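(* Let $\beta\in(0,1)$, $0<T<\infty$. Suppose that either $g\in C(0,T]$ satisfies $|g(x)|\le Mx^{\alpha-\beta}$ for some $M,\alpha>0$ and all $x\in(0,T]$, or $g\in B[0,T]$. Then $I_0^\beta g\in C_\infty(0,T]$, and for all $x\in(0,T]$, $$I_0^\beta g(x)=\mathbb E_x\left[\int_0^{\tau_\infty}g(S^c_s)\,ds\right].$$
   Context: Fix $\beta\in(0,1)$ and $0<T<\infty$. $B[0,T]$ is the set of bounded Borel measurable real functions on $[0,T]$; $C_\infty(0,T]=\{u\in C[0,T]:u(0)=0\}$. $J_0^\beta g(x)=\int_0^x\frac{(x-r)^{\beta-1}}{\Gamma(\beta)}g(r)\,dr$ for $x\in(0,T]$ and $J_0^\beta g(0)=0$. For $\psi\in C[0,T]$, $\mathcal K\psi(x)=\int_0^x\frac{(x-r)^{\beta-1}r^{-\beta}}{\Gamma(\beta)\Gamma(1-\beta)}\psi(r)\,dr$ for $x>0$, $\mathcal K\psi(0)=\psi(0)$. Define $I_0^\beta g=\sum_{j=0}^\infty\mathcal K^jJ_0^\beta g$ ($\mathcal K^0$ the identity). A $\beta$-stable subordinator is a (càdlàg) Lévy process $-S=\{-S_s\}_{s\ge0}$ started at $0$ with $\mathbb E[\exp\{kS_s\}]=\exp\{-sk^\beta\}$, $k,s>0$. Let $\{-S^j\}_{j\in\mathbb N}$ be i.i.d. $\beta$-stable subordinators. For a starting point $x>0$ define recursively $\tau_0=0$; $\widetilde S^1_t=x+S^1_t$; for $j\ge2$, $\widetilde S^j_t=\widetilde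 S^{j-1}_{\tau_{j-1}-}+S^j_{t-\tau_{j-1}}$; $\tau_j=\inf\{s>\tau_{j-1}:\widetilde S^j_s\le0\}$; $\tau_\infty=\lim_{j\to\infty}\tau_j$ (where $Y_{t-}$ denotes the left limit). The censored decreasing $\beta$-stable process started at $S^c_0=x$ is $S^c_t=\widetilde S^j_t$ for $\tau_{j-1}\le t<\tau_j$, $j\in\mathbb N$, and $S^c_t=\partial$ (a cemetery state) for $t\ge\tau_\infty$. $\mathbb E_x$ is expectation given $S^c_0=x$. *)

theory Defs
  imports "HOL-Probability.Probability"
begin

definition C_infty :: "real \<Rightarrow> (real \<Rightarrow> real) set" where
  "C_infty T = {u. continuous_on {0..T} u \<and> u 0 = 0}"

definition bounded_borel :: "real \<Rightarrow> (real \<Rightarrow> real) set" where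
  "bounded_borel T = {g. g \<in> borel_measurable (restrict_space borel {0..T}) \<and> bounded (g ` {0..T})}"

text \<open>
  Functions on \<open>[0,T]\<close> or \<open>(0,T]\<close> are total functions on the reals. The values of \<open>J_op \<beta> g\<close> and
  \<open>K_op \<beta> \<psi>\<close> at \<open>x\<close> only depend on the restriction of the argument to \<open>(0,x)\<close> (to \<open>{0}\<close> for
  \<open>K_op \<beta> \<psi> 0\<close>), so values outside the interval are irrelevant.
\<close>

definition J_op :: "real \<Rightarrow> (real \<Rightarrow> real) \<Rightarrow> real \<Rightarrow> real" where
  "J_op \<beta> g x =
     (if x = 0 then 0
      else LINT r:{0<..<x}|lborel. (x - r) powr (\<beta> - 1) / Gamma \<beta> * g r)"

definition K_op :: "real \<Rightarrow> (real \<Rightarrow> real) \<Rightarrow> real \<Rightarrow> real" where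
  "K_op \<beta> \<psi> x =
     (if x = 0 then \<psi> 0
      else LINT r:{0<..<x}|lborel.
             (x - r) powr (\<beta> - 1) * r powr (- \<beta>) / (Gamma \<beta> * Gamma (1 - \<beta>)) * \<psi> r)"

definition I_op :: "real \<Rightarrow> (real \<Rightarrow> real) \<Rightarrow> real \<Rightarrow> real" where
  "I_op \<beta> g x = (\<Sum>j. (K_op \<beta> ^^ j) (J_op \<beta> g) x)"


definition cadlag :: "(real \<Rightarrow> real) \<Rightarrow> bool" where
  "cadlag f \<longleftrightarrow>
     (\<forall>t\<ge>0. (f \<longlongrightarrow> f t) (at_right t)) \<and> (\<forall>t>0. \<exists>l. (f \<longlongrightarrow> l) (at_left t))"

text \<open>Processes are indexed by all reals, but only times \<open>t \<ge> 0\<close> matter.\<close>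

definition levy_process :: "'w measure \<Rightarrow> (real \<Rightarrow> 'w \<Rightarrow> real) \<Rightarrow> bool" where
  "levy_process M Y \<longleftrightarrow>
     prob_space M \<and>
     (\<forall>t\<ge>0. Y t \<in> borel_measurable M) \<and>
     (AE \<omega> in M. Y 0 \<omega> = 0) \<and>
     (\<forall>(n::nat) (t :: nat \<Rightarrow> real). 0 \<le> t 0 \<and> (\<forall>i<n. t i \<le> t (Suc i)) \<longrightarrow>
        prob_space.indep_vars M (\<lambda>_. borel) (\<lambda>i \<omega>. Y (t (Suc i)) \<omega> - Y (t i) \<omega>) {..<n}) \<and>
     (\<forall>s\<ge>0. \<forall>t\<ge>0. distr M borel (\<lambda>\<omega>. Y (s + t) \<omega> - Y s \<omega>) = distr M borel (Y t)) \<and>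
     (AE \<omega> in M. cadlag (\<lambda>t. Y t \<omega>))"

text \<open>
  Monotonicity of almost every path is not required separately: it follows from the Laplace
  transform and the path regularity.
\<close>

definition stable_subordinator :: "'w measure \<Rightarrow> real \<Rightarrow> (real \<Rightarrow> 'w \<Rightarrow> real) \<Rightarrow> bool" where
  "stable_subordinator M \<beta> Y \<longleftrightarrow>
     levy_process M Y \<and>
     (\<forall>k>0. \<forall>s>0. (LINT \<omega>|M. exp (k * (- Y s \<omega>))) = exp (- s * k powr \<beta>))"

text \<open>
  Independence and equality in law are those of the whole processes, viewed as random elements
  of the product space over the times \<open>[0,\<infinity>)\<close>. The sequence is indexed by \<open>1, 2, \<dots>\<close>.
\<close>

definition iid_stable_subordinators ::
    "'w measure \<Rightarrow> real \<Rightarrow> (nat \<Rightarrow> real \<Rightarrow> 'w \<Rightarrow> real) \<Rightarrow> bool" where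
  "iid_stable_subordinators M \<beta> Y \<longleftrightarrow>
     (\<forall>j\<ge>1. stable_subordinator M \<beta> (Y j)) \<and>
     prob_space.indep_vars M (\<lambda>_. \<Pi>\<^sub>M t\<in>{0..}. borel) (\<lambda>j \<omega>. \<lambda>t\<in>{0..}. Y j t \<omega>) {1..} \<and>
     (\<forall>i\<ge>1. \<forall>j\<ge>1. distr M (\<Pi>\<^sub>M t\<in>{0..}. borel) (\<lambda>\<omega>. \<lambda>t\<in>{0..}. Y i t \<omega>) =
                      distr M (\<Pi>\<^sub>M t\<in>{0..}. borel) (\<lambda>\<omega>. \<lambda>t\<in>{0..}. Y j t \<omega>))"


text \<open>
  The censored process is a functional of the start \<open>x\<close> and of the realised paths \<open>S j\<close>,
  \<open>j \<ge> 1\<close>. The times \<open>cens_time x S j\<close> (that is, \<open>\<tau>\<^sub>j\<close>) are extended reals, with \<open>inf \<emptyset> = \<infinity>\<close>; if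
  \<open>\<tau>\<^sub>j = \<infinity>\<close>, then all later times are infinite too and the real part taken of \<open>\<tau>\<^sub>j\<close> in the next
  path is irrelevant. \<open>cens_path x S j\<close> is the path with index \<open>j \<ge> 1\<close>; its value for \<open>j = 0\<close> is a
  dummy that is never used.
\<close>

fun cens_time :: "real \<Rightarrow> (nat \<Rightarrow> real \<Rightarrow> real) \<Rightarrow> nat \<Rightarrow> ereal"
  and cens_path :: "real \<Rightarrow> (nat \<Rightarrow> real \<Rightarrow> real) \<Rightarrow> nat \<Rightarrow> real \<Rightarrow> real" where
  "cens_time x S 0 = 0"
| "cens_time x S (Suc j) =
     Inf {ereal s | s. cens_time x S j < ereal s \<and> cens_path x S (Suc j) s \<le> 0}"
| "cens_path x S 0 = (\<lambda>t. x)"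
| "cens_path x S (Suc 0) = (\<lambda>t. x + S 1 t)"
| "cens_path x S (Suc (Suc j)) =
     (\<lambda>t. Lim (at_left (real_of_ereal (cens_time x S (Suc j)))) (cens_path x S (Suc j))
          + S (Suc (Suc j)) (t - real_of_ereal (cens_time x S (Suc j))))"

definition cens_lifetime :: "real \<Rightarrow> (nat \<Rightarrow> real \<Rightarrow> real) \<Rightarrow> ereal" where
  "cens_lifetime x S = lim (cens_time x S)"

text \<open>The cemetery state is \<open>None\<close>.\<close>

definition cens_proc :: "real \<Rightarrow> (nat \<Rightarrow> real \<Rightarrow> real) \<Rightarrow> real \<Rightarrow> real option" where
  "cens_proc x S t =
     (if ereal t < cens_lifetime x S
      then Some (cens_path x S
             (THE j. 1 \<le> j \<and> cens_time x S (j - 1) \<le> ereal t \<and> ereal t < cens_time x S j) t)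
      else None)"

definition alive_times :: "real \<Rightarrow> (nat \<Rightarrow> real \<Rightarrow> real) \<Rightarrow> real set" where
  "alive_times x S = {s. 0 \<le> s \<and> ereal s < cens_lifetime x S}"

definition occupation_integral :: "(real \<Rightarrow> real) \<Rightarrow> real \<Rightarrow> (nat \<Rightarrow> real \<Rightarrow> real) \<Rightarrow> real" where
  "occupation_integral g x S =
     (LINT s:alive_times x S|lborel. g (the (cens_proc x S s)))"

end

theory Submission
  imports Defs "HOL-Real_Asymp.Real_Asymp"
begin

text \<open>
  Let \<open>-S\<close> be a single \<open>\<beta>\<close>-stable subordinator. Its potential measure has density
  \<open>y powr (\<beta> - 1) / Gamma \<beta>\<close>, since its Laplace transform at \<open>k\<close> is the integral of
  \<open>exp (- s * k powr \<beta>)\<close> over \<open>s\<close>. Hence \<open>J\<close> is the expected occupation integral up to the first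
  passage below \<open>0\<close>. The position just before that passage is distributed according to the kernel
  of \<open>K\<close>: sampling the path on dyadic grids, independence and stationarity of the increments give
  the double Laplace transform of the undershoot as a geometric series, with limit
  \<open>q powr (\<beta> - 1) * (k + q) powr (- \<beta>)\<close>, and the remaining exceptional null set of starting
  points is removed by left continuity. This route uses neither the Levy measure nor the
  compensation formula.

  In the censored process, the position from which the path with index \<open>j + 1\<close> starts depends on
  the paths \<open>1, \<dots>, j\<close> only and is therefore independent of it, so the \<open>j\<close>-th piece contributes
  \<open>K^j J g\<close>. Powers \<open>x powr \<alpha>\<close> are eigenfunctions of \<open>K\<close> with an eigenvalue less than \<open>1\<close>,
  which yields geometric convergence of the series.
\<close>

text \<open>Two obstacles shape the proof. First, \<open>K_op\<close> fixes constants, because its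
  kernel is a probability density on (0,x). On continuous functions alone there is thus no
  contraction; the gain comes from the decay of \<open>J_op \<beta> g\<close> at 0, and this is why
  every estimate is weighted by a power of the argument. Second, independence is given on the
  product space over uncountably many times, where a first passage time is not a measurable
  functional. The probabilistic part therefore uses functionals of countably many dyadic
  coordinates, which agree with the true ones on almost every path. The actual occupation integral
  is controlled off a null set only, which is why the expectation lives on the completion. Up to the
  last step all quantities are nonnegative and take values in \<open>ennreal\<close>, so sums,
  integrals and expectations can be exchanged without integrability; signed functions enter by
  splitting into positive and negative parts.\<close>

subsection \<open>Measures determined by their Laplace transform\<close>

text \<open>Integrate the exponential series term by term: on [0,1] its partial sums are dominated
  by the constant \<open>exp \<bar>t\<bar>\<close>. A characteristic function is thus computable
  from the moments.\<close>

lemma iexp_integral_LIMSEQ: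
  fixes M :: "real measure" and t :: real
  assumes "finite_measure M" and [measurable_cong]: "sets M = sets borel"
    and "AE x in M. 0 \<le> x \<and> x \<le> 1"
  shows "(\<lambda>n. \<Sum>k<n. (\<i> * complex_of_real t) ^ k / fact k * complex_of_real (LINT x|M. x ^ k))
           \<longlonglongrightarrow> (CLINT x|M. iexp (t * x))"
proof -
  interpret finite_measure M by fact
  define s where "s n x = (\<Sum>k<n. (\<i> * complex_of_real t) ^ k / fact k * complex_of_real (x ^ k))" for n x
  have int: "integrable M (\<lambda>x. complex_of_real (x ^ k))" for k :: nat
  proof (rule integrable_const_bound[where B=1])
    show "AE x in M. norm (complex_of_real (x ^ k)) \<le> 1"
      using assms(3) by eventually_elim (simp add: norm_power power_le_one)
  qed simp
  have eq: "(CLINT x|M. s n x) = (\<Sum>k<n. (\<i> * complex_of_real t) ^ k / fact k * complex_of_real (LINT x|M. x ^ k))" for n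
    unfolding s_def
    by (subst Bochner_Integration.integral_sum)
       (use int in \<open>auto simp del: of_real_power simp: integral_complex_of_real\<close>)
  have "(\<lambda>n. CLINT x|M. s n x) \<longlonglongrightarrow> (CLINT x|M. iexp (t * x))"
  proof (rule integral_dominated_convergence[where w="\<lambda>_. exp \<bar>t\<bar>"])
    show "AE x in M. (\<lambda>n. s n x) \<longlonglongrightarrow> iexp (t * x)"
    proof (rule AE_I2)
      fix x
      have "(\<lambda>k. (\<i> * complex_of_real (t * x)) ^ k /\<^sub>R fact k) sums iexp (t * x)"
        by (rule exp_converges)
      moreover have "(\<i> * complex_of_real (t * x)) ^ k /\<^sub>R fact k =
          (\<i> * complex_of_real t) ^ k / fact k * complex_of_real (x ^ k)" for k
        by (simp add: scaleR_conv_of_real power_mult_distrib field_simps)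
      ultimately show "(\<lambda>n. s n x) \<longlonglongrightarrow> iexp (t * x)"
        unfolding sums_def s_def by (simp only:)
    qed
    show "AE x in M. norm (s n x) \<le> exp \<bar>t\<bar>" for n
      using assms(3)
    proof eventually_elim
      case (elim x)
      have "norm (s n x) \<le> (\<Sum>k<n. norm ((\<i> * complex_of_real t) ^ k / fact k * complex_of_real (x ^ k)))"
        unfolding s_def by (rule norm_sum)
      also have "\<dots> \<le> (\<Sum>k<n. \<bar>t\<bar> ^ k /\<^sub>R fact k)"
      proof (rule sum_mono)
        fix k
        have "norm ((\<i> * complex_of_real t) ^ k / fact k * complex_of_real (x ^ k)) =
            (\<bar>t\<bar> ^ k /\<^sub>R fact k) * x ^ k"
          using elim by (simp add: norm_mult norm_divide norm_power norm_fact divide_inverse[where 'a=real] flip: divide_inverse_commute)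
        also have "\<dots> \<le> \<bar>t\<bar> ^ k /\<^sub>R fact k"
          using elim by (intro mult_left_le) (auto intro: power_le_one)
        finally show "norm ((\<i> * complex_of_real t) ^ k / fact k * complex_of_real (x ^ k)) \<le> \<bar>t\<bar> ^ k /\<^sub>R fact k" .
      qed
      also have "\<dots> \<le> exp \<bar>t\<bar>"
        using summable_exp_generic[of "\<bar>t\<bar>"] unfolding exp_def
        by (intro sum_le_suminf) auto
      finally show ?case .
    qed
    show "s n \<in> borel_measurable M" for n unfolding s_def by measurable
  qed (auto intro!: borel_measurable_integrable)
  then show ?thesis unfolding eq .
qed

text \<open>Equal moments give equal characteristic functions by the preceding expansion.
  \<open>Levy_uniqueness\<close> concerns probability measures, so both measures are divided by
  their common mass, the zeroth moment; mass 0 is a separate case.\<close>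

lemma measure_eqI_moments:
  fixes M N :: "real measure"
  assumes M: "finite_measure M" "sets M = sets borel" "AE x in M. 0 \<le> x \<and> x \<le> 1"
    and N: "finite_measure N" "sets N = sets borel" "AE x in N. 0 \<le> x \<and> x \<le> 1"
    and mom: "\<And>n::nat. (LINT x|M. x ^ n) = (LINT x|N. x ^ n)"
  shows "M = N"
proof -
  interpret M: finite_measure M by fact
  interpret N: finite_measure N by fact
  note [measurable_cong] = M(2) N(2)
  have sp: "space M = UNIV" "space N = UNIV" using sets_eq_imp_space_eq[OF M(2)] sets_eq_imp_space_eq[OF N(2)] by simp_all
  define c where "c = measure M UNIV"
  have c: "measure N UNIV = c" using mom[of 0] sp by (simp add: c_def)
  have ch: "(CLINT x|M. iexp (t * x)) = (CLINT x|N. iexp (t * x))" for t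
    using iexp_integral_LIMSEQ[OF M, of t] iexp_integral_LIMSEQ[OF N, of t]
    unfolding mom by (rule LIMSEQ_unique)
  show ?thesis
  proof (cases "c = 0")
    case True
    have "emeasure M A = 0" "emeasure N A = 0" for A
      using emeasure_mono[of A UNIV M] emeasure_mono[of A UNIV N] True c
      by (auto simp: c_def M.emeasure_eq_measure N.emeasure_eq_measure M(2) N(2) measure_le_0_iff)
    then show ?thesis by (intro measure_eqI) (simp_all add: M(2) N(2))
  next
    case False
    then have "c > 0" by (simp add: c_def zero_less_measure_iff)
    have rd: "real_distribution (density L (\<lambda>_. ennreal (1 / c)))"
      if "finite_measure L" "sets L = sets borel" "measure L UNIV = c" for L :: "real measure"
    proof -
      have spL: "space L = UNIV" using sets_eq_imp_space_eq[OF that(2)] by simp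
      have "emeasure (density L (\<lambda>_. ennreal (1 / c))) UNIV = 1"
        using that \<open>c > 0\<close> spL
        by (subst emeasure_density)
           (simp_all add: nn_integral_cmult finite_measure.emeasure_eq_measure ennreal_mult'[symmetric])
      then show ?thesis using that spL
        by (intro real_distribution.intro real_distribution_axioms.intro prob_spaceI) simp_all
    qed
    have "density M (\<lambda>_. ennreal (1 / c)) = density N (\<lambda>_. ennreal (1 / c))"
    proof (rule Levy_uniqueness)
      show "char (density M (\<lambda>_. ennreal (1 / c))) = char (density N (\<lambda>_. ennreal (1 / c)))"
        unfolding char_def using ch \<open>c > 0\<close>
        by (intro ext, subst (1 2) integral_density) (auto simp: mult.commute)
    qed (use rd M N c c_def in auto)
    then have "density (density M (\<lambda>_. ennreal (1 / c))) (\<lambda>_. ennreal c) =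
               density (density N (\<lambda>_. ennreal (1 / c))) (\<lambda>_. ennreal c)" by simp
    then show ?thesis using \<open>c > 0\<close>
      by (simp add: density_density_eq ennreal_mult'[symmetric] density_1)
  qed
qed

text \<open>The measures may be infinite. Tilting by exp (- x) makes them finite, and u = exp (- x)
  carries them to [0,1], where the n-th moment is the Laplace transform at n + 1. Uniqueness for
  moments then applies.\<close>

lemma measure_eqI_Laplace:
  fixes M N :: "real measure"
  assumes M: "sets M = sets borel" "emeasure M {..<0} = 0"
    and N: "sets N = sets borel" "emeasure N {..<0} = 0"
    and eq: "\<And>k. k > 0 \<Longrightarrow> (\<integral>\<^sup>+x. ennreal (exp (- k * x)) \<partial>M) = (\<integral>\<^sup>+x. ennreal (exp (- k * x)) \<partial>N)"
    and fin: "(\<integral>\<^sup>+x. ennreal (exp (- x)) \<partial>M) < \<infinity>"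
  shows "M = N"
proof -
  define D where "D L = distr (density L (\<lambda>x. ennreal (exp (- x)))) borel (\<lambda>x::real. exp (- x))" for L
  note [measurable_cong] = M(1) N(1)
  have finN: "(\<integral>\<^sup>+x. ennreal (exp (- x)) \<partial>N) < \<infinity>" using fin eq[of 1] by simp
  have mom: "(\<integral>\<^sup>+x. ennreal (x ^ n) \<partial>D L) = (\<integral>\<^sup>+x. ennreal (exp (- (real n + 1) * x)) \<partial>L)"
    if [measurable_cong]: "sets L = sets borel" for L and n :: nat
    unfolding D_def
    by (subst nn_integral_distr, simp, simp, subst nn_integral_density, simp, simp)
       (auto intro!: nn_integral_cong simp: ennreal_mult'[symmetric] exp_of_nat_mult[symmetric] exp_add[symmetric] algebra_simps
         simp flip: exp_of_nat_mult)
  have good: "finite_measure (D L)" "AE x in D L. 0 \<le> x \<and> x \<le> 1" "sets (D L) = sets borel"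
    if [measurable_cong]: "sets L = sets borel" and null: "emeasure L {..<0} = 0" and f: "(\<integral>\<^sup>+x. ennreal (exp (- x)) \<partial>L) < \<infinity>" for L
  proof -
    have "emeasure (D L) (space (D L)) = (\<integral>\<^sup>+x. ennreal (x ^ 0) \<partial>D L)" by simp
    also have "\<dots> < \<infinity>" using f mom[OF that(1), of 0] by simp
    finally show "finite_measure (D L)" by (intro finite_measureI) auto
    have "AE x in L. \<not> x < 0"
      by (rule AE_I[where N="{..<0}"]) (use null that(1) in auto)
    then show "AE x in D L. 0 \<le> x \<and> x \<le> 1"
      unfolding D_def by (subst AE_distr_iff, simp, simp, subst AE_density, simp) auto
    show "sets (D L) = sets borel" by (simp add: D_def)
  qed
  have "D M = D N"
  proof (rule measure_eqI_moments)
    fix n :: nat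
    have "(LINT x|D L. x ^ n) = enn2real (\<integral>\<^sup>+x. ennreal (exp (- (real n + 1) * x)) \<partial>L)"
      if s: "sets L = sets borel" "emeasure L {..<0} = 0" "(\<integral>\<^sup>+x. ennreal (exp (- x)) \<partial>L) < \<infinity>" for L
    proof -
      note [measurable_cong] = good(3)[OF s]
      have "(LINT x|D L. x ^ n) = enn2real (\<integral>\<^sup>+x. ennreal (x ^ n) \<partial>D L)"
        using good(2)[OF s] by (intro integral_eq_nn_integral) auto
      then show ?thesis using mom[OF s(1)] by simp
    qed
    then show "(LINT x|D M. x ^ n) = (LINT x|D N. x ^ n)"
      using M N fin finN eq[of "real n + 1"] by simp
  qed (use good M N fin finN in auto)
  \<comment> \<open>The passage to \<open>D L\<close> loses nothing: x = - ln u followed by the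
    density exp x inverts it.\<close>
  moreover have "density (distr (D L) borel (\<lambda>x. - ln x)) (\<lambda>x. ennreal (exp x)) = L"
    if [measurable_cong]: "sets L = sets borel" for L
  proof -
    have "distr (D L) borel (\<lambda>x. - ln x) = distr (density L (\<lambda>x. ennreal (exp (- x)))) borel (\<lambda>x. x)"
      unfolding D_def by (subst distr_distr) (auto simp: o_def)
    also have "\<dots> = density L (\<lambda>x. ennreal (exp (- x)))"
      by (rule distr_id2) (simp add: that)
    finally have "density (distr (D L) borel (\<lambda>x. - ln x)) (\<lambda>x. ennreal (exp x)) =
        density L (\<lambda>x. ennreal (exp (- x)) * ennreal (exp x))"
      by (simp add: density_density_eq)
    also have "(\<lambda>x. ennreal (exp (- x)) * ennreal (exp x)) = (\<lambda>_. 1)"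
      by (auto simp: ennreal_mult'[symmetric] exp_add[symmetric])
    finally show ?thesis by (simp add: density_1)
  qed
  ultimately show ?thesis using M(1) N(1) by metis
qed

subsection \<open>The fractional kernel\<close>

lemma nn_integral_Gamma_scaled:
  fixes a k :: real
  assumes "a > 0" "k > 0"
  shows "(\<integral>\<^sup>+y. ennreal (exp (- k * y) * y powr (a - 1)) * indicator {0<..} y \<partial>lborel) =
         ennreal (Gamma a * k powr (- a))"
proof -
  have "ennreal (Gamma a) = ennreal k * (\<integral>\<^sup>+y. ennreal (indicator {0..} (k * y) * (k * y) powr (a - 1) / exp (k * y)) \<partial>lborel)"
    using assms by (subst Gamma_conv_nn_integral_real, simp, subst nn_integral_real_affine[where c=k and t=0]) simp_all
  then have "ennreal (k powr (- a)) * ennreal (Gamma a) = ennreal (k powr (- a) * k) *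
      (\<integral>\<^sup>+y. ennreal (indicator {0..} (k * y) * (k * y) powr (a - 1) / exp (k * y)) \<partial>lborel)"
    using assms by (simp add: ennreal_mult mult.assoc)
  also have "\<dots> = (\<integral>\<^sup>+y. ennreal (k powr (- a) * k) * ennreal (indicator {0..} (k * y) * (k * y) powr (a - 1) / exp (k * y)) \<partial>lborel)"
    by (rule nn_integral_cmult[symmetric]) measurable
  also have "\<dots> = (\<integral>\<^sup>+y. ennreal (exp (- k * y) * y powr (a - 1)) * indicator {0<..} y \<partial>lborel)"
  proof (rule nn_integral_cong)
    fix y :: real
    show "ennreal (k powr (- a) * k) * ennreal (indicator {0..} (k * y) * (k * y) powr (a - 1) / exp (k * y)) =
          ennreal (exp (- k * y) * y powr (a - 1)) * indicator {0<..} y"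
    proof (cases "y > 0")
      case True
      have "k powr (- a) * k * (k powr (a - 1)) = 1"
        using assms by (simp add: powr_minus powr_diff field_simps)
      then have "k powr (- a) * k * ((k * y) powr (a - 1) / exp (k * y)) = exp (- k * y) * y powr (a - 1)"
        using assms True by (simp add: powr_mult exp_minus field_simps)
      then show ?thesis using True assms
        by (simp add: ennreal_mult'[symmetric])
    next
      case False
      then have "y = 0 \<or> k * y < 0" using assms by (auto simp: mult_less_0_iff)
      then show ?thesis using False by auto
    qed
  qed
  finally show ?thesis using assms by (simp add: ennreal_mult'[symmetric] mult.commute Gamma_real_pos less_imp_le)
qed

text \<open>Substitute r = x * u. With \<open>a\<close> = \<beta> and \<open>b\<close> = \<alpha> -
  \<beta> + 1 this is the eigenvalue computation of \<open>K_op\<close> for r powr \<alpha>.\<close>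

lemma nn_integral_Beta_scaled:
  fixes a b x :: real
  assumes "a > 0" "b > 0" "x > 0"
  shows "(\<integral>\<^sup>+r. ennreal ((x - r) powr (a - 1) * r powr (b - 1)) * indicator {0<..<x} r \<partial>lborel) =
         ennreal (Beta a b * x powr (a + b - 1))"
proof -
  have "ennreal (Beta b a) = (\<integral>\<^sup>+u. ennreal (indicator {0..1} u * (u powr (b - 1) * (1 - u) powr (a - 1))) \<partial>lborel)"
    by (subst nn_integral_has_integral_lebesgue[OF _ has_integral_Beta_real]) (use assms in auto)
  have "(\<integral>\<^sup>+r. ennreal ((x - r) powr (a - 1) * r powr (b - 1)) * indicator {0<..<x} r \<partial>lborel) =
     ennreal x * (\<integral>\<^sup>+u. ennreal ((x - x * u) powr (a - 1) * (x * u) powr (b - 1)) * indicator {0<..<x} (x * u) \<partial>lborel)"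
    using assms by (subst nn_integral_real_affine[where c=x and t=0]) simp_all
  also have "\<dots> = (\<integral>\<^sup>+u. ennreal x * (ennreal ((x - x * u) powr (a - 1) * (x * u) powr (b - 1)) * indicator {0<..<x} (x * u)) \<partial>lborel)"
    by (rule nn_integral_cmult[symmetric]) measurable
  also have "\<dots> = (\<integral>\<^sup>+u. ennreal (x powr (a + b - 1)) * ennreal (indicator {0..1} u * (u powr (b - 1) * (1 - u) powr (a - 1))) \<partial>lborel)"
  proof (rule nn_integral_cong)
    fix u :: real
    show "ennreal x * (ennreal ((x - x * u) powr (a - 1) * (x * u) powr (b - 1)) * indicator {0<..<x} (x * u)) =
       ennreal (x powr (a + b - 1)) * ennreal (indicator {0..1} u * (u powr (b - 1) * (1 - u) powr (a - 1)))"
    proof (cases "0 < u \<and> u < 1")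
      case True
      have "x * (x powr (a - 1) * x powr (b - 1)) = x powr (a + b - 1)"
        using assms by (simp add: powr_diff powr_add field_simps)
      moreover have "(x - x * u) powr (a - 1) = x powr (a - 1) * (1 - u) powr (a - 1)"
        using assms True by (subst powr_mult[symmetric]) (auto simp: algebra_simps)
      moreover have "(x * u) powr (b - 1) = x powr (b - 1) * u powr (b - 1)"
        using assms True by (subst powr_mult) auto
      ultimately have "x * ((x - x * u) powr (a - 1) * (x * u) powr (b - 1)) =
           x powr (a + b - 1) * (u powr (b - 1) * (1 - u) powr (a - 1))"
        by (simp add: mult_ac)
      then show ?thesis using True assms by (simp add: ennreal_mult'[symmetric])
    next
      case False
      then have "x * u \<notin> {0<..<x}" using assms by (auto simp: zero_less_mult_iff)
      moreover have "indicator {0..1} u * (u powr (b - 1) * (1 - u) powr (a - 1)) = 0"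
        using False by (cases "u = 0 \<or> u = 1") (auto simp: indicator_def)
      ultimately show ?thesis by simp
    qed
  qed
  also have "\<dots> = ennreal (x powr (a + b - 1)) * ennreal (Beta b a)"
    by (subst nn_integral_cmult) (auto simp: \<open>ennreal (Beta b a) = _\<close>)
  finally show ?thesis using assms by (simp add: ennreal_mult''[symmetric] mult.commute Beta_commute)
qed

text \<open>On (0,1) the factor u powr c is less than 1, so the integrands are strictly ordered
  there. Equal integrals would make the difference vanish almost everywhere, although it is positive
  on a set of measure 1. This strictness makes \<open>contraction\<close> less than 1.\<close>

lemma Beta_strict_decreasing:
  fixes a b c :: real
  assumes "a > 0" "b > 0" "c > 0"
  shows "Beta a (b + c) < Beta a b"
proof -
  define f where "f u = indicator {0<..<1} u *\<^sub>R ((1 - u) powr (a - 1) * u powr (b - 1))" for u :: real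
  define h where "h u = indicator {0<..<1} u *\<^sub>R ((1 - u) powr (a - 1) * u powr (b + c - 1))" for u :: real
  have f: "has_bochner_integral lborel f (Beta a b)"
    using nn_integral_Beta_scaled[OF assms(1,2) zero_less_one] assms unfolding f_def
    by (intro has_bochner_integral_nn_integral)
       (auto simp: indicator_mult_ennreal mult.commute Beta_def Gamma_real_pos less_imp_le intro!: divide_nonneg_pos)
  have h: "has_bochner_integral lborel h (Beta a (b + c))"
    using nn_integral_Beta_scaled[OF assms(1) _ zero_less_one, of "b + c"] assms unfolding h_def
    by (intro has_bochner_integral_nn_integral)
       (auto simp: indicator_mult_ennreal mult.commute Beta_def Gamma_real_pos less_imp_le intro!: divide_nonneg_pos)
  have d: "has_bochner_integral lborel (\<lambda>u. f u - h u) (Beta a b - Beta a (b + c))"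
    by (rule has_bochner_integral_diff[OF f h])
  have pos: "f u - h u > 0" if "0 < u" "u < 1" for u
  proof -
    have "u powr (b + c - 1) < u powr (b - 1)" using that assms by (intro powr_less_mono') auto
    then show ?thesis using that by (simp add: f_def h_def)
  qed
  have nn: "f u - h u \<ge> 0" for u
    using pos[of u] by (cases "0 < u \<and> u < 1") (auto simp: f_def h_def)
  have "Beta a b - Beta a (b + c) \<ge> 0"
    using d nn by (metis has_bochner_integral_integral_eq integral_nonneg_AE AE_I2)
  moreover have "Beta a b - Beta a (b + c) \<noteq> 0"
  proof
    assume "Beta a b - Beta a (b + c) = 0"
    then have "integral\<^sup>L lborel (\<lambda>u. f u - h u) = 0"
      using has_bochner_integral_integral_eq[OF d] by simp
    then have "AE u in lborel. f u - h u = 0"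
      using integral_nonneg_eq_0_iff_AE[OF integrable.intros[OF d]] nn by blast
    then have ae: "AE u in lborel. u \<notin> {0<..<1::real}"
    proof eventually_elim
      case (elim u)
      show ?case
      proof
        assume "u \<in> {0<..<1}"
        then show False using pos[of u] elim by simp
      qed
    qed
    have "{u \<in> space lborel. \<not> u \<notin> {0<..<1::real}} = {0<..<1}" by auto
    from iffD1[OF AE_iff_measurable[OF _ this] ae] have "emeasure lborel {0<..<1::real} = 0" by simp
    then show False by simp
  qed
  ultimately show ?thesis by simp
qed

lemma Beta_nonneg_real: "a > 0 \<Longrightarrow> b > 0 \<Longrightarrow> 0 \<le> Beta a (b::real)"
  by (simp add: Beta_def Gamma_real_pos less_imp_le)

lemma has_bochner_integral_Beta_scaled:
  fixes a b x :: real
  assumes "a > 0" "b > 0" "x > 0"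
  shows "has_bochner_integral lborel (\<lambda>r. indicator {0<..<x} r *\<^sub>R ((x - r) powr (a - 1) * r powr (b - 1)))
           (Beta a b * x powr (a + b - 1))"
  using nn_integral_Beta_scaled[OF assms] assms Beta_nonneg_real[OF assms(1,2)]
  by (intro has_bochner_integral_nn_integral) (auto simp: indicator_mult_ennreal mult.commute)

text \<open>After a power weight is taken out of the argument, \<open>J_op\<close>,
  \<open>K_op\<close> and the transform of the arcsine law are all integrals of a bounded function
  against this Beta kernel, so one continuity statement serves all three.\<close>

definition frac_kernel :: "real \<Rightarrow> real \<Rightarrow> real \<Rightarrow> real \<Rightarrow> real" where
  "frac_kernel a b x r = indicator {0<..<x} r *\<^sub>R ((x - r) powr (a - 1) * r powr (b - 1))"

lemma frac_kernel_measurable [measurable]: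
  "(\<lambda>p. frac_kernel a b (fst p) (snd p)) \<in> borel_measurable (borel \<Otimes>\<^sub>M borel)"
proof -
  have "(\<lambda>p. frac_kernel a b (fst p) (snd p)) =
    (\<lambda>p. if 0 < snd p \<and> snd p < fst p then (fst p - snd p) powr (a - 1) * snd p powr (b - 1) else 0)"
    by (auto simp: frac_kernel_def indicator_def fun_eq_iff)
  then show ?thesis by simp
qed

lemma frac_kernel_measurable1 [measurable]: "frac_kernel a b x \<in> borel_measurable borel"
  unfolding frac_kernel_def by measurable

lemma frac_kernel_nonneg [simp]: "0 \<le> frac_kernel a b x r"
  by (simp add: frac_kernel_def)

lemma frac_kernel_weighted:
  fixes a b x :: real
  assumes ab: "a > 0" "b > 0" and x: "x > 0"
    and [measurable]: "\<phi> \<in> borel_measurable borel" and bd: "\<And>r. r > 0 \<Longrightarrow> \<bar>\<phi> r\<bar> \<le> C"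
  shows "integrable lborel (\<lambda>r. frac_kernel a b x r * \<phi> r)"
    and "\<bar>LINT r|lborel. frac_kernel a b x r * \<phi> r\<bar> \<le> C * Beta a b * x powr (a + b - 1)"
proof -
  note hb = has_bochner_integral_Beta_scaled[OF ab x, folded frac_kernel_def]
  have le: "\<bar>frac_kernel a b x r * \<phi> r\<bar> \<le> C * frac_kernel a b x r" for r
    using bd[of r] by (auto simp: frac_kernel_def indicator_def abs_mult mult.commute intro!: mult_left_mono)
  have int: "integrable lborel (\<lambda>r. C * frac_kernel a b x r)"
    using hb by (intro integrable_mult_right) (auto simp: integrable.simps)
  show 1: "integrable lborel (\<lambda>r. frac_kernel a b x r * \<phi> r)"
    by (rule Bochner_Integration.integrable_bound[OF int]) (use le in \<open>auto intro: order.trans[OF _ abs_ge_self]\<close>)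
  have "\<bar>LINT r|lborel. frac_kernel a b x r * \<phi> r\<bar> \<le> (LINT r|lborel. \<bar>frac_kernel a b x r * \<phi> r\<bar>)"
    by (rule integral_abs_bound)
  also have "\<dots> \<le> (LINT r|lborel. C * frac_kernel a b x r)"
    by (rule integral_mono) (use 1 int le in auto)
  also have "\<dots> = C * Beta a b * x powr (a + b - 1)"
    using has_bochner_integral_integral_eq[OF hb] by simp
  finally show "\<bar>LINT r|lborel. frac_kernel a b x r * \<phi> r\<bar> \<le> C * Beta a b * x powr (a + b - 1)" .
qed

text \<open>For \<open>a\<close> < 1 the singularity at r = x moves with x. The kernels are
  therefore compared by Scheffe's lemma: they converge almost everywhere, their masses
  \<open>Beta a b * x powr (a + b - 1)\<close> converge, hence they converge in L1, and a bounded
  \<open>\<phi>\<close> can be integrated against them.\<close>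

lemma continuous_on_frac_kernel_integral:
  fixes a b :: real
  assumes ab: "a > 0" "b > 0"
    and [measurable]: "\<phi> \<in> borel_measurable borel" and bd: "\<And>r. r > 0 \<Longrightarrow> \<bar>\<phi> r\<bar> \<le> C"
  shows "continuous_on {0<..} (\<lambda>x. LINT r|lborel. frac_kernel a b x r * \<phi> r)"
proof (rule continuous_on_sequentiallyI)
  fix u :: "nat \<Rightarrow> real" and x :: real
  assume u: "\<forall>n. u n \<in> {0<..}" and x: "x \<in> {0<..}" and lim: "u \<longlonglongrightarrow> x"
  have hb: "has_bochner_integral lborel (frac_kernel a b y) (Beta a b * y powr (a + b - 1))" if "y > 0" for y
    using has_bochner_integral_Beta_scaled[OF ab that] by (simp add: frac_kernel_def[abs_def])
  have nn: "(\<integral>\<^sup>+r. ennreal (norm (frac_kernel a b y r)) \<partial>lborel) = ennreal (Beta a b * y powr (a + b - 1))" if "y > 0" for y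
    using nn_integral_eq_integral[OF integrable.intros[OF hb[OF that]]] has_bochner_integral_integral_eq[OF hb[OF that]]
    by simp
  have scheffe: "(\<lambda>n. \<integral>\<^sup>+r. ennreal (norm (frac_kernel a b (u n) r - frac_kernel a b x r)) \<partial>lborel) \<longlonglongrightarrow> 0"
  proof (rule Scheffe_lemma1)
    show "integrable lborel (frac_kernel a b (u n))" for n using hb u by (auto simp: integrable.simps)
    show "integrable lborel (frac_kernel a b x)" using hb x by (auto simp: integrable.simps)
    have "AE r in lborel. r \<noteq> x" by (rule AE_lborel_singleton)
    then show "AE r in lborel. (\<lambda>n. frac_kernel a b (u n) r) \<longlonglongrightarrow> frac_kernel a b x r"
    proof eventually_elim
      case (elim r)
      consider "r \<le> 0" | "0 < r" "r < x" | "r > x" using elim by linarith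
      then show ?case
      proof cases
        case 1
        then show ?thesis by (simp add: frac_kernel_def)
      next
        case 2
        then have ev: "eventually (\<lambda>n. r < u n) sequentially" using lim by (intro order_tendstoD(1))
        have "(\<lambda>n. (u n - r) powr (a - 1) * r powr (b - 1)) \<longlonglongrightarrow> (x - r) powr (a - 1) * r powr (b - 1)"
          using 2 by (intro tendsto_intros lim) auto
        moreover have "eventually (\<lambda>n. (u n - r) powr (a - 1) * r powr (b - 1) = frac_kernel a b (u n) r) sequentially"
          using ev by eventually_elim (use 2 in \<open>simp add: frac_kernel_def\<close>)
        ultimately have "(\<lambda>n. frac_kernel a b (u n) r) \<longlonglongrightarrow> (x - r) powr (a - 1) * r powr (b - 1)"
          by (rule Lim_transform_eventually)
        then show ?thesis using 2 by (simp add: frac_kernel_def[of _ _ x])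
      next
        case 3
        then have ev: "eventually (\<lambda>n. u n < r) sequentially" using lim by (intro order_tendstoD(2))
        then have "eventually (\<lambda>n. frac_kernel a b (u n) r = 0) sequentially"
          by eventually_elim (simp add: frac_kernel_def)
        then show ?thesis using 3 by (simp add: frac_kernel_def tendsto_eventually)
      qed
    qed
    have "(\<lambda>n. ennreal (Beta a b * u n powr (a + b - 1))) \<longlonglongrightarrow> ennreal (Beta a b * x powr (a + b - 1))"
      using x by (intro tendsto_ennrealI tendsto_intros lim) auto
    then have "limsup (\<lambda>n. ennreal (Beta a b * u n powr (a + b - 1))) = ennreal (Beta a b * x powr (a + b - 1))"
      by (rule lim_imp_Limsup[rotated]) simp
    then show "limsup (\<lambda>n. \<integral>\<^sup>+r. ennreal (norm (frac_kernel a b (u n) r)) \<partial>lborel)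
          \<le> (\<integral>\<^sup>+r. ennreal (norm (frac_kernel a b x r)) \<partial>lborel)"
      using nn u x by simp
  qed
  have C: "C \<ge> 0" using bd[of 1] by simp
  have int: "integrable lborel (frac_kernel a b y)" if "y > 0" for y using hb that by (auto simp: integrable.simps)
  note intphi = frac_kernel_weighted(1)[OF ab _ assms(3) bd]
  have "(\<lambda>n. ennreal C * (\<integral>\<^sup>+r. ennreal (norm (frac_kernel a b (u n) r - frac_kernel a b x r)) \<partial>lborel)) \<longlonglongrightarrow> ennreal C * 0"
    by (intro ennreal_tendsto_cmult scheffe) simp
  then have lim0: "(\<lambda>n. enn2real (ennreal C * (\<integral>\<^sup>+r. ennreal (norm (frac_kernel a b (u n) r - frac_kernel a b x r)) \<partial>lborel))) \<longlonglongrightarrow> 0"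
    using tendsto_enn2real[of _ 0] by simp
  have "(\<lambda>n. (LINT r|lborel. frac_kernel a b (u n) r * \<phi> r) - (LINT r|lborel. frac_kernel a b x r * \<phi> r)) \<longlonglongrightarrow> 0"
  proof (rule Lim_null_comparison[OF _ lim0], rule eventuallyI)
    fix n
    have un: "u n > 0" and x0: "x > 0" using u x by auto
    define d where "d r = C * \<bar>frac_kernel a b (u n) r - frac_kernel a b x r\<bar>" for r
    have intd: "integrable lborel d"
      unfolding d_def using int[OF un] int[OF x0] by auto
    have "norm ((LINT r|lborel. frac_kernel a b (u n) r * \<phi> r) - (LINT r|lborel. frac_kernel a b x r * \<phi> r)) =
        \<bar>LINT r|lborel. frac_kernel a b (u n) r * \<phi> r - frac_kernel a b x r * \<phi> r\<bar>"
      by (subst Bochner_Integration.integral_diff) (use intphi[OF un] intphi[OF x0] in auto)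
    also have "\<dots> \<le> (LINT r|lborel. \<bar>frac_kernel a b (u n) r * \<phi> r - frac_kernel a b x r * \<phi> r\<bar>)"
      by (rule integral_abs_bound)
    also have "\<dots> \<le> (LINT r|lborel. d r)"
    proof (rule integral_mono)
      fix r
      have "\<bar>frac_kernel a b (u n) r * \<phi> r - frac_kernel a b x r * \<phi> r\<bar> =
           \<bar>\<phi> r\<bar> * \<bar>frac_kernel a b (u n) r - frac_kernel a b x r\<bar>"
        by (simp add: abs_mult[symmetric] algebra_simps)
      also have "\<dots> \<le> d r"
        unfolding d_def using bd[of r] by (cases "r > 0") (auto simp: frac_kernel_def intro!: mult_right_mono)
      finally show "\<bar>frac_kernel a b (u n) r * \<phi> r - frac_kernel a b x r * \<phi> r\<bar> \<le> d r" .
    qed (use intphi[OF un] intphi[OF x0] intd in auto)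
    also have "\<dots> = enn2real (\<integral>\<^sup>+r. ennreal (d r) \<partial>lborel)"
      by (rule integral_eq_nn_integral) (use intd C in \<open>auto simp: d_def\<close>)
    also have "(\<integral>\<^sup>+r. ennreal (d r) \<partial>lborel) =
       ennreal C * (\<integral>\<^sup>+r. ennreal (norm (frac_kernel a b (u n) r - frac_kernel a b x r)) \<partial>lborel)"
      using C unfolding d_def by (subst nn_integral_cmult[symmetric]) (auto simp: ennreal_mult'')
    finally show "norm ((LINT r|lborel. frac_kernel a b (u n) r * \<phi> r) - (LINT r|lborel. frac_kernel a b x r * \<phi> r))
        \<le> enn2real (ennreal C * (\<integral>\<^sup>+r. ennreal (norm (frac_kernel a b (u n) r - frac_kernel a b x r)) \<partial>lborel))" .
  qed
  then show "(\<lambda>n. LINT r|lborel. frac_kernel a b (u n) r * \<phi> r) \<longlonglongrightarrow> (LINT r|lborel. frac_kernel a b x r * \<phi> r)"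
    by (rule LIM_zero_cancel)
qed

subsection \<open>The operators J, K and I\<close>

text \<open>The bound is required on the whole of (0,\<infinity>), so that no horizon T has to be
  carried through the pointwise estimates; a function given on (0,T] is extended by 0.\<close>

definition power_bounded :: "real \<Rightarrow> real \<Rightarrow> (real \<Rightarrow> real) \<Rightarrow> bool" where
  "power_bounded a C \<psi> \<longleftrightarrow> \<psi> \<in> borel_measurable borel \<and> (\<forall>r>0. \<bar>\<psi> r\<bar> \<le> C * r powr a)"

text \<open>The \<open>ennreal\<close> counterparts of the operators carry the probabilistic part,
  where Tonelli's theorem and monotone convergence replace all integrability arguments.
  \<open>I_op_nn\<close> leads back to the real operators.\<close>

definition J_nn :: "real \<Rightarrow> (real \<Rightarrow> ennreal) \<Rightarrow> real \<Rightarrow> ennreal" where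
  "J_nn \<beta> h x = (\<integral>\<^sup>+r. ennreal ((x - r) powr (\<beta> - 1) / Gamma \<beta>) * h r * indicator {0<..<x} r \<partial>lborel)"

definition K_nn :: "real \<Rightarrow> (real \<Rightarrow> ennreal) \<Rightarrow> real \<Rightarrow> ennreal" where
  "K_nn \<beta> h x = (\<integral>\<^sup>+r. ennreal ((x - r) powr (\<beta> - 1) * r powr (- \<beta>) / (Gamma \<beta> * Gamma (1 - \<beta>))) * h r
     * indicator {0<..<x} r \<partial>lborel)"

lemma K_nn_cong: "(\<And>r. r > 0 \<Longrightarrow> h r = h' r) \<Longrightarrow> K_nn \<beta> h x = K_nn \<beta> h' x"
  unfolding K_nn_def by (intro nn_integral_cong) (auto simp: indicator_def)

lemma J_nn_measurable [measurable]:
  assumes [measurable]: "h \<in> borel_measurable borel"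
  shows "J_nn \<beta> h \<in> borel_measurable borel"
proof -
  \<comment> \<open>Written as a condition on both variables, the moving domain of integration makes
    the integrand visibly measurable in (x, r) jointly.\<close>
  have "J_nn \<beta> h = (\<lambda>x. \<integral>\<^sup>+r. (if 0 < r \<and> r < x then ennreal ((x - r) powr (\<beta> - 1) / Gamma \<beta>) * h r else 0) \<partial>lborel)"
    unfolding J_nn_def by (intro ext nn_integral_cong) (auto simp: indicator_def)
  then show ?thesis by simp
qed

lemma K_nn_measurable [measurable]:
  assumes [measurable]: "h \<in> borel_measurable borel"
  shows "K_nn \<beta> h \<in> borel_measurable borel"
proof -
  have "K_nn \<beta> h = (\<lambda>x. \<integral>\<^sup>+r. (if 0 < r \<and> r < x then
      ennreal ((x - r) powr (\<beta> - 1) * r powr (- \<beta>) / (Gamma \<beta> * Gamma (1 - \<beta>))) * h r else 0) \<partial>lborel)"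
    unfolding K_nn_def by (intro ext nn_integral_cong) (auto simp: indicator_def)
  then show ?thesis by simp
qed

lemma funpow_K_nn_measurable [measurable]:
  "h \<in> borel_measurable borel \<Longrightarrow> (K_nn \<beta> ^^ j) h \<in> borel_measurable borel"
  by (induction j) auto

lemma power_boundedD:
  assumes "power_bounded a C \<psi>"
  shows "\<psi> \<in> borel_measurable borel" "\<And>r. r > 0 \<Longrightarrow> \<bar>\<psi> r\<bar> \<le> C * r powr a" "0 \<le> C"
  using assms unfolding power_bounded_def by (auto dest: spec[of _ 1])

lemma power_bounded_weight:
  assumes "power_bounded a C \<psi>"
  shows "(\<lambda>r. r powr (- a) * \<psi> r) \<in> borel_measurable borel" "\<And>r. r > 0 \<Longrightarrow> \<bar>r powr (- a) * \<psi> r\<bar> \<le> C"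
proof -
  show "(\<lambda>r. r powr (- a) * \<psi> r) \<in> borel_measurable borel"
    using power_boundedD(1)[OF assms] by measurable
  fix r :: real assume r: "r > 0"
  have "\<bar>r powr (- a) * \<psi> r\<bar> = r powr (- a) * \<bar>\<psi> r\<bar>" by (simp add: abs_mult)
  also have "\<dots> \<le> r powr (- a) * (C * r powr a)"
    using power_boundedD(2)[OF assms r] by (intro mult_left_mono) auto
  also have "\<dots> = C" using r by (simp add: powr_minus field_simps)
  finally show "\<bar>r powr (- a) * \<psi> r\<bar> \<le> C" .
qed

lemma K_op_cong:
  assumes "\<And>r. 0 < r \<Longrightarrow> r < x \<Longrightarrow> f r = g r" "x = 0 \<Longrightarrow> f 0 = g 0"
  shows "K_op \<beta> f x = K_op \<beta> g x"
  using assms by (auto simp: K_op_def intro!: set_lebesgue_integral_cong)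

text \<open>For x > 0 both operators look only at arguments in (0,x), so a function may be cut off
  beyond T without changing the iterates on [0,T]. At x = 0 the iterates inherit the value 0 of
  \<open>J_op\<close>.\<close>

lemma funpow_K_op_cong:
  assumes "\<And>r. 0 < r \<Longrightarrow> r \<le> T \<Longrightarrow> f r = g r" "0 \<le> x" "x \<le> T"
  shows "(K_op \<beta> ^^ j) (J_op \<beta> f) x = (K_op \<beta> ^^ j) (J_op \<beta> g) x"
  using assms(2,3)
proof (induction j arbitrary: x)
  case 0
  then show ?case using assms(1) by (auto simp: J_op_def intro!: set_lebesgue_integral_cong)
next
  case (Suc j)
  then show ?case by (auto intro!: K_op_cong)
qed

section \<open>Mapping properties of the operators under power weights\<close>

context
  fixes \<alpha> \<beta> :: real
  assumes \<alpha>: "0 < \<alpha>" and \<beta>: "0 < \<beta>" "\<beta> < 1"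
begin

text \<open>The eigenvalue of \<open>K_op\<close> for the eigenfunction r powr \<alpha>. For
  \<alpha> = 0 the formula gives exactly 1, so only a positive order \<alpha> yields geometric
  decay.\<close>

definition "contraction = Beta \<beta> (\<alpha> - \<beta> + 1) / (Gamma \<beta> * Gamma (1 - \<beta>))"

lemma Gamma_pos: "Gamma \<beta> > 0" "Gamma (1 - \<beta>) > 0" "Gamma \<beta> * Gamma (1 - \<beta>) > 0"
  using \<beta> by (auto intro!: mult_pos_pos Gamma_real_pos)

lemma contraction: "0 \<le> contraction" "contraction < 1"
proof -
  show "0 \<le> contraction"
    unfolding contraction_def using \<alpha> \<beta> Gamma_pos by (intro divide_nonneg_pos Beta_nonneg_real) auto
  have "Beta \<beta> ((1 - \<beta>) + \<alpha>) < Beta \<beta> (1 - \<beta>)"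
    using \<alpha> \<beta> by (intro Beta_strict_decreasing) auto
  also have "\<dots> = Gamma \<beta> * Gamma (1 - \<beta>)" by (simp add: Beta_def)
  finally show "contraction < 1" using Gamma_pos
    by (simp add: contraction_def field_simps)
qed

text \<open>The argument of \<open>J_op\<close> has order \<alpha> - \<beta>, that of
  \<open>K_op\<close> has order \<alpha>. The extra factor r powr (- \<beta>) in \<open>K_op\<close>
  compensates for the difference, so both operators lead to the same Beta kernel.\<close>

lemma J_op_integrand:
  "indicator {0<..<x} r *\<^sub>R ((x - r) powr (\<beta> - 1) / Gamma \<beta> * g r) =
   frac_kernel \<beta> (\<alpha> - \<beta> + 1) x r * (r powr (- (\<alpha> - \<beta>)) * g r) / Gamma \<beta>"
  by (auto simp: frac_kernel_def indicator_def powr_add[symmetric] mult.assoc mult.left_commute)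

lemma K_op_integrand:
  "indicator {0<..<x} r *\<^sub>R ((x - r) powr (\<beta> - 1) * r powr (- \<beta>) / (Gamma \<beta> * Gamma (1 - \<beta>)) * \<psi> r) =
   frac_kernel \<beta> (\<alpha> - \<beta> + 1) x r * (r powr (- \<alpha>) * \<psi> r) / (Gamma \<beta> * Gamma (1 - \<beta>))"
proof (cases "0 < r")
  case True
  then have "r powr (- \<beta>) = r powr (\<alpha> - \<beta>) * r powr (- \<alpha>)" by (simp add: powr_add[symmetric])
  then show ?thesis by (simp add: frac_kernel_def mult_ac)
qed (simp add: frac_kernel_def)

lemma J_op_eq: "J_op \<beta> g x = (LINT r|lborel. frac_kernel \<beta> (\<alpha> - \<beta> + 1) x r * (r powr (- (\<alpha> - \<beta>)) * g r)) / Gamma \<beta>"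
proof (cases "x = 0")
  case False
  then show ?thesis
    by (simp only: J_op_def set_lebesgue_integral_def J_op_integrand if_False integral_divide_zero)
qed (simp add: J_op_def frac_kernel_def)

lemma K_op_eq: "x \<noteq> 0 \<Longrightarrow> K_op \<beta> \<psi> x =
   (LINT r|lborel. frac_kernel \<beta> (\<alpha> - \<beta> + 1) x r * (r powr (- \<alpha>) * \<psi> r)) / (Gamma \<beta> * Gamma (1 - \<beta>))"
  by (simp only: K_op_def set_lebesgue_integral_def K_op_integrand if_False integral_divide_zero)

text \<open>For the kernel parameters used here a + b - 1 = \<alpha>: fractional integration raises
  the order \<alpha> - \<beta> by \<beta>.\<close>

lemma J_op_props:
  assumes g: "power_bounded (\<alpha> - \<beta>) C g"
  shows "x > 0 \<Longrightarrow> integrable lborel (\<lambda>r. indicator {0<..<x} r *\<^sub>R ((x - r) powr (\<beta> - 1) / Gamma \<beta> * g r))"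
    and "power_bounded \<alpha> (C * Beta \<beta> (\<alpha> - \<beta> + 1) / Gamma \<beta>) (J_op \<beta> g)"
    and "continuous_on {0<..} (J_op \<beta> g)"
proof -
  have ab: "\<beta> > 0" "\<alpha> - \<beta> + 1 > 0" using \<alpha> \<beta> by auto
  note w = power_bounded_weight[OF g]
  note [measurable] = w(1)
  show "integrable lborel (\<lambda>r. indicator {0<..<x} r *\<^sub>R ((x - r) powr (\<beta> - 1) / Gamma \<beta> * g r))" if "x > 0"
    unfolding J_op_integrand using frac_kernel_weighted(1)[OF ab that w] by (intro integrable_divide) auto
  have "J_op \<beta> g \<in> borel_measurable borel" unfolding J_op_eq[abs_def] by measurable
  moreover have "\<bar>J_op \<beta> g x\<bar> \<le> C * Beta \<beta> (\<alpha> - \<beta> + 1) / Gamma \<beta> * x powr \<alpha>" if "x > 0" for x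
    using frac_kernel_weighted(2)[OF ab that w] Gamma_pos unfolding J_op_eq by (simp add: divide_right_mono)
  ultimately show "power_bounded \<alpha> (C * Beta \<beta> (\<alpha> - \<beta> + 1) / Gamma \<beta>) (J_op \<beta> g)"
    by (auto simp: power_bounded_def)
  show "continuous_on {0<..} (J_op \<beta> g)"
    unfolding J_op_eq[abs_def] using Gamma_pos
    by (intro continuous_on_divide continuous_on_frac_kernel_integral[OF ab w] continuous_on_const) auto
qed

text \<open>The weight r powr (- \<beta>) takes back the order gained by fractional integration, so
  the order \<alpha> is kept and only the constant shrinks.\<close>

lemma K_op_props:
  assumes \<psi>: "power_bounded \<alpha> C \<psi>"
  shows "x > 0 \<Longrightarrow> integrable lborel (\<lambda>r. indicator {0<..<x} r *\<^sub>R
           ((x - r) powr (\<beta> - 1) * r powr (- \<beta>) / (Gamma \<beta> * Gamma (1 - \<beta>)) * \<psi> r))"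
    and "power_bounded \<alpha> (C * contraction) (K_op \<beta> \<psi>)"
    and "continuous_on {0<..} (K_op \<beta> \<psi>)"
proof -
  have ab: "\<beta> > 0" "\<alpha> - \<beta> + 1 > 0" using \<alpha> \<beta> by auto
  note w = power_bounded_weight[OF \<psi>]
  note [measurable] = w(1)
  show "integrable lborel (\<lambda>r. indicator {0<..<x} r *\<^sub>R
           ((x - r) powr (\<beta> - 1) * r powr (- \<beta>) / (Gamma \<beta> * Gamma (1 - \<beta>)) * \<psi> r))" if "x > 0"
    unfolding K_op_integrand using frac_kernel_weighted(1)[OF ab that w] by (intro integrable_divide) auto
  have eq: "K_op \<beta> \<psi> = (\<lambda>x. if x = 0 then \<psi> 0 else
    (LINT r|lborel. frac_kernel \<beta> (\<alpha> - \<beta> + 1) x r * (r powr (- \<alpha>) * \<psi> r)) / (Gamma \<beta> * Gamma (1 - \<beta>)))"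
    using K_op_eq by (auto simp: K_op_def)
  have "K_op \<beta> \<psi> \<in> borel_measurable borel" unfolding eq by measurable
  moreover have "\<bar>K_op \<beta> \<psi> x\<bar> \<le> C * contraction * x powr \<alpha>" if "x > 0" for x
    using frac_kernel_weighted(2)[OF ab that w] Gamma_pos that
    unfolding contraction_def by (simp add: K_op_eq divide_right_mono abs_mult)
  ultimately show "power_bounded \<alpha> (C * contraction) (K_op \<beta> \<psi>)"
    by (auto simp: power_bounded_def)
  have "continuous_on {0<..} (\<lambda>x. (LINT r|lborel. frac_kernel \<beta> (\<alpha> - \<beta> + 1) x r * (r powr (- \<alpha>) * \<psi> r)) / (Gamma \<beta> * Gamma (1 - \<beta>)))"
    using Gamma_pos by (intro continuous_on_divide continuous_on_frac_kernel_integral[OF ab w] continuous_on_const) auto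
  then show "continuous_on {0<..} (K_op \<beta> \<psi>)"
    by (rule continuous_on_cong[THEN iffD1, rotated -1]) (auto simp: eq)
qed

lemma J_op_nn:
  assumes g: "power_bounded (\<alpha> - \<beta>) C g" "\<And>r. r > 0 \<Longrightarrow> 0 \<le> g r" and x: "x > 0"
  shows "ennreal (J_op \<beta> g x) = J_nn \<beta> (\<lambda>r. ennreal (g r)) x" "0 \<le> J_op \<beta> g x"
proof -
  define f where "f r = indicator {0<..<x} r *\<^sub>R ((x - r) powr (\<beta> - 1) / Gamma \<beta> * g r)" for r
  have f0: "0 \<le> f r" for r using g(2)[of r] Gamma_pos by (auto simp: f_def indicator_def)
  have J: "J_op \<beta> g x = integral\<^sup>L lborel f"
    using x by (simp add: J_op_def set_lebesgue_integral_def f_def[abs_def])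
  show "0 \<le> J_op \<beta> g x" unfolding J using f0 by (intro integral_nonneg_AE) auto
  have "ennreal (J_op \<beta> g x) = (\<integral>\<^sup>+r. ennreal (f r) \<partial>lborel)"
    unfolding J using J_op_props(1)[OF g(1) x] f0 unfolding f_def[symmetric]
    by (intro nn_integral_eq_integral[symmetric]) auto
  also have "\<dots> = J_nn \<beta> (\<lambda>r. ennreal (g r)) x"
    unfolding J_nn_def f_def using g(2) Gamma_pos
    by (intro nn_integral_cong) (auto simp: indicator_def ennreal_mult'[symmetric])
  finally show "ennreal (J_op \<beta> g x) = J_nn \<beta> (\<lambda>r. ennreal (g r)) x" .
qed

lemma K_op_nn:
  assumes g: "power_bounded \<alpha> C g" "\<And>r. r > 0 \<Longrightarrow> 0 \<le> g r" and x: "x > 0"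
  shows "ennreal (K_op \<beta> g x) = K_nn \<beta> (\<lambda>r. ennreal (g r)) x" "0 \<le> K_op \<beta> g x"
proof -
  define f where "f r = indicator {0<..<x} r *\<^sub>R ((x - r) powr (\<beta> - 1) * r powr (- \<beta>) / (Gamma \<beta> * Gamma (1 - \<beta>)) * g r)" for r
  have f0: "0 \<le> f r" for r using g(2)[of r] Gamma_pos by (auto simp: f_def indicator_def)
  have K: "K_op \<beta> g x = integral\<^sup>L lborel f"
    using x by (simp add: K_op_def set_lebesgue_integral_def f_def[abs_def])
  show "0 \<le> K_op \<beta> g x" unfolding K using f0 by (intro integral_nonneg_AE) auto
  have "ennreal (K_op \<beta> g x) = (\<integral>\<^sup>+r. ennreal (f r) \<partial>lborel)"
    unfolding K using K_op_props(1)[OF g(1) x] f0 unfolding f_def[symmetric]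
    by (intro nn_integral_eq_integral[symmetric]) auto
  also have "\<dots> = K_nn \<beta> (\<lambda>r. ennreal (g r)) x"
    unfolding K_nn_def f_def using g(2) Gamma_pos
    by (intro nn_integral_cong) (auto simp: indicator_def ennreal_mult'[symmetric])
  finally show "ennreal (K_op \<beta> g x) = K_nn \<beta> (\<lambda>r. ennreal (g r)) x" .
qed

lemma J_op_diff:
  assumes "power_bounded (\<alpha> - \<beta>) C f" "power_bounded (\<alpha> - \<beta>) D g" "x > 0"
  shows "J_op \<beta> (\<lambda>r. f r - g r) x = J_op \<beta> f x - J_op \<beta> g x"
  using assms J_op_props(1)[OF assms(1,3)] J_op_props(1)[OF assms(2,3)]
  by (simp add: J_op_def set_lebesgue_integral_def right_diff_distrib)

lemma K_op_diff:
  assumes "power_bounded \<alpha> C f" "power_bounded \<alpha> D g" "x > 0"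
  shows "K_op \<beta> (\<lambda>r. f r - g r) x = K_op \<beta> f x - K_op \<beta> g x"
  using assms K_op_props(1)[OF assms(1,3)] K_op_props(1)[OF assms(2,3)]
  by (simp add: K_op_def set_lebesgue_integral_def right_diff_distrib)

text \<open>Continuity away from 0 comes from the kernel. At 0 it comes from the bound by a multiple
  of x powr \<alpha> with \<alpha> > 0, together with the value 0 that \<open>J_op\<close> starts
  with and \<open>K_op\<close> preserves.\<close>

lemma funpow_K_op_props:
  assumes g: "power_bounded (\<alpha> - \<beta>) C g"
  shows "power_bounded \<alpha> (C * Beta \<beta> (\<alpha> - \<beta> + 1) / Gamma \<beta> * contraction ^ j) ((K_op \<beta> ^^ j) (J_op \<beta> g))"
    and "(K_op \<beta> ^^ j) (J_op \<beta> g) 0 = 0"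
    and "continuous_on {0..} ((K_op \<beta> ^^ j) (J_op \<beta> g))"
proof -
  let ?C = "C * Beta \<beta> (\<alpha> - \<beta> + 1) / Gamma \<beta> * contraction ^ j"
  let ?f = "(K_op \<beta> ^^ j) (J_op \<beta> g)"
  have pb: "power_bounded \<alpha> (C * Beta \<beta> (\<alpha> - \<beta> + 1) / Gamma \<beta> * contraction ^ j) ((K_op \<beta> ^^ j) (J_op \<beta> g))" for j
  proof (induction j)
    case 0
    then show ?case using J_op_props(2)[OF g] by simp
  next
    case (Suc j)
    then show ?case using K_op_props(2)[OF Suc] by (simp add: mult_ac)
  qed
  show p: "power_bounded \<alpha> ?C ?f" by (rule pb)
  show z: "?f 0 = 0" by (induction j) (auto simp: J_op_def K_op_def)
  have pos: "continuous_on {0<..} ?f"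
    by (cases j) (use J_op_props(3)[OF g] K_op_props(3)[OF pb] in auto)
  show "continuous_on {0..} ?f"
    unfolding continuous_on_eq_continuous_within
  proof
    fix x :: real assume "x \<in> {0..}"
    then consider "x > 0" | "x = 0" by force
    then show "continuous (at x within {0..}) ?f"
    proof cases
      case 1
      then have "isCont ?f x" using pos by (simp add: continuous_on_eq_continuous_at)
      then show ?thesis by (rule continuous_at_imp_continuous_at_within)
    next
      case 2
      have "((\<lambda>x. ?C * x powr \<alpha>) \<longlongrightarrow> ?C * 0) (at_right 0)"
        using \<alpha> by (intro tendsto_intros tendsto_zero_powrI[where b=\<alpha>]) (auto intro: tendsto_ident_at eventually_mono[OF eventually_at_right_less[of "0::real"]])
      then have l: "((\<lambda>x. ?C * x powr \<alpha>) \<longlongrightarrow> 0) (at_right 0)" by simp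
      have "eventually (\<lambda>x. norm (?f x) \<le> ?C * x powr \<alpha>) (at_right 0)"
        using eventually_at_right_less[of 0] by eventually_elim (use power_boundedD(2)[OF p] in auto)
      then have "(?f \<longlongrightarrow> 0) (at_right 0)" using l by (rule Lim_null_comparison)
      moreover have "at (0::real) within {0..} = at_right 0"
        by (rule at_within_Ici_at_right)
      ultimately show ?thesis using 2 z by (simp add: continuous_within)
    qed
  qed
qed

lemma funpow_K_op_bound:
  assumes g: "power_bounded (\<alpha> - \<beta>) C g" and x: "x \<in> {0..T}"
  shows "norm ((K_op \<beta> ^^ j) (J_op \<beta> g) x) \<le> C * Beta \<beta> (\<alpha> - \<beta> + 1) / Gamma \<beta> * contraction ^ j * T powr \<alpha>"
proof -
  note p = funpow_K_op_props[OF g, of j]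
  show ?thesis
  proof (cases "x = 0")
    case True
    then show ?thesis using p(2) mult_nonneg_nonneg[OF power_boundedD(3)[OF p(1)] powr_ge_zero[of T \<alpha>]] by simp
  next
    case False
    then have "x > 0" using x by auto
    then have "norm ((K_op \<beta> ^^ j) (J_op \<beta> g) x) \<le> C * Beta \<beta> (\<alpha> - \<beta> + 1) / Gamma \<beta> * contraction ^ j * x powr \<alpha>"
      using power_boundedD(2)[OF p(1)] by simp
    also have "\<dots> \<le> C * Beta \<beta> (\<alpha> - \<beta> + 1) / Gamma \<beta> * contraction ^ j * T powr \<alpha>"
      using power_boundedD(3)[OF p(1)] x \<alpha> by (intro mult_left_mono powr_mono2) auto
    finally show ?thesis .
  qed
qed

lemma summable_contraction: "summable (\<lambda>j. a * contraction ^ j * b)"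
  using contraction by (intro summable_mult2 summable_mult summable_geometric) auto

lemma I_op_uniform_limit:
  assumes g: "power_bounded (\<alpha> - \<beta>) C g"
  shows "uniform_limit {0..T} (\<lambda>n x. \<Sum>j<n. (K_op \<beta> ^^ j) (J_op \<beta> g) x) (I_op \<beta> g) sequentially"
  unfolding I_op_def[abs_def]
  by (rule Weierstrass_m_test[OF funpow_K_op_bound[OF g] summable_contraction])

lemma I_op_C_infty:
  assumes g: "power_bounded (\<alpha> - \<beta>) C g"
  shows "I_op \<beta> g \<in> C_infty T"
proof -
  have "continuous_on {0..T} (\<lambda>x. \<Sum>j<n. (K_op \<beta> ^^ j) (J_op \<beta> g) x)" for n
    by (intro continuous_on_sum continuous_on_subset[OF funpow_K_op_props(3)[OF g]]) auto
  then have "continuous_on {0..T} (I_op \<beta> g)"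
    by (intro uniform_limit_theorem[OF _ I_op_uniform_limit[OF g]]) auto
  moreover have "I_op \<beta> g 0 = 0" by (simp add: I_op_def funpow_K_op_props(2)[OF g])
  ultimately show ?thesis by (simp add: C_infty_def)
qed

lemma I_op_summable:
  assumes g: "power_bounded (\<alpha> - \<beta>) C g" and x: "x > 0"
  shows "summable (\<lambda>j. (K_op \<beta> ^^ j) (J_op \<beta> g) x)"
  by (rule summable_comparison_test'[OF summable_contraction funpow_K_op_bound[OF g, of x x]])
     (use x in auto)

text \<open>The terms are nonnegative and summable, so the real series and the series in
  \<open>ennreal\<close> agree term by term. This is the bridge to the probabilistic side.\<close>

lemma I_op_nn:
  assumes g: "power_bounded (\<alpha> - \<beta>) C g" "\<And>r. r > 0 \<Longrightarrow> 0 \<le> g r" and x: "x > 0"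
  shows "ennreal (I_op \<beta> g x) = (\<Sum>j. (K_nn \<beta> ^^ j) (J_nn \<beta> (\<lambda>r. ennreal (g r))) x)" "0 \<le> I_op \<beta> g x"
proof -
  have it: "x > 0 \<Longrightarrow> 0 \<le> (K_op \<beta> ^^ j) (J_op \<beta> g) x \<and> ennreal ((K_op \<beta> ^^ j) (J_op \<beta> g) x) =
      (K_nn \<beta> ^^ j) (J_nn \<beta> (\<lambda>r. ennreal (g r))) x" for j x
  proof (induction j arbitrary: x)
    case 0
    then show ?case using J_op_nn[OF g] by simp
  next
    case (Suc j)
    have "ennreal (K_op \<beta> ((K_op \<beta> ^^ j) (J_op \<beta> g)) x) =
      K_nn \<beta> (\<lambda>r. ennreal ((K_op \<beta> ^^ j) (J_op \<beta> g) r)) x" "0 \<le> K_op \<beta> ((K_op \<beta> ^^ j) (J_op \<beta> g)) x"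
      using K_op_nn[OF funpow_K_op_props(1)[OF g(1)]] Suc by blast+
    moreover have "K_nn \<beta> (\<lambda>r. ennreal ((K_op \<beta> ^^ j) (J_op \<beta> g) r)) x =
       K_nn \<beta> ((K_nn \<beta> ^^ j) (J_nn \<beta> (\<lambda>r. ennreal (g r)))) x"
      \<comment> \<open>The induction hypothesis speaks of positive arguments only, and these are
        all that \<open>K_nn\<close> looks at.\<close>
      by (rule K_nn_cong) (use Suc.IH in blast)
    ultimately show ?case by simp
  qed
  show "0 \<le> I_op \<beta> g x"
    unfolding I_op_def using it[OF x] I_op_summable[OF g(1) x] by (intro suminf_nonneg) auto
  show "ennreal (I_op \<beta> g x) = (\<Sum>j. (K_nn \<beta> ^^ j) (J_nn \<beta> (\<lambda>r. ennreal (g r))) x)"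
    unfolding I_op_def using it[OF x] I_op_summable[OF g(1) x]
    by (subst suminf_ennreal2[symmetric]) auto
qed

lemma I_op_diff:
  assumes f: "power_bounded (\<alpha> - \<beta>) C f" and g: "power_bounded (\<alpha> - \<beta>) D g" and x: "x > 0"
  shows "I_op \<beta> (\<lambda>r. f r - g r) x = I_op \<beta> f x - I_op \<beta> g x"
proof -
  have it: "x > 0 \<Longrightarrow> (K_op \<beta> ^^ j) (J_op \<beta> (\<lambda>r. f r - g r)) x =
      (K_op \<beta> ^^ j) (J_op \<beta> f) x - (K_op \<beta> ^^ j) (J_op \<beta> g) x" for j x
  proof (induction j arbitrary: x)
    case 0
    then show ?case using J_op_diff[OF f g] by simp
  next
    case (Suc j)
    have "K_op \<beta> ((K_op \<beta> ^^ j) (J_op \<beta> (\<lambda>r. f r - g r))) x =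
      K_op \<beta> (\<lambda>r. (K_op \<beta> ^^ j) (J_op \<beta> f) r - (K_op \<beta> ^^ j) (J_op \<beta> g) r) x"
      using Suc by (intro K_op_cong) auto
    then show ?case
      using K_op_diff[OF funpow_K_op_props(1)[OF f] funpow_K_op_props(1)[OF g] Suc.prems] by simp
  qed
  show ?thesis
    unfolding I_op_def it[OF x]
    by (rule suminf_diff[symmetric]) (rule I_op_summable[OF f x] I_op_summable[OF g x])+
qed

end

subsection \<open>First passage of a nondecreasing path\<close>

text \<open>Indexed by pairs of level and position, a countable type, so that suprema and infima
  over all dyadic times remain measurable; repeated values are harmless.\<close>

definition dyad :: "nat \<times> nat \<Rightarrow> real" where
  "dyad p = real (snd p) / 2 ^ fst p"

lemma dyad_nonneg [simp]: "0 \<le> dyad p"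
  by (simp add: dyad_def)

lemma dyad_dense:
  assumes "0 \<le> a" "a < b"
  obtains p where "a < dyad p" "dyad p < b"
proof -
  \<comment> \<open>The mesh is finer than b - a, and \<open>i\<close> is the first index whose grid
    point lies strictly above \<open>a\<close>.\<close>
  obtain n where n: "1 / (b - a) < 2 ^ n" using real_arch_pow[of 2 "1 / (b - a)"] by auto
  define i where "i = nat (\<lfloor>a * 2 ^ n\<rfloor> + 1)"
  have "real i = of_int (\<lfloor>a * 2 ^ n\<rfloor> + 1)" unfolding i_def using assms by (simp add: of_nat_nat)
  then have i: "a * 2 ^ n < real i" "real i \<le> a * 2 ^ n + 1" by linarith+
  have "1 < (b - a) * 2 ^ n" using n assms by (simp add: field_simps)
  then have "real i < b * 2 ^ n" using i by (simp add: algebra_simps)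
  then show thesis using i(1) by (intro that[of "(n, i)"]) (simp_all add: dyad_def field_simps)
qed

abbreviation path_space :: "(real \<Rightarrow> real) measure" where
  "path_space \<equiv> \<Pi>\<^sub>M t\<in>{0..}. borel"

text \<open>
  On the paths of interest \<open>right_reg w s\<close> is \<open>w s\<close> and \<open>pre_passage w x\<close> is the left limit of \<open>w\<close>
  at the first passage over \<open>x\<close>. Reading the path at dyadic times only makes both functionals
  jointly measurable on the product space.
\<close>

definition right_reg :: "(real \<Rightarrow> real) \<Rightarrow> real \<Rightarrow> real" where
  "right_reg w s = enn2real (INF p. if s < dyad p then ennreal (w (dyad p)) else \<top>)"

definition pre_passage :: "(real \<Rightarrow> real) \<Rightarrow> real \<Rightarrow> real" where
  "pre_passage w x = enn2real (SUP p. if w (dyad p) < x then ennreal (w (dyad p)) else 0)"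

lemma path_component_measurable:
  "f \<in> M \<rightarrow>\<^sub>M path_space \<Longrightarrow> (\<lambda>z. f z (dyad p)) \<in> borel_measurable M"
  using measurable_component_singleton[of "dyad p" "{0..}" "\<lambda>_. borel"]
  by (auto intro: measurable_compose[where g="\<lambda>w. w (dyad p)"])

lemma right_reg_measurable [measurable]:
  assumes [measurable]: "f \<in> M \<rightarrow>\<^sub>M path_space" "h \<in> borel_measurable M"
  shows "(\<lambda>z. right_reg (f z) (h z)) \<in> borel_measurable M"
  using path_component_measurable[OF assms(1), measurable] unfolding right_reg_def by measurable

lemma pre_passage_measurable [measurable]:
  assumes [measurable]: "f \<in> M \<rightarrow>\<^sub>M path_space" "h \<in> borel_measurable M"
  shows "(\<lambda>z. pre_passage (f z) (h z)) \<in> borel_measurable M"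
  using path_component_measurable[OF assms(1), measurable] unfolding pre_passage_def by measurable

lemma right_reg_nonneg [simp]: "0 \<le> right_reg w s"
  by (simp add: right_reg_def)

lemma pre_passage_nonneg [simp]: "0 \<le> pre_passage w x"
  by (simp add: pre_passage_def)

text \<open>Dyadic times are nonnegative, so cutting a path off to [0,\<infinity>) is invisible to
  both functionals. This moves statements between a process and the corresponding element of
  \<open>path_space\<close>.\<close>

lemma restrict_path_functionals [simp]:
  "right_reg (restrict w {0..}) = right_reg w" "pre_passage (restrict w {0..}) = pre_passage w"
  by (simp_all add: right_reg_def[abs_def] pre_passage_def[abs_def])

text \<open>The properties of almost every subordinator path. Unboundedness makes all passage times
  finite, and monotonicity supplies the left limits.\<close>

definition good_path :: "(real \<Rightarrow> real) \<Rightarrow> bool" where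
  "good_path w \<longleftrightarrow> w 0 = 0 \<and> mono_on {0..} w \<and> (\<forall>t\<ge>0. (w \<longlongrightarrow> w t) (at_right t)) \<and> (\<forall>c. \<exists>t\<ge>0. c < w t)"

text \<open>The weak inequality and the condition 0 < s mirror the definition of
  \<open>cens_time\<close>.\<close>

definition passage_time :: "(real \<Rightarrow> real) \<Rightarrow> real \<Rightarrow> real" where
  "passage_time w x = Inf {s. 0 < s \<and> x \<le> w s}"

context
  fixes w :: "real \<Rightarrow> real"
  assumes good: "good_path w"
begin

lemma good_pathD:
  "w 0 = 0" "\<And>s t. 0 \<le> s \<Longrightarrow> s \<le> t \<Longrightarrow> w s \<le> w t" "\<And>t. 0 \<le> t \<Longrightarrow> (w \<longlongrightarrow> w t) (at_right t)"
  "\<And>c. \<exists>t\<ge>0. c < w t" "\<And>s. 0 \<le> s \<Longrightarrow> 0 \<le> w s"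
proof -
  show "w 0 = 0" "\<And>s t. 0 \<le> s \<Longrightarrow> s \<le> t \<Longrightarrow> w s \<le> w t" "\<And>t. 0 \<le> t \<Longrightarrow> (w \<longlongrightarrow> w t) (at_right t)"
    "\<And>c. \<exists>t\<ge>0. c < w t"
    using good by (auto simp: good_path_def mono_on_def)
  then show "0 \<le> w s" if "0 \<le> s" for s using that by (metis order_refl)
qed

text \<open>By monotonicity all later dyadic values are at least \<open>w s\<close>, and by right
  continuity they come arbitrarily close to it.\<close>

lemma right_reg_good:
  assumes s: "0 \<le> s"
  shows "right_reg w s = w s"
proof -
  have "(INF p. if s < dyad p then ennreal (w (dyad p)) else \<top>) = ennreal (w s)"
  proof (rule antisym)
    show "ennreal (w s) \<le> (INF p. if s < dyad p then ennreal (w (dyad p)) else \<top>)"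
      by (rule INF_greatest) (auto intro!: ennreal_leI good_pathD(2) s)
    show "(INF p. if s < dyad p then ennreal (w (dyad p)) else \<top>) \<le> ennreal (w s)"
    proof (rule ennreal_le_epsilon)
      fix e :: real assume e: "0 < e"
      have "eventually (\<lambda>t. w t < w s + e) (at_right s)"
        using good_pathD(3)[OF s] e by (intro order_tendstoD) auto
      then obtain b where b: "b > s" "\<And>t. s < t \<Longrightarrow> t < b \<Longrightarrow> w t < w s + e"
        by (auto simp: eventually_at_right_field)
      obtain p where p: "s < dyad p" "dyad p < b" using dyad_dense[OF s b(1)] .
      have "(INF p. if s < dyad p then ennreal (w (dyad p)) else \<top>) \<le> ennreal (w (dyad p))"
        using p by (intro INF_lower2[of p]) auto
      also have "\<dots> \<le> ennreal (w s) + ennreal e"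
        using b(2)[OF p] good_pathD(5)[OF s] e by (simp add: ennreal_plus[symmetric] ennreal_leI less_imp_le del: ennreal_plus)
      finally show "(INF p. if s < dyad p then ennreal (w (dyad p)) else \<top>) \<le> ennreal (w s) + ennreal e" .
    qed
  qed
  then show ?thesis using good_pathD(5)[OF s] by (simp add: right_reg_def)
qed

context
  fixes x :: real
  assumes x: "0 < x"
begin

text \<open>Right continuity at 0 keeps the path below x for a while, and right continuity at the
  infimum shows that it is attained. With monotonicity, being below the level and being before the
  passage become the same condition.\<close>

lemma passage_time_pos: "0 < passage_time w x"
  and passage_time_iff: "0 \<le> s \<Longrightarrow> w s < x \<longleftrightarrow> s < passage_time w x"
proof -
  define A where "A = {s. 0 < s \<and> x \<le> w s}"
  obtain t where t: "t \<ge> 0" "x < w t" using good_pathD(4) by blast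
  have "t \<noteq> 0" using t x good_pathD(1) by auto
  then have ne: "A \<noteq> {}" using t by (auto simp: A_def intro!: exI[of _ t])
  have bdd: "bdd_below A" by (auto simp: A_def intro!: bdd_belowI[of _ 0])
  define \<sigma> where "\<sigma> = Inf A"
  have \<sigma>: "passage_time w x = \<sigma>" by (simp add: passage_time_def \<sigma>_def A_def)
  have "eventually (\<lambda>t. w t < x) (at_right 0)"
    using good_pathD(3)[of 0] good_pathD(1) x by (intro order_tendstoD) auto
  then obtain b where b: "b > 0" "\<And>t. 0 < t \<Longrightarrow> t < b \<Longrightarrow> w t < x"
    by (auto simp: eventually_at_right_field)
  have "b \<le> \<sigma>" unfolding \<sigma>_def
    by (rule cInf_greatest[OF ne]) (use b in \<open>force simp: A_def not_less[symmetric]\<close>)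
  then have pos: "0 < \<sigma>" using b by simp
  then show "0 < passage_time w x" by (simp add: \<sigma>)
  have at: "x \<le> w \<sigma>"
  proof (rule ccontr)
    assume n: "\<not> x \<le> w \<sigma>"
    then have "eventually (\<lambda>t. w t < x) (at_right \<sigma>)"
      using good_pathD(3)[of \<sigma>] pos by (intro order_tendstoD) auto
    then obtain b where b: "b > \<sigma>" "\<And>t. \<sigma> < t \<Longrightarrow> t < b \<Longrightarrow> w t < x"
      by (auto simp: eventually_at_right_field)
    obtain y where y: "y \<in> A" "y < b" using b(1) ne bdd unfolding \<sigma>_def by (auto simp: cInf_less_iff)
    then have "\<sigma> \<le> y" unfolding \<sigma>_def using bdd by (intro cInf_lower)
    then show False using y b(2)[of y] n by (cases "y = \<sigma>") (auto simp: A_def)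
  qed
  show "w s < x \<longleftrightarrow> s < passage_time w x" if s: "0 \<le> s"
  proof
    assume "w s < x"
    then show "s < passage_time w x" using at good_pathD(2)[of \<sigma> s] pos by (force simp: \<sigma>)
  next
    assume "s < passage_time w x"
    then have "s \<notin> A" unfolding \<sigma> \<sigma>_def using cInf_lower[OF _ bdd] by force
    then show "w s < x" using s x good_pathD(1) by (cases "s = 0") (auto simp: A_def)
  qed
qed

lemma pre_passage_ge: "w (dyad p) < x \<Longrightarrow> w (dyad p) \<le> pre_passage w x"
  and pre_passage_le: "pre_passage w x \<le> x"
  and pre_passage_approx: "a < pre_passage w x \<Longrightarrow> \<exists>p. w (dyad p) < x \<and> a < w (dyad p)"
proof -
  define L where "L = (SUP p. if w (dyad p) < x then ennreal (w (dyad p)) else 0)"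
  have "L \<le> ennreal x" unfolding L_def by (rule SUP_least) (auto intro: ennreal_leI)
  moreover have pL: "pre_passage w x = enn2real L" by (simp only: pre_passage_def L_def)
  ultimately have L: "L = ennreal (pre_passage w x)" "pre_passage w x \<le> x"
    using x le_less_trans[of L "ennreal x" \<top>] by (simp_all add: enn2real_leI)
  show "pre_passage w x \<le> x" by fact
  note nn = pre_passage_nonneg
  show "w (dyad p) \<le> pre_passage w x" if "w (dyad p) < x"
  proof -
    have "ennreal (w (dyad p)) \<le> L" unfolding L_def using that by (intro SUP_upper2[of p]) auto
    then show ?thesis unfolding L(1) using nn by (simp add: ennreal_le_iff)
  qed
  show "\<exists>p. w (dyad p) < x \<and> a < w (dyad p)" if a: "a < pre_passage w x"
  proof (cases "a < 0")
    case True
    \<comment> \<open>The witness is time 0, where the path has the value 0, below x and above the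
      negative \<open>a\<close>.\<close>
    then show ?thesis using good_pathD(1) x by (intro exI[of _ "(0, 0)"]) (simp add: dyad_def)
  next
    case False
    then have "ennreal a < L" unfolding L(1) using a by (intro ennreal_lessI) auto
    then obtain p where p: "ennreal a < (if w (dyad p) < x then ennreal (w (dyad p)) else 0)"
      unfolding L_def less_SUP_iff by auto
    then show ?thesis using False by (intro exI[of _ p]) (auto simp: ennreal_less_iff split: if_splits)
  qed
qed

text \<open>\<open>pre_passage\<close> is the supremum of the path over dyadic times before the
  passage. Such times come arbitrarily close to the passage, so for a monotone path this supremum is
  the left limit.\<close>

lemma tendsto_pre_passage: "(w \<longlongrightarrow> pre_passage w x) (at_left (passage_time w x))"
proof (rule order_tendstoI)
  fix a assume "a < pre_passage w x"
  then obtain p where p: "w (dyad p) < x" "a < w (dyad p)" using pre_passage_approx by blast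
  then have "dyad p < passage_time w x" using passage_time_iff by simp
  then show "eventually (\<lambda>s. a < w s) (at_left (passage_time w x))"
    using p(2) good_pathD(2)[of "dyad p"]
    by (auto simp: eventually_at_left_field intro!: exI[of _ "dyad p"] less_le_trans[of a "w (dyad p)"])
next
  fix a assume a: "pre_passage w x < a"
  have "w s < a" if s: "0 < s" "s < passage_time w x" for s
  proof -
    obtain p where p: "s < dyad p" "dyad p < passage_time w x" using s dyad_dense[of s] by auto
    then have "w (dyad p) \<le> pre_passage w x" using pre_passage_ge passage_time_iff by simp
    moreover have "w s \<le> w (dyad p)" using good_pathD(2)[of s "dyad p"] s p by simp
    ultimately show ?thesis using a by simp
  qed
  then show "eventually (\<lambda>s. w s < a) (at_left (passage_time w x))"
    using passage_time_pos by (auto simp: eventually_at_left_field)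
qed

end

lemma pre_passage_mono: "0 < x \<Longrightarrow> x \<le> y \<Longrightarrow> pre_passage w x \<le> pre_passage w y"
  using pre_passage_approx[of x "pre_passage w y"] pre_passage_ge[of y]
  by (meson leD less_le_trans not_le_imp_less)

text \<open>A supremum of path values below the level is nondecreasing and left continuous in the
  level. Continuity from the right fails at heights that the path reaches by a jump, hence the
  approach from below.\<close>

lemma pre_passage_left_continuous:
  assumes x: "0 < x" and u: "\<And>n. 0 < u n \<and> u n < x" "u \<longlonglongrightarrow> x"
  shows "(\<lambda>n. pre_passage w (u n)) \<longlonglongrightarrow> pre_passage w x"
proof (rule order_tendstoI)
  fix a assume "a < pre_passage w x"
  then obtain p where p: "w (dyad p) < x" "a < w (dyad p)" using pre_passage_approx[OF x] by blast
  have "eventually (\<lambda>n. w (dyad p) < u n) sequentially" using u(2) p(1) by (rule order_tendstoD)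
  then show "eventually (\<lambda>n. a < pre_passage w (u n)) sequentially"
    by eventually_elim (use p u pre_passage_ge in \<open>meson less_le_trans\<close>)
next
  fix a assume a: "pre_passage w x < a"
  show "eventually (\<lambda>n. pre_passage w (u n) < a) sequentially"
    using pre_passage_mono u(1) a by (intro always_eventually) (meson le_less_trans less_imp_le)
qed

text \<open>Exactly one grid cell contains the passage over x, so the sum collapses to its value at
  the last grid time before the passage. These grid times tend to the passage time strictly from the
  left, where the path has the limit \<open>pre_passage w x\<close>.\<close>

lemma grid_pre_passage:
  assumes x: "0 < x"
  shows "(\<lambda>n. \<Sum>i. ennreal (exp (- k * w (real i / 2 ^ n))) * indicator {w (real i / 2 ^ n)<..w (real (Suc i) / 2 ^ n)} x)
     \<longlonglongrightarrow> ennreal (exp (- k * pre_passage w x))" (is ?lim)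
    and "0 \<le> k \<Longrightarrow> (\<Sum>i. ennreal (exp (- k * w (real i / 2 ^ n))) * indicator {w (real i / 2 ^ n)<..w (real (Suc i) / 2 ^ n)} x) \<le> 1"
proof -
  let ?\<sigma> = "passage_time w x"
  \<comment> \<open>The largest index whose grid time is strictly before the passage; a floor would
    be wrong when the passage happens at a grid time.\<close>
  define j where "j n = nat (\<lceil>?\<sigma> * 2 ^ n\<rceil> - 1)" for n :: nat
  define t where "t n = real (j n) / 2 ^ n" for n
  have jr: "real (j n) = of_int (\<lceil>?\<sigma> * 2 ^ n\<rceil> - 1)" for n
    unfolding j_def using passage_time_pos[OF x] by (subst of_nat_nat) (auto simp: less_ceiling_iff)
  have j: "real (j n) < ?\<sigma> * 2 ^ n \<and> ?\<sigma> * 2 ^ n \<le> real (Suc (j n))" for n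
    using jr[of n] by linarith
  have eq: "(\<Sum>i. ennreal (exp (- k * w (real i / 2 ^ n))) * indicator {w (real i / 2 ^ n)<..w (real (Suc i) / 2 ^ n)} x)
     = ennreal (exp (- k * w (t n)))" (is "(\<Sum>i. ?f i) = _") for n
  proof -
    have "x \<in> {w (real i / 2 ^ n)<..w (real (Suc i) / 2 ^ n)} \<longleftrightarrow> i = j n" for i
    proof -
      have "w (real i / 2 ^ n) < x \<longleftrightarrow> real i < ?\<sigma> * 2 ^ n"
        using passage_time_iff[OF x, of "real i / 2 ^ n"] by (simp add: field_simps)
      moreover have "x \<le> w (real (Suc i) / 2 ^ n) \<longleftrightarrow> ?\<sigma> * 2 ^ n \<le> real (Suc i)"
        using passage_time_iff[OF x, of "real (Suc i) / 2 ^ n"] by (simp add: field_simps not_less[symmetric] del: of_nat_Suc)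
      ultimately have "x \<in> {w (real i / 2 ^ n)<..w (real (Suc i) / 2 ^ n)} \<longleftrightarrow> real i < ?\<sigma> * 2 ^ n \<and> ?\<sigma> * 2 ^ n \<le> real (Suc i)" by simp
      also have "\<dots> \<longleftrightarrow> i = j n" using j[of n]
      proof (intro iffI conjI)
        assume "real i < ?\<sigma> * 2 ^ n \<and> ?\<sigma> * 2 ^ n \<le> real (Suc i)"
        then have "real i < real (Suc (j n))" "real (j n) < real (Suc i)" using j[of n] by linarith+
        then show "i = j n" by linarith
      qed auto
      finally show ?thesis .
    qed
    then have "?f = (\<lambda>i. if i = j n then ennreal (exp (- k * w (t n))) else 0)"
      unfolding t_def by (intro ext) (simp add: indicator_def del: of_nat_Suc greaterThanAtMost_iff)
    then show ?thesis using sums_unique[OF sums_single[of "j n" "\<lambda>_. ennreal (exp (- k * w (t n)))"]] by simp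
  qed
  have "filterlim t (at_left ?\<sigma>) sequentially"
    unfolding filterlim_at
  proof (intro conjI always_eventually allI)
    show "t n \<in> {..<?\<sigma>}" "t n \<noteq> ?\<sigma>" for n using j[of n] by (auto simp: t_def field_simps)
    show "t \<longlonglongrightarrow> ?\<sigma>"
    proof (rule tendsto_sandwich[of "\<lambda>n. ?\<sigma> - (1/2) ^ n" _ _ "\<lambda>_. ?\<sigma>"])
      have "(\<lambda>n. ?\<sigma> - (1/2) ^ n) \<longlonglongrightarrow> ?\<sigma> - 0" by (intro tendsto_intros LIMSEQ_realpow_zero) auto
      then show "(\<lambda>n. ?\<sigma> - (1/2) ^ n) \<longlonglongrightarrow> ?\<sigma>" by simp
      show "eventually (\<lambda>n. ?\<sigma> - (1/2) ^ n \<le> t n) sequentially"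
      proof (intro always_eventually allI)
        fix n
        have "?\<sigma> \<le> real (Suc (j n)) / 2 ^ n" using j[of n] by (subst pos_le_divide_eq) auto
        then show "?\<sigma> - (1/2) ^ n \<le> t n" by (simp add: t_def add_divide_distrib power_one_over)
      qed
      show "eventually (\<lambda>n. t n \<le> ?\<sigma>) sequentially"
        using j by (intro always_eventually allI) (simp add: t_def field_simps less_imp_le)
    qed simp
  qed
  then have "(\<lambda>n. w (t n)) \<longlonglongrightarrow> pre_passage w x"
    by (rule filterlim_compose[OF tendsto_pre_passage[OF x]])
  then show ?lim unfolding eq by (intro tendsto_intros)
  show "(\<Sum>i. ennreal (exp (- k * w (real i / 2 ^ n))) * indicator {w (real i / 2 ^ n)<..w (real (Suc i) / 2 ^ n)} x) \<le> 1" if "0 \<le> k"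
    unfolding eq using that good_pathD(5)[of "t n"] by (simp add: t_def mult_nonneg_nonneg)
qed

end

subsection \<open>Stable subordinators\<close>

text \<open>Here \<open>Y\<close> is the increasing process; in the censored process it is the
  negative of one of the paths \<open>S j\<close>.\<close>

locale subordinator =
  fixes M :: "'w measure" and \<beta> :: real and Y :: "real \<Rightarrow> 'w \<Rightarrow> real"
  assumes sub: "stable_subordinator M \<beta> Y" and \<beta>: "0 < \<beta>" "\<beta> < 1"
begin

sublocale prob_space M
  using sub by (simp add: stable_subordinator_def levy_process_def)

abbreviation path :: "'w \<Rightarrow> real \<Rightarrow> real" where "path \<omega> \<equiv> \<lambda>t. Y t \<omega>"

lemma Y_measurable: "0 \<le> t \<Longrightarrow> Y t \<in> borel_measurable M"
  using sub by (simp add: stable_subordinator_def levy_process_def)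

lemma Y_dyad_measurable [measurable]: "Y (dyad p) \<in> borel_measurable M"
  by (rule Y_measurable) simp

lemma path_measurable [measurable]: "(\<lambda>\<omega>. restrict (path \<omega>) {0..}) \<in> M \<rightarrow>\<^sub>M path_space"
  by (rule measurable_restrict) (simp add: Y_measurable)

lemma AE_Y_0: "AE \<omega> in M. Y 0 \<omega> = 0"
  using sub by (simp add: stable_subordinator_def levy_process_def)

lemma AE_cadlag: "AE \<omega> in M. cadlag (path \<omega>)"
  using sub by (simp add: stable_subordinator_def levy_process_def)

lemma distr_increment: "0 \<le> s \<Longrightarrow> 0 \<le> t \<Longrightarrow> distr M borel (\<lambda>\<omega>. Y (s + t) \<omega> - Y s \<omega>) = distr M borel (Y t)"
  using sub by (simp add: stable_subordinator_def levy_process_def)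

lemma Laplace_Y:
  assumes "0 < k" "0 \<le> s"
  shows "(\<integral>\<^sup>+\<omega>. ennreal (exp (- k * Y s \<omega>)) \<partial>M) = ennreal (exp (- s * k powr \<beta>))"
proof (cases "s = 0")
  case True
  have "(\<integral>\<^sup>+\<omega>. ennreal (exp (- k * Y 0 \<omega>)) \<partial>M) = (\<integral>\<^sup>+\<omega>. 1 \<partial>M)"
    by (rule nn_integral_cong_AE) (use AE_Y_0 in eventually_elim, simp)
  then show ?thesis using True by (simp add: emeasure_space_1)
next
  case False
  then have eq: "(LINT \<omega>|M. exp (- k * Y s \<omega>)) = exp (- s * k powr \<beta>)"
    using sub assms by (simp add: stable_subordinator_def)
  \<comment> \<open>The Bochner integral of a non-integrable function is 0 by convention, whereas
    the value here is an exponential.\<close>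
  then have "integrable M (\<lambda>\<omega>. exp (- k * Y s \<omega>))"
    using not_integrable_integral_eq by fastforce
  then have "(\<integral>\<^sup>+\<omega>. ennreal (exp (- k * Y s \<omega>)) \<partial>M) = ennreal (LINT \<omega>|M. exp (- k * Y s \<omega>))"
    by (intro nn_integral_eq_integral) auto
  then show ?thesis using eq by simp
qed

text \<open>A Chernoff bound: the Laplace transform is at most 1 for every k, so the probability of
  a value at most -1/(m+1) is at most exp (- k/(m+1)). Let k tend to infinity, then take the union
  over m.\<close>

lemma AE_Y_nonneg:
  assumes "0 \<le> s"
  shows "AE \<omega> in M. 0 \<le> Y s \<omega>"
proof -
  note [measurable] = Y_measurable[OF assms]
  have "AE \<omega> in M. \<not> Y s \<omega> \<le> - (1 / real (Suc m))" for m
  proof (rule AE_I[OF order_refl])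
    define A where "A = {\<omega> \<in> space M. \<not> \<not> Y s \<omega> \<le> - (1 / real (Suc m))}"
    have [measurable]: "A \<in> sets M" unfolding A_def by measurable
    have "emeasure M A \<le> ennreal (exp (- real k / real (Suc m)))" if k: "k > 0" for k :: nat
    proof -
      have "emeasure M A = (\<integral>\<^sup>+\<omega>. indicator A \<omega> \<partial>M)" by simp
      also have "\<dots> \<le> (\<integral>\<^sup>+\<omega>. ennreal (exp (- real k / real (Suc m))) * ennreal (exp (- real k * Y s \<omega>)) \<partial>M)"
      proof (rule nn_integral_mono)
        fix \<omega>
        have "1 \<le> exp (- real k / real (Suc m)) * exp (- real k * Y s \<omega>)" if "\<omega> \<in> A"
        proof -
          have "real k * Y s \<omega> \<le> real k * (- (1 / real (Suc m)))"
            using that by (intro mult_left_mono) (auto simp: A_def)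
          then show ?thesis by (simp add: exp_add[symmetric])
        qed
        then show "indicator A \<omega> \<le> ennreal (exp (- real k / real (Suc m))) * ennreal (exp (- real k * Y s \<omega>))"
          by (auto simp: indicator_def ennreal_mult'[symmetric] ennreal_1[symmetric] simp del: ennreal_1 intro!: ennreal_leI)
      qed
      also have "\<dots> = ennreal (exp (- real k / real (Suc m))) * ennreal (exp (- s * real k powr \<beta>))"
        using Laplace_Y[of "real k" s] k assms by (subst nn_integral_cmult) auto
      also have "\<dots> \<le> ennreal (exp (- real k / real (Suc m))) * 1"
        using assms by (intro mult_left_mono) (auto simp: mult_nonneg_nonneg)
      finally show ?thesis by simp
    qed
    then have "emeasure M A \<le> ennreal 0"
    proof (intro LIMSEQ_le_const[where X="\<lambda>k. ennreal (exp (- real k / real (Suc m)))"] tendsto_ennrealI)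
      show "(\<lambda>k. exp (- real k / real (Suc m))) \<longlonglongrightarrow> 0"
      proof -
        have "(\<lambda>k. exp (- real k / a)) \<longlonglongrightarrow> 0" if "a > 0" for a :: real using that by real_asymp
        then show ?thesis by simp
      qed
    qed (auto intro!: exI[of _ 1])
    then show "emeasure M {\<omega> \<in> space M. \<not> \<not> Y s \<omega> \<le> - (1 / real (Suc m))} = 0"
      by (simp add: A_def)
    show "{\<omega> \<in> space M. \<not> \<not> Y s \<omega> \<le> - (1 / real (Suc m))} \<in> sets M" by measurable
  qed
  then have "AE \<omega> in M. \<forall>m. \<not> Y s \<omega> \<le> - (1 / real (Suc m))" by (simp add: AE_all_countable)
  then show ?thesis
  proof eventually_elim
    case (elim \<omega>)
    show ?case
    proof (rule ccontr)
      assume "\<not> 0 \<le> Y s \<omega>"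
      then obtain m where "inverse (real (Suc m)) < - Y s \<omega>" using reals_Archimedean[of "- Y s \<omega>"] by auto
      then show False using elim[rule_format, of m] by (simp add: inverse_eq_divide)
    qed
  qed
qed

lemma AE_increment_nonneg:
  assumes "0 \<le> s" "s \<le> t"
  shows "AE \<omega> in M. Y s \<omega> \<le> Y t \<omega>"
proof -
  note [measurable] = Y_measurable[of s] Y_measurable[of t] Y_measurable[of "t - s"]
  have "AE x in distr M borel (Y (t - s)). 0 \<le> x"
    using AE_Y_nonneg[of "t - s"] assms by (subst AE_distr_iff) (auto simp: Y_measurable)
  then have "AE x in distr M borel (\<lambda>\<omega>. Y (s + (t - s)) \<omega> - Y s \<omega>). 0 \<le> x"
    using assms by (subst distr_increment) simp_all
  then have "AE \<omega> in M. 0 \<le> Y t \<omega> - Y s \<omega>"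
    using assms by (subst (asm) AE_distr_iff) (auto simp: Y_measurable)
  then show ?thesis by eventually_elim simp
qed

text \<open>The infimum of exp (- Y n) over n has expectation at most exp (- n) for every n, hence
  vanishes almost surely.\<close>

lemma AE_unbounded: "AE \<omega> in M. \<forall>c. \<exists>n::nat. c < Y (real n) \<omega>"
proof -
  note [measurable] = Y_measurable[OF of_nat_0_le_iff]
  define Z where "Z \<omega> = (INF n::nat. ennreal (exp (- Y (real n) \<omega>)))" for \<omega>
  have [measurable]: "Z \<in> borel_measurable M" unfolding Z_def by measurable
  have le: "(\<integral>\<^sup>+\<omega>. Z \<omega> \<partial>M) \<le> ennreal (exp (- real n))" for n
  proof -
    have "(\<integral>\<^sup>+\<omega>. Z \<omega> \<partial>M) \<le> (\<integral>\<^sup>+\<omega>. ennreal (exp (- Y (real n) \<omega>)) \<partial>M)"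
      unfolding Z_def by (intro nn_integral_mono INF_lower) auto
    then show ?thesis using Laplace_Y[of 1 "real n"] by simp
  qed
  have "(\<integral>\<^sup>+\<omega>. Z \<omega> \<partial>M) \<le> ennreal 0"
  proof (intro LIMSEQ_le_const[where X="\<lambda>n. ennreal (exp (- real n))"] tendsto_ennrealI)
    show "(\<lambda>n. exp (- real n)) \<longlonglongrightarrow> 0" by real_asymp
  qed (use le in auto)
  then have "AE \<omega> in M. Z \<omega> = 0" by (simp add: nn_integral_0_iff_AE)
  then show ?thesis
  proof eventually_elim
    case (elim \<omega>)
    show ?case
    proof
      fix c
      have "Z \<omega> < ennreal (exp (- c))" using elim by simp
      then obtain n where "ennreal (exp (- Y (real n) \<omega>)) < ennreal (exp (- c))"
        unfolding Z_def INF_less_iff by auto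
      then show "\<exists>n::nat. c < Y (real n) \<omega>" by (auto simp: ennreal_less_iff)
    qed
  qed
qed

text \<open>Each single increment is nonnegative almost surely, so off one null set the path is
  monotone on the countable set of dyadic times. Right continuity extends this to all times.\<close>

lemma AE_good_path: "AE \<omega> in M. good_path (path \<omega>)"
proof -
  have "AE \<omega> in M. \<forall>p q. dyad p \<le> dyad q \<longrightarrow> Y (dyad p) \<omega> \<le> Y (dyad q) \<omega>"
  proof (subst AE_all_countable, intro allI, subst AE_all_countable, intro allI)
    show "AE \<omega> in M. dyad p \<le> dyad q \<longrightarrow> Y (dyad p) \<omega> \<le> Y (dyad q) \<omega>" for p q
      using AE_increment_nonneg[of "dyad p" "dyad q"] by (cases "dyad p \<le> dyad q") auto
  qed
  then show ?thesis using AE_Y_0 AE_cadlag AE_unbounded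
  proof eventually_elim
    case (elim \<omega>)
    have rc: "(path \<omega> \<longlongrightarrow> Y t \<omega>) (at_right t)" if "t \<ge> 0" for t
      using elim(3) that by (simp add: cadlag_def)
    have "Y s \<omega> \<le> Y t \<omega>" if st: "0 \<le> s" "s \<le> t" for s t
    proof (rule ccontr)
      assume n: "\<not> Y s \<omega> \<le> Y t \<omega>"
      then have lt: "s < t" using st by (cases "s = t") auto
      obtain c where c: "Y t \<omega> < c" "c < Y s \<omega>" using n dense[of "Y t \<omega>" "Y s \<omega>"] by auto
      obtain b where b: "b > s" "\<And>u. s < u \<Longrightarrow> u < b \<Longrightarrow> c < Y u \<omega>"
        using order_tendstoD(1)[OF rc[OF st(1)] c(2)] by (auto simp: eventually_at_right_field)
      obtain d where d: "d > t" "\<And>u. t < u \<Longrightarrow> u < d \<Longrightarrow> Y u \<omega> < c"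
        using order_tendstoD(2)[OF rc c(1)] st by (auto simp: eventually_at_right_field)
      obtain p where p: "s < dyad p" "dyad p < min b t" using dyad_dense[of s "min b t"] b(1) lt st by auto
      obtain q where q: "t < dyad q" "dyad q < d" using dyad_dense[of t d] d(1) st by auto
      have "Y (dyad p) \<omega> \<le> Y (dyad q) \<omega>" using elim(1)[rule_format, of p q] p q by simp
      then show False using b(2)[of "dyad p"] d(2)[of "dyad q"] p q by force
    qed
    moreover have "\<exists>t\<ge>0. c < Y t \<omega>" for c using elim(4) of_nat_0_le_iff by blast
    ultimately show ?case using elim(2) rc by (auto simp: good_path_def mono_on_def)
  qed
qed

lemma nn_integral_increment:
  assumes st: "0 \<le> s" "0 \<le> t" and cq: "0 < c" "0 < q"
  shows "(\<integral>\<^sup>+\<omega>. ennreal (exp (- c * Y s \<omega>)) * ennreal (exp (- q * (Y (s + t) \<omega> - Y s \<omega>))) \<partial>M) =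
         ennreal (exp (- s * c powr \<beta>)) * ennreal (exp (- t * q powr \<beta>))"
proof -
  note [measurable] = Y_measurable[OF st(1)] Y_measurable[OF st(2)] Y_measurable[OF add_nonneg_nonneg[OF st]] Y_measurable[OF order_refl]
  \<comment> \<open>The independence hypothesis concerns increments only. The partition 0, s, s + t
    presents \<open>Y s\<close> as the increment from time 0, up to the null set where
    \<open>Y 0\<close> is not 0.\<close>
  define u where "u i = (if i = 0 then 0 else if i = 1 then s else s + t)" for i :: nat
  define k where "k i = (if i = 0 then c else q)" for i :: nat
  have "indep_vars (\<lambda>_. borel) (\<lambda>i \<omega>. Y (u (Suc i)) \<omega> - Y (u i) \<omega>) {..<2}"
    using sub st unfolding stable_subordinator_def levy_process_def
    by (elim conjE allE[where x="2::nat"] allE[where x=u]) (auto simp: u_def)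
  then have "indep_vars (\<lambda>_. borel) (\<lambda>i \<omega>. ennreal (exp (- k i * (Y (u (Suc i)) \<omega> - Y (u i) \<omega>)))) {..<2}"
    by (rule indep_vars_compose2[where Y="\<lambda>i x. ennreal (exp (- k i * x))"]) measurable
  then have "(\<integral>\<^sup>+\<omega>. (\<Prod>i<2. ennreal (exp (- k i * (Y (u (Suc i)) \<omega> - Y (u i) \<omega>)))) \<partial>M) =
     (\<Prod>i<2. \<integral>\<^sup>+\<omega>. ennreal (exp (- k i * (Y (u (Suc i)) \<omega> - Y (u i) \<omega>))) \<partial>M)"
    by (intro indep_vars_nn_integral) auto
  then have eq: "(\<integral>\<^sup>+\<omega>. ennreal (exp (- c * (Y s \<omega> - Y 0 \<omega>))) * ennreal (exp (- q * (Y (s + t) \<omega> - Y s \<omega>))) \<partial>M) =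
     (\<integral>\<^sup>+\<omega>. ennreal (exp (- c * (Y s \<omega> - Y 0 \<omega>))) \<partial>M) * (\<integral>\<^sup>+\<omega>. ennreal (exp (- q * (Y (s + t) \<omega> - Y s \<omega>))) \<partial>M)"
    by (simp add: numeral_2_eq_2 u_def k_def)
  have "(\<integral>\<^sup>+\<omega>. ennreal (exp (- q * (Y (s + t) \<omega> - Y s \<omega>))) \<partial>M) =
        (\<integral>\<^sup>+x. ennreal (exp (- q * x)) \<partial>distr M borel (\<lambda>\<omega>. Y (s + t) \<omega> - Y s \<omega>))"
    by (subst nn_integral_distr) auto
  also have "\<dots> = (\<integral>\<^sup>+\<omega>. ennreal (exp (- q * Y t \<omega>)) \<partial>M)"
    unfolding distr_increment[OF st] by (subst nn_integral_distr) auto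
  also have "\<dots> = ennreal (exp (- t * q powr \<beta>))" by (rule Laplace_Y[OF cq(2) st(2)])
  finally have e2: "(\<integral>\<^sup>+\<omega>. ennreal (exp (- q * (Y (s + t) \<omega> - Y s \<omega>))) \<partial>M) = ennreal (exp (- t * q powr \<beta>))" .
  have "(\<integral>\<^sup>+\<omega>. ennreal (exp (- c * (Y s \<omega> - Y 0 \<omega>))) \<partial>M) = (\<integral>\<^sup>+\<omega>. ennreal (exp (- c * Y s \<omega>)) \<partial>M)"
    by (rule nn_integral_cong_AE) (use AE_Y_0 in eventually_elim, simp)
  moreover have "(\<integral>\<^sup>+\<omega>. ennreal (exp (- c * (Y s \<omega> - Y 0 \<omega>))) * ennreal (exp (- q * (Y (s + t) \<omega> - Y s \<omega>))) \<partial>M) =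
     (\<integral>\<^sup>+\<omega>. ennreal (exp (- c * Y s \<omega>)) * ennreal (exp (- q * (Y (s + t) \<omega> - Y s \<omega>))) \<partial>M)"
    by (rule nn_integral_cong_AE) (use AE_Y_0 in eventually_elim, simp)
  ultimately show ?thesis using eq e2 Laplace_Y[OF cq(1) st(1)] by simp
qed

end

subsection \<open>The law of the undershoot\<close>

lemma nn_integral_exp_Ioc:
  fixes q a b :: real
  assumes "q > 0" "a \<le> b"
  shows "(\<integral>\<^sup>+x. ennreal (exp (- q * x)) * indicator {a<..b} x \<partial>lborel) = ennreal ((exp (- q * a) - exp (- q * b)) / q)"
proof -
  have "(\<integral>\<^sup>+x. ennreal (exp (- q * x)) * indicator {a<..b} x \<partial>lborel) = (\<integral>\<^sup>+x. ennreal (exp (- q * x)) * indicator {a..b} x \<partial>lborel)"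
    by (rule nn_integral_cong_AE, rule AE_mp[OF AE_lborel_singleton[of a]]) (auto simp: indicator_def)
  also have "\<dots> = ennreal (- exp (- q * b) / q - - exp (- q * a) / q)"
    by (rule nn_integral_FTC_Icc) (use assms in \<open>auto intro!: derivative_eq_intros\<close>)
  also have "- exp (- q * b) / q - - exp (- q * a) / q = (exp (- q * a) - exp (- q * b)) / q"
    by (simp add: diff_divide_distrib)
  finally show ?thesis .
qed

text \<open>A set of full measure is dense; this supplies points close to a given level where an
  almost everywhere identity holds.\<close>

lemma AE_lborel_interval_obtains:
  assumes "AE x in lborel. P x" "a < (b::real)"
  obtains x where "a < x" "x < b" "P x"
proof -
  obtain N where N: "{x \<in> space lborel. \<not> P x} \<subseteq> N" "emeasure lborel N = 0" "N \<in> sets lborel"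
    using assms(1) by (elim AE_E)
  have "\<not> {a<..<b} \<subseteq> N"
  proof
    assume "{a<..<b} \<subseteq> N"
    then have "emeasure lborel {a<..<b} \<le> emeasure lborel N" using N(3) by (intro emeasure_mono) auto
    then show False using N(2) assms(2) by simp
  qed
  then obtain x where "x \<in> {a<..<b}" "x \<notin> N" by blast
  then show thesis using N(1) by (intro that[of x]) auto
qed

text \<open>
  The law of the undershoot is found from its double Laplace transform: the kernel below has the
  transform \<open>q powr (\<beta> - 1) * (k + q) powr (- \<beta>)\<close> in \<open>(x, y)\<close>.
\<close>

definition arcsine_density :: "real \<Rightarrow> real \<Rightarrow> real \<Rightarrow> real" where
  "arcsine_density \<beta> x y = y powr (\<beta> - 1) * (x - y) powr (- \<beta>) / (Gamma \<beta> * Gamma (1 - \<beta>))"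

definition arcsine_Laplace :: "real \<Rightarrow> real \<Rightarrow> real \<Rightarrow> ennreal" where
  "arcsine_Laplace \<beta> k x = (\<integral>\<^sup>+y. ennreal (exp (- k * y)) * (ennreal (arcsine_density \<beta> x y) * indicator {0<..<x} y) \<partial>lborel)"

lemma arcsine_Laplace_measurable [measurable]: "arcsine_Laplace \<beta> k \<in> borel_measurable borel"
proof -
  have "arcsine_Laplace \<beta> k = (\<lambda>x. \<integral>\<^sup>+y. (if 0 < y \<and> y < x then ennreal (exp (- k * y)) * ennreal (arcsine_density \<beta> x y) else 0) \<partial>lborel)"
    unfolding arcsine_Laplace_def by (intro ext nn_integral_cong) (auto simp: indicator_def)
  then show ?thesis unfolding arcsine_density_def by simp
qed

context
  fixes \<beta> :: real
  assumes \<beta>: "0 < \<beta>" "\<beta> < 1"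
begin

lemma Gamma_product_pos: "Gamma \<beta> > 0" "Gamma (1 - \<beta>) > 0"
  using \<beta> by (auto intro!: Gamma_real_pos)

text \<open>After exchanging the integrals, x = y + z splits the exponent into (k + q) * y and q *
  z, and the double integral factors into two Gamma integrals.\<close>

lemma nn_integral_arcsine_Laplace:
  assumes kq: "0 < k" "0 < q"
  shows "(\<integral>\<^sup>+x. ennreal (exp (- q * x)) * (indicator {0<..} x * arcsine_Laplace \<beta> k x) \<partial>lborel) =
         ennreal (q powr (\<beta> - 1) * (k + q) powr (- \<beta>))"
proof -
  let ?G = "Gamma \<beta> * Gamma (1 - \<beta>)"
  note G = Gamma_product_pos
  define F where "F x y = (if 0 < y \<and> y < x then
     ennreal (exp (- q * x) * exp (- k * y) * arcsine_density \<beta> x y) else 0)" for x y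
  have Fm: "case_prod F \<in> borel_measurable (lborel \<Otimes>\<^sub>M lborel)"
    unfolding F_def[abs_def] arcsine_density_def by measurable
  have "(\<integral>\<^sup>+x. ennreal (exp (- q * x)) * (indicator {0<..} x * arcsine_Laplace \<beta> k x) \<partial>lborel) = (\<integral>\<^sup>+x. \<integral>\<^sup>+y. F x y \<partial>lborel \<partial>lborel)"
  proof (rule nn_integral_cong)
    fix x :: real
    have "(\<integral>\<^sup>+y. F x y \<partial>lborel) = (\<integral>\<^sup>+y. ennreal (exp (- q * x)) * indicator {0<..} x * (ennreal (exp (- k * y)) * (ennreal (arcsine_density \<beta> x y) * indicator {0<..<x} y)) \<partial>lborel)"
      using G by (intro nn_integral_cong) (auto simp: F_def indicator_def ennreal_mult'[symmetric] arcsine_density_def mult_ac)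
    also have "\<dots> = ennreal (exp (- q * x)) * indicator {0<..} x * arcsine_Laplace \<beta> k x"
      unfolding arcsine_Laplace_def by (rule nn_integral_cmult) (unfold arcsine_density_def, measurable)
    finally show "ennreal (exp (- q * x)) * (indicator {0<..} x * arcsine_Laplace \<beta> k x) = (\<integral>\<^sup>+y. F x y \<partial>lborel)" by (simp add: mult.assoc)
  qed
  also have "\<dots> = (\<integral>\<^sup>+y. \<integral>\<^sup>+x. F x y \<partial>lborel \<partial>lborel)" by (rule lborel_pair.Fubini'[OF Fm, symmetric])
  also have "\<dots> = (\<integral>\<^sup>+y. ennreal (exp (- (k + q) * y) * y powr (\<beta> - 1)) * indicator {0<..} y * ennreal (q powr (\<beta> - 1) / Gamma \<beta>) \<partial>lborel)"
  proof (rule nn_integral_cong)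
    fix y :: real
    have [measurable]: "(\<lambda>x. F x y) \<in> borel_measurable borel"
      unfolding F_def arcsine_density_def by measurable
    have "(\<integral>\<^sup>+x. F x y \<partial>lborel) = (\<integral>\<^sup>+z. F (y + z) y \<partial>lborel)"
      using nn_integral_real_affine[where c=1 and t=y and f="\<lambda>x. F x y"] by simp
    also have "\<dots> = (\<integral>\<^sup>+z. ennreal (exp (- (k + q) * y) * y powr (\<beta> - 1) / ?G) * indicator {0<..} y *
        (ennreal (exp (- q * z) * z powr ((1 - \<beta>) - 1)) * indicator {0<..} z) \<partial>lborel)"
      using G by (intro nn_integral_cong)
        (auto simp: F_def indicator_def ennreal_mult'[symmetric] arcsine_density_def exp_add[symmetric] algebra_simps intro!: arg_cong[where f=ennreal])
    also have "\<dots> = ennreal (exp (- (k + q) * y) * y powr (\<beta> - 1) / ?G) * indicator {0<..} y * ennreal (Gamma (1 - \<beta>) * q powr (- (1 - \<beta>)))"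
      using \<beta> kq by (subst nn_integral_cmult, measurable, subst nn_integral_Gamma_scaled) auto
    also have "\<dots> = ennreal (exp (- (k + q) * y) * y powr (\<beta> - 1)) * indicator {0<..} y * ennreal (q powr (\<beta> - 1) / Gamma \<beta>)"
      using G by (auto simp: indicator_def ennreal_mult'[symmetric] field_simps)
    finally show "(\<integral>\<^sup>+x. F x y \<partial>lborel) = ennreal (exp (- (k + q) * y) * y powr (\<beta> - 1)) * indicator {0<..} y * ennreal (q powr (\<beta> - 1) / Gamma \<beta>)" .
  qed
  also have "\<dots> = ennreal (Gamma \<beta> * (k + q) powr (- \<beta>)) * ennreal (q powr (\<beta> - 1) / Gamma \<beta>)"
    using \<beta> kq by (subst nn_integral_multc, measurable, subst nn_integral_Gamma_scaled) auto
  also have "\<dots> = ennreal (q powr (\<beta> - 1) * (k + q) powr (- \<beta>))"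
    using G by (simp add: ennreal_mult'[symmetric] mult.commute)
  finally show ?thesis .
qed

lemma arcsine_Laplace_eq:
  assumes "0 < k" "0 < x"
  shows "arcsine_Laplace \<beta> k x = ennreal ((LINT y|lborel. frac_kernel (1 - \<beta>) \<beta> x y * exp (- k * \<bar>y\<bar>)) / (Gamma \<beta> * Gamma (1 - \<beta>)))"
proof -
  note G = Gamma_product_pos
  have int: "integrable lborel (\<lambda>y. frac_kernel (1 - \<beta>) \<beta> x y * exp (- k * \<bar>y\<bar>))"
    using \<beta> assms by (intro frac_kernel_weighted(1)[where C=1]) auto
  have "arcsine_Laplace \<beta> k x = (\<integral>\<^sup>+y. ennreal (frac_kernel (1 - \<beta>) \<beta> x y * exp (- k * \<bar>y\<bar>) / (Gamma \<beta> * Gamma (1 - \<beta>))) \<partial>lborel)"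
    unfolding arcsine_Laplace_def using G
    by (intro nn_integral_cong) (auto simp: arcsine_density_def frac_kernel_def indicator_def ennreal_mult'[symmetric] mult_ac)
  also have "\<dots> = ennreal (LINT y|lborel. frac_kernel (1 - \<beta>) \<beta> x y * exp (- k * \<bar>y\<bar>) / (Gamma \<beta> * Gamma (1 - \<beta>)))"
    using G by (intro nn_integral_eq_integral integrable_divide int) (auto simp: less_imp_le)
  finally show ?thesis by simp
qed

lemma arcsine_Laplace_continuous:
  assumes "0 < k" "0 < x" "\<And>n. 0 < u n" "u \<longlonglongrightarrow> x"
  shows "(\<lambda>n. arcsine_Laplace \<beta> k (u n)) \<longlonglongrightarrow> arcsine_Laplace \<beta> k x"
proof -
  have "continuous_on {0<..} (\<lambda>x. LINT y|lborel. frac_kernel (1 - \<beta>) \<beta> x y * exp (- k * \<bar>y\<bar>))"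
    using \<beta> assms(1) by (intro continuous_on_frac_kernel_integral[where C=1]) auto
  then have "(\<lambda>n. LINT y|lborel. frac_kernel (1 - \<beta>) \<beta> (u n) y * exp (- k * \<bar>y\<bar>)) \<longlonglongrightarrow>
      (LINT y|lborel. frac_kernel (1 - \<beta>) \<beta> x y * exp (- k * \<bar>y\<bar>))"
    using assms by (rule_tac continuous_on_tendsto_compose[where s="{0<..}"]) auto
  then show ?thesis using Gamma_product_pos assms
    by (simp add: arcsine_Laplace_eq) (intro tendsto_intros, auto)
qed

end

lemma density_lborel_lessThan_0:
  fixes f :: "real \<Rightarrow> ennreal"
  assumes [measurable]: "f \<in> borel_measurable borel" and "\<And>y. y < 0 \<Longrightarrow> f y = 0"
  shows "emeasure (density lborel f) {..<0} = 0"
proof -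
  have "emeasure (density lborel f) {..<0} = (\<integral>\<^sup>+y. f y * indicator {..<0} y \<partial>lborel)"
    by (rule emeasure_density) auto
  also have "\<dots> = (\<integral>\<^sup>+y. 0 \<partial>(lborel :: real measure))"
    by (intro nn_integral_cong) (auto simp: assms(2) indicator_def)
  finally show ?thesis by simp
qed

section \<open>From dyadic grids to the position before passage\<close>

context subordinator
begin

lemma pre_passage_path_measurable [measurable]:
  assumes [measurable]: "f \<in> N \<rightarrow>\<^sub>M M" "h \<in> borel_measurable N"
  shows "(\<lambda>z. pre_passage (path (f z)) (h z)) \<in> borel_measurable N"
proof -
  have "(\<lambda>z. pre_passage (restrict (path (f z)) {0..}) (h z)) \<in> borel_measurable N"
    by measurable
  then show ?thesis by simp
qed

lemma right_reg_path_measurable [measurable]: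
  assumes [measurable]: "f \<in> N \<rightarrow>\<^sub>M M" "h \<in> borel_measurable N"
  shows "(\<lambda>z. right_reg (path (f z)) (h z)) \<in> borel_measurable N"
proof -
  have "(\<lambda>z. right_reg (restrict (path (f z)) {0..}) (h z)) \<in> borel_measurable N"
    by measurable
  then show ?thesis by simp
qed

text \<open>The difference quotient is the integral of exp (- q * x) over the heights crossed in one
  grid cell. The integrand is (A - B) / q, where A = exp (- (k + q) * Y s) and B is A times exp (- q
  * increment); independence and stationarity evaluate both means.\<close>

lemma nn_integral_grid_term:
  assumes kq: "0 < k" "0 < q"
  shows "(\<integral>\<^sup>+\<omega>. ennreal (exp (- k * Y (real i / 2 ^ n) \<omega>) *
             ((exp (- q * Y (real i / 2 ^ n) \<omega>) - exp (- q * Y (real (Suc i) / 2 ^ n) \<omega>)) / q)) \<partial>M) =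
         ennreal (exp (- ((k + q) powr \<beta>) / 2 ^ n) ^ i * ((1 - exp (- (q powr \<beta>) / 2 ^ n)) / q))"
proof -
  define s t where "s = real i / 2 ^ n" and "t = 1 / (2::real) ^ n"
  have st: "0 \<le> s" "0 \<le> t" "real (Suc i) / 2 ^ n = s + t" by (simp_all add: s_def t_def add_divide_distrib)
  note [measurable] = Y_measurable[OF st(1)] Y_measurable[OF add_nonneg_nonneg[OF st(1,2)]]
  define A where "A \<omega> = ennreal (exp (- (k + q) * Y s \<omega>))" for \<omega>
  define B where "B \<omega> = A \<omega> * ennreal (exp (- q * (Y (s + t) \<omega> - Y s \<omega>)))" for \<omega>
  have [measurable]: "A \<in> borel_measurable M" "B \<in> borel_measurable M" unfolding A_def B_def by measurable
  have intA: "(\<integral>\<^sup>+\<omega>. A \<omega> \<partial>M) = ennreal (exp (- s * (k + q) powr \<beta>))"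
    unfolding A_def using kq st by (intro Laplace_Y) auto
  have intB: "(\<integral>\<^sup>+\<omega>. B \<omega> \<partial>M) = ennreal (exp (- s * (k + q) powr \<beta>)) * ennreal (exp (- t * q powr \<beta>))"
    unfolding A_def B_def using kq st by (intro nn_integral_increment) auto
  have "(\<integral>\<^sup>+\<omega>. ennreal (exp (- k * Y s \<omega>) * ((exp (- q * Y s \<omega>) - exp (- q * Y (s + t) \<omega>)) / q)) \<partial>M) =
      (\<integral>\<^sup>+\<omega>. (A \<omega> - B \<omega>) * ennreal (1 / q) \<partial>M)"
  proof (rule nn_integral_cong)
    fix \<omega>
    have e: "B \<omega> = ennreal (exp (- k * Y s \<omega>) * exp (- q * Y (s + t) \<omega>))"
      by (simp add: A_def B_def ennreal_mult'[symmetric] exp_add[symmetric] algebra_simps)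
    have e': "A \<omega> = ennreal (exp (- k * Y s \<omega>) * exp (- q * Y s \<omega>))"
      by (simp add: A_def exp_add[symmetric] algebra_simps)
    have "A \<omega> - B \<omega> = ennreal (exp (- k * Y s \<omega>) * exp (- q * Y s \<omega>) - exp (- k * Y s \<omega>) * exp (- q * Y (s + t) \<omega>))"
      unfolding e e' by (rule ennreal_minus) simp
    then show "ennreal (exp (- k * Y s \<omega>) * ((exp (- q * Y s \<omega>) - exp (- q * Y (s + t) \<omega>)) / q)) = (A \<omega> - B \<omega>) * ennreal (1 / q)"
      using kq by (simp add: ennreal_mult''[symmetric] right_diff_distrib)
  qed
  also have "\<dots> = ((\<integral>\<^sup>+\<omega>. A \<omega> \<partial>M) - (\<integral>\<^sup>+\<omega>. B \<omega> \<partial>M)) * ennreal (1 / q)"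
  proof (subst nn_integral_multc, measurable, subst nn_integral_diff)
    show "(\<integral>\<^sup>+\<omega>. B \<omega> \<partial>M) \<noteq> \<infinity>" unfolding intB by (simp add: ennreal_mult_eq_top_iff)
    have "AE \<omega> in M. Y s \<omega> \<le> Y (s + t) \<omega>" using AE_increment_nonneg st by simp
    then show "AE \<omega> in M. B \<omega> \<le> A \<omega>"
    proof eventually_elim
      case (elim \<omega>)
      then have "ennreal (exp (- q * (Y (s + t) \<omega> - Y s \<omega>))) \<le> 1" using kq by simp
      then show ?case unfolding B_def using mult_left_mono[of _ 1 "A \<omega>"] by simp
    qed
  qed measurable
  also have "\<dots> = ennreal (exp (- s * (k + q) powr \<beta>) * ((1 - exp (- t * q powr \<beta>)) / q))"
    unfolding intA intB using kq
    by (simp add: ennreal_mult''[symmetric] ennreal_minus right_diff_distrib)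
  also have "exp (- s * (k + q) powr \<beta>) = exp (- ((k + q) powr \<beta>) / 2 ^ n) ^ i"
    by (simp add: s_def exp_of_nat_mult[symmetric])
  also have "- t * q powr \<beta> = - (q powr \<beta>) / 2 ^ n" by (simp add: t_def)
  finally show ?thesis unfolding st s_def[symmetric] .
qed

text \<open>On a good path and for x > 0 this is exp (- k * h), where h is the height at the last
  grid time before the passage over x. Summing over cells keeps all times deterministic, so the
  integral and the expectation can be taken cell by cell.\<close>

definition grid_sum :: "real \<Rightarrow> nat \<Rightarrow> 'w \<Rightarrow> real \<Rightarrow> ennreal" where
  "grid_sum k n \<omega> x = (\<Sum>i. ennreal (exp (- k * Y (real i / 2 ^ n) \<omega>)) *
      indicator {Y (real i / 2 ^ n) \<omega><..Y (real (Suc i) / 2 ^ n) \<omega>} x)"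

lemma grid_sum_measurable [measurable]:
  "(\<lambda>(\<omega>, x). grid_sum k n \<omega> x) \<in> borel_measurable (M \<Otimes>\<^sub>M borel)"
proof -
  have [measurable]: "Y (real i / 2 ^ n) \<in> borel_measurable M" for i by (rule Y_measurable) simp
  have eq: "(\<lambda>(\<omega>, x). grid_sum k n \<omega> x) = (\<lambda>(\<omega>, x). \<Sum>i. ennreal (exp (- k * Y (real i / 2 ^ n) \<omega>)) *
      (if Y (real i / 2 ^ n) \<omega> < x \<and> x \<le> Y (real (Suc i) / 2 ^ n) \<omega> then 1 else 0))"
    by (simp add: grid_sum_def fun_eq_iff indicator_def of_bool_def)
  show ?thesis unfolding eq by measurable
qed

text \<open>Each cell contributes one term of \<open>nn_integral_grid_term\<close>. The ratio of the
  resulting geometric series is the mean of exp (- (k + q) * Y) at the first grid time.\<close>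

lemma nn_integral_grid_sum:
  assumes kq: "0 < k" "0 < q"
  shows "(\<integral>\<^sup>+\<omega>. \<integral>\<^sup>+x. ennreal (exp (- q * x)) * (indicator {0<..} x * grid_sum k n \<omega> x) \<partial>lborel \<partial>M) =
         ennreal ((1 - exp (- (q powr \<beta>) / 2 ^ n)) / (q * (1 - exp (- ((k + q) powr \<beta>) / 2 ^ n))))"
proof -
  have [measurable]: "Y (real i / 2 ^ n) \<in> borel_measurable M" for i by (rule Y_measurable) simp
  have "(\<integral>\<^sup>+\<omega>. \<integral>\<^sup>+x. ennreal (exp (- q * x)) * (indicator {0<..} x * grid_sum k n \<omega> x) \<partial>lborel \<partial>M) =
    (\<integral>\<^sup>+\<omega>. (\<Sum>i. ennreal (exp (- k * Y (real i / 2 ^ n) \<omega>) *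
             ((exp (- q * Y (real i / 2 ^ n) \<omega>) - exp (- q * Y (real (Suc i) / 2 ^ n) \<omega>)) / q))) \<partial>M)"
  proof (rule nn_integral_cong_AE, use AE_good_path in eventually_elim)
    case (elim \<omega>)
    define y where "y i = Y (real i / 2 ^ n) \<omega>" for i
    have y: "0 \<le> y i" "y i \<le> y (Suc i)" for i
      using good_pathD(5)[OF elim, of "real i / 2 ^ n"] good_pathD(2)[OF elim, of "real i / 2 ^ n" "real (Suc i) / 2 ^ n"]
      by (auto simp: y_def divide_right_mono)
    have "(\<integral>\<^sup>+x. ennreal (exp (- q * x)) * (indicator {0<..} x * grid_sum k n \<omega> x) \<partial>lborel) =
       (\<integral>\<^sup>+x. (\<Sum>i. ennreal (exp (- k * y i)) * (ennreal (exp (- q * x)) * indicator {y i<..y (Suc i)} x)) \<partial>lborel)"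
    proof (rule nn_integral_cong)
      fix x :: real
      have "ennreal (exp (- q * x)) * (indicator {0<..} x * grid_sum k n \<omega> x) =
         (\<Sum>i. (ennreal (exp (- q * x)) * indicator {0<..} x) * (ennreal (exp (- k * y i)) * indicator {y i<..y (Suc i)} x))"
        unfolding grid_sum_def y_def by (simp add: mult.assoc)
      also have "\<dots> = (\<Sum>i. ennreal (exp (- k * y i)) * (ennreal (exp (- q * x)) * indicator {y i<..y (Suc i)} x))"
        using y(1) by (intro suminf_cong) (auto simp: indicator_def mult_ac dest: le_less_trans)
      finally show "ennreal (exp (- q * x)) * (indicator {0<..} x * grid_sum k n \<omega> x) = \<dots>" .
    qed
    also have "\<dots> = (\<Sum>i. ennreal (exp (- k * y i)) * (\<integral>\<^sup>+x. ennreal (exp (- q * x)) * indicator {y i<..y (Suc i)} x \<partial>lborel))"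
      by (simp add: nn_integral_suminf nn_integral_cmult)
    also have "\<dots> = (\<Sum>i. ennreal (exp (- k * y i) * ((exp (- q * y i) - exp (- q * y (Suc i))) / q)))"
      by (subst nn_integral_exp_Ioc[OF kq(2) y(2)]) (simp add: ennreal_mult'[symmetric])
    finally show ?case unfolding y_def .
  qed
  also have "\<dots> = (\<Sum>i. ennreal (exp (- ((k + q) powr \<beta>) / 2 ^ n) ^ i * ((1 - exp (- (q powr \<beta>) / 2 ^ n)) / q)))"
    by (subst nn_integral_suminf) (simp_all only: nn_integral_grid_term[OF kq], measurable)
  also have "\<dots> = ennreal (\<Sum>i. exp (- ((k + q) powr \<beta>) / 2 ^ n) ^ i * ((1 - exp (- (q powr \<beta>) / 2 ^ n)) / q))"
    using kq by (intro suminf_ennreal2 summable_mult2 summable_geometric) auto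
  also have "(\<Sum>i. exp (- ((k + q) powr \<beta>) / 2 ^ n) ^ i * ((1 - exp (- (q powr \<beta>) / 2 ^ n)) / q)) =
     1 / (1 - exp (- ((k + q) powr \<beta>) / 2 ^ n)) * ((1 - exp (- (q powr \<beta>) / 2 ^ n)) / q)"
    using kq by (subst suminf_mult2[symmetric]) (auto simp: suminf_geometric intro!: summable_geometric)
  finally show ?thesis by (simp add: mult.commute)
qed

text \<open>First-order expansion of both exponentials in the mesh. It is applied with c = q powr
  \<beta> and d = (k + q) powr \<beta>.\<close>

lemma grid_limit:
  assumes "0 < c" "0 < d" "0 < (q::real)"
  shows "(\<lambda>n. (1 - exp (- c / 2 ^ n)) / (q * (1 - exp (- d / 2 ^ n)))) \<longlonglongrightarrow> c / (q * d)"
  using assms by (real_asymp simp: field_simps)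

lemma grid_sum_good:
  assumes "good_path (path \<omega>)" "0 < x" "0 \<le> k"
  shows "(\<lambda>n. grid_sum k n \<omega> x) \<longlonglongrightarrow> ennreal (exp (- k * pre_passage (path \<omega>) x))" "grid_sum k n \<omega> x \<le> 1"
  using grid_pre_passage[OF assms(1,2), of k] assms(3) by (simp_all add: grid_sum_def)

text \<open>The transform is that of the height just before passage, not of the gap left below the
  level; the reflection takes place in \<open>nn_integral_undershoot\<close>.\<close>

definition undershoot_Laplace :: "real \<Rightarrow> real \<Rightarrow> ennreal" where
  "undershoot_Laplace k x = (\<integral>\<^sup>+\<omega>. ennreal (exp (- k * pre_passage (path \<omega>) x)) \<partial>M)"

lemma undershoot_Laplace_measurable [measurable]: "undershoot_Laplace k \<in> borel_measurable borel"
  unfolding undershoot_Laplace_def by measurable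

text \<open>Since \<open>grid_sum\<close> is at most 1 on good paths, dominated convergence applies
  twice: in x with the weight exp (- q * x) of mass 1 / q, and in \<open>\<omega>\<close> with the
  constant 1 / q. A final exchange of integrals gives the transform in x.\<close>

lemma nn_integral_undershoot_Laplace:
  assumes kq: "0 < k" "0 < q"
  shows "(\<integral>\<^sup>+x. ennreal (exp (- q * x)) * (indicator {0<..} x * undershoot_Laplace k x) \<partial>lborel) =
         ennreal (q powr (\<beta> - 1) * (k + q) powr (- \<beta>))"
proof -
  interpret lM: pair_sigma_finite M "lborel :: real measure" ..
  define E where "E x = ennreal (exp (- q * x)) * indicator {0<..} x" for x :: real
  have [measurable]: "E \<in> borel_measurable borel" unfolding E_def by measurable
  have intE: "(\<integral>\<^sup>+x. E x \<partial>lborel) = ennreal (1 / q)"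
  proof -
    have "(\<integral>\<^sup>+x. E x \<partial>lborel) = (\<integral>\<^sup>+x. ennreal (exp (- q * x) * x powr (1 - 1)) * indicator {0<..} x \<partial>lborel)"
      by (intro nn_integral_cong) (auto simp: E_def indicator_def)
    also have "\<dots> = ennreal (1 / q)"
      using kq by (subst nn_integral_Gamma_scaled) (auto simp: powr_minus_divide)
    finally show ?thesis .
  qed
  define V where "V \<omega> x = ennreal (exp (- k * pre_passage (path \<omega>) x))" for \<omega> x
  have Vm [measurable]: "(\<lambda>(\<omega>, x). V \<omega> x) \<in> borel_measurable (M \<Otimes>\<^sub>M borel)"
    unfolding V_def by measurable
  have inner: "(\<lambda>n. \<integral>\<^sup>+x. E x * grid_sum k n \<omega> x \<partial>lborel) \<longlonglongrightarrow> (\<integral>\<^sup>+x. E x * V \<omega> x \<partial>lborel)"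
    and inner_le: "(\<integral>\<^sup>+x. E x * grid_sum k n \<omega> x \<partial>lborel) \<le> ennreal (1 / q)"
    if g: "good_path (path \<omega>)" and [measurable]: "\<omega> \<in> space M" for \<omega> n
  proof -
    have le: "E x * grid_sum k n \<omega> x \<le> E x" for x n
      using grid_sum_good(2)[OF g, of x k n] kq mult_left_mono[of "grid_sum k n \<omega> x" 1 "E x"]
      by (cases "0 < x") (auto simp: E_def)
    show "(\<integral>\<^sup>+x. E x * grid_sum k n \<omega> x \<partial>lborel) \<le> ennreal (1 / q)"
      unfolding intE[symmetric] by (intro nn_integral_mono le)
    show "(\<lambda>n. \<integral>\<^sup>+x. E x * grid_sum k n \<omega> x \<partial>lborel) \<longlonglongrightarrow> (\<integral>\<^sup>+x. E x * V \<omega> x \<partial>lborel)"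
    proof (rule nn_integral_dominated_convergence[where w=E])
      show "AE x in lborel. (\<lambda>n. E x * grid_sum k n \<omega> x) \<longlonglongrightarrow> E x * V \<omega> x"
      proof (rule AE_I2)
        fix x :: real
        show "(\<lambda>n. E x * grid_sum k n \<omega> x) \<longlonglongrightarrow> E x * V \<omega> x"
          using grid_sum_good(1)[OF g, of x k] kq unfolding V_def
          by (cases "0 < x") (auto simp: E_def intro!: ennreal_tendsto_cmult ennreal_mult_less_top)
      qed
    qed (auto simp: le intE)
  qed
  have "(\<lambda>n. \<integral>\<^sup>+\<omega>. \<integral>\<^sup>+x. E x * grid_sum k n \<omega> x \<partial>lborel \<partial>M) \<longlonglongrightarrow> (\<integral>\<^sup>+\<omega>. \<integral>\<^sup>+x. E x * V \<omega> x \<partial>lborel \<partial>M)"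
  proof (rule nn_integral_dominated_convergence[where w="\<lambda>_. ennreal (1 / q)"])
    show "AE \<omega> in M. (\<integral>\<^sup>+x. E x * grid_sum k n \<omega> x \<partial>lborel) \<le> ennreal (1 / q)" for n
      using AE_good_path AE_space by eventually_elim (rule inner_le)
    show "AE \<omega> in M. (\<lambda>n. \<integral>\<^sup>+x. E x * grid_sum k n \<omega> x \<partial>lborel) \<longlonglongrightarrow> (\<integral>\<^sup>+x. E x * V \<omega> x \<partial>lborel)"
      using AE_good_path AE_space by eventually_elim (rule inner)
  qed (auto simp: emeasure_space_1)
  moreover have "(\<integral>\<^sup>+\<omega>. \<integral>\<^sup>+x. E x * grid_sum k n \<omega> x \<partial>lborel \<partial>M) =
      ennreal ((1 - exp (- (q powr \<beta>) / 2 ^ n)) / (q * (1 - exp (- ((k + q) powr \<beta>) / 2 ^ n))))" for n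
    using nn_integral_grid_sum[OF kq, of n] by (simp add: E_def mult.assoc)
  moreover have "(\<lambda>n. ennreal ((1 - exp (- (q powr \<beta>) / 2 ^ n)) / (q * (1 - exp (- ((k + q) powr \<beta>) / 2 ^ n)))))
      \<longlonglongrightarrow> ennreal (q powr \<beta> / (q * (k + q) powr \<beta>))"
    using kq by (intro tendsto_ennrealI grid_limit) auto
  ultimately have "(\<integral>\<^sup>+\<omega>. \<integral>\<^sup>+x. E x * V \<omega> x \<partial>lborel \<partial>M) = ennreal (q powr \<beta> / (q * (k + q) powr \<beta>))"
    using LIMSEQ_unique by simp
  moreover have "(\<integral>\<^sup>+\<omega>. \<integral>\<^sup>+x. E x * V \<omega> x \<partial>lborel \<partial>M) = (\<integral>\<^sup>+x. \<integral>\<^sup>+\<omega>. E x * V \<omega> x \<partial>M \<partial>lborel)"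
    by (rule lM.Fubini'[symmetric]) measurable
  moreover have "(\<integral>\<^sup>+\<omega>. E x * V \<omega> x \<partial>M) = ennreal (exp (- q * x)) * (indicator {0<..} x * undershoot_Laplace k x)" for x
    unfolding undershoot_Laplace_def V_def E_def by (subst nn_integral_cmult) (auto simp: mult.assoc)
  moreover have "q powr \<beta> / (q * (k + q) powr \<beta>) = q powr (\<beta> - 1) * (k + q) powr (- \<beta>)"
    using kq by (simp add: powr_diff powr_minus field_simps)
  ultimately show ?thesis by simp
qed

text \<open>For fixed k both sides have the same Laplace transform in x, so they agree for almost
  every level. Every level is a limit from below of levels of agreement, and both sides converge
  along such a sequence.\<close>

lemma undershoot_Laplace_eq:
  assumes k: "0 < k" and x: "0 < x"
  shows "undershoot_Laplace k x = arcsine_Laplace \<beta> k x"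
proof -
  define f where "f x = indicator {0<..} x * undershoot_Laplace k x" for x :: real
  define g where "g x = indicator {0<..} x * arcsine_Laplace \<beta> k x" for x :: real
  have [measurable]: "f \<in> borel_measurable borel" "g \<in> borel_measurable borel"
    unfolding f_def g_def by measurable
  have lap: "(\<integral>\<^sup>+x. ennreal (exp (- q * x)) \<partial>density lborel f) = ennreal (q powr (\<beta> - 1) * (k + q) powr (- \<beta>))"
    "(\<integral>\<^sup>+x. ennreal (exp (- q * x)) \<partial>density lborel g) = ennreal (q powr (\<beta> - 1) * (k + q) powr (- \<beta>))"
    if "q > 0" for q
    using nn_integral_undershoot_Laplace[OF k that] nn_integral_arcsine_Laplace[OF \<beta> k that]
    by (simp_all add: nn_integral_density f_def g_def mult.commute mult.left_commute)
  have "density lborel f = density lborel g"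
  proof (rule measure_eqI_Laplace)
    show "emeasure (density lborel f) {..<0} = 0" "emeasure (density lborel g) {..<0} = 0"
      by (rule density_lborel_lessThan_0; simp add: f_def g_def indicator_def)+
    show "(\<integral>\<^sup>+x. ennreal (exp (- x)) \<partial>density lborel f) < \<infinity>" using lap(1)[of 1] by simp
  qed (auto simp only: lap sets_density sets_lborel)
  then have ae: "AE x in lborel. f x = g x"
    by (intro sigma_finite_measure.density_unique[OF lborel.sigma_finite_measure_axioms]) auto
  have "\<exists>u. x - x / real (n + 2) < u \<and> u < x \<and> f u = g u" for n
  proof -
    \<comment> \<open>The left endpoint is at least x / 2, so the chosen points stay positive and
      converge to x from below.\<close>
    have "x - x / real (n + 2) < x" using x by simp
    then obtain u where "x - x / real (n + 2) < u" "u < x" "f u = g u"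
      by (rule AE_lborel_interval_obtains[OF ae])
    then show ?thesis by blast
  qed
  then obtain u where u: "\<And>n. x - x / real (n + 2) < u n \<and> u n < x \<and> f (u n) = g (u n)" by metis
  have upos: "0 < u n" for n
  proof -
    have "x / real (n + 2) \<le> x" using x by (simp add: field_simps)
    then show ?thesis using u[of n] by linarith
  qed
  have ulim: "u \<longlonglongrightarrow> x"
  proof (rule tendsto_sandwich[of "\<lambda>n. x - x / real (n + 2)" _ _ "\<lambda>_. x"])
    show "(\<lambda>n. x - x / real (n + 2)) \<longlonglongrightarrow> x" by real_asymp
  qed (use u in \<open>auto intro!: always_eventually less_imp_le\<close>)
  have "(\<lambda>n. undershoot_Laplace k (u n)) \<longlonglongrightarrow> undershoot_Laplace k x"
    unfolding undershoot_Laplace_def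
  proof (rule nn_integral_dominated_convergence[where w="\<lambda>_. 1"])
    show "AE \<omega> in M. ennreal (exp (- k * pre_passage (path \<omega>) (u n))) \<le> 1" for n
      using k by (intro AE_I2) simp
    show "AE \<omega> in M. (\<lambda>n. ennreal (exp (- k * pre_passage (path \<omega>) (u n)))) \<longlonglongrightarrow> ennreal (exp (- k * pre_passage (path \<omega>) x))"
      using AE_good_path
      by eventually_elim (intro tendsto_intros pre_passage_left_continuous, use x u upos ulim in auto)
  qed (auto simp: emeasure_space_1)
  moreover have "(\<lambda>n. arcsine_Laplace \<beta> k (u n)) \<longlonglongrightarrow> arcsine_Laplace \<beta> k x"
    by (rule arcsine_Laplace_continuous[OF \<beta> k x upos ulim])
  moreover have "undershoot_Laplace k (u n) = arcsine_Laplace \<beta> k (u n)" for n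
    using u[of n] upos[of n] by (simp add: f_def g_def)
  ultimately show ?thesis using LIMSEQ_unique by simp
qed

text \<open>The second use of uniqueness, now in the variable k with the level x fixed.\<close>

lemma distr_pre_passage:
  assumes x: "0 < x"
  shows "distr M borel (\<lambda>\<omega>. pre_passage (path \<omega>) x) =
         density lborel (\<lambda>y. ennreal (arcsine_density \<beta> x y) * indicator {0<..<x} y)"
proof (rule measure_eqI_Laplace)
  have m [measurable]: "(\<lambda>y. ennreal (arcsine_density \<beta> x y) * indicator {0<..<x} y) \<in> borel_measurable borel"
    unfolding arcsine_density_def by measurable
  show "emeasure (density lborel (\<lambda>y. ennreal (arcsine_density \<beta> x y) * indicator {0<..<x} y)) {..<0} = 0"
    by (rule density_lborel_lessThan_0[OF m]) simp
  show "emeasure (distr M borel (\<lambda>\<omega>. pre_passage (path \<omega>) x)) {..<0} = 0"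
    by (subst emeasure_distr) (simp_all add: vimage_def not_le[symmetric])
  have eq: "(\<integral>\<^sup>+y. ennreal (exp (- k * y)) \<partial>distr M borel (\<lambda>\<omega>. pre_passage (path \<omega>) x)) = undershoot_Laplace k x" for k
    unfolding undershoot_Laplace_def by (subst nn_integral_distr) auto
  show "(\<integral>\<^sup>+y. ennreal (exp (- k * y)) \<partial>distr M borel (\<lambda>\<omega>. pre_passage (path \<omega>) x)) =
      (\<integral>\<^sup>+y. ennreal (exp (- k * y)) \<partial>density lborel (\<lambda>y. ennreal (arcsine_density \<beta> x y) * indicator {0<..<x} y))"
    if "k > 0" for k
    unfolding eq undershoot_Laplace_eq[OF that x] arcsine_Laplace_def
    by (subst nn_integral_density) (auto simp: mult_ac)
  have "undershoot_Laplace 1 x \<le> (\<integral>\<^sup>+\<omega>. 1 \<partial>M)"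
    unfolding undershoot_Laplace_def by (intro nn_integral_mono) simp
  also have "\<dots> < \<infinity>" by (simp add: emeasure_space_1)
  finally show "(\<integral>\<^sup>+y. ennreal (exp (- y)) \<partial>distr M borel (\<lambda>\<omega>. pre_passage (path \<omega>) x)) < \<infinity>"
    using eq[of 1] by simp
qed auto

text \<open>The reflection of y to x - y turns the arcsine density of the height before passage into
  the kernel of \<open>K_nn\<close>.\<close>

lemma nn_integral_undershoot:
  assumes [measurable]: "h \<in> borel_measurable borel" and x: "0 < x"
  shows "(\<integral>\<^sup>+\<omega>. h (x - pre_passage (path \<omega>) x) \<partial>M) = K_nn \<beta> h x"
proof -
  have [measurable]: "(\<lambda>y. ennreal (arcsine_density \<beta> x y) * indicator {0<..<x} y) \<in> borel_measurable borel"
    unfolding arcsine_density_def by measurable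
  have "(\<integral>\<^sup>+\<omega>. h (x - pre_passage (path \<omega>) x) \<partial>M) = (\<integral>\<^sup>+y. h (x - y) \<partial>distr M borel (\<lambda>\<omega>. pre_passage (path \<omega>) x))"
    by (subst nn_integral_distr) auto
  also have "\<dots> = (\<integral>\<^sup>+y. ennreal (arcsine_density \<beta> x y) * indicator {0<..<x} y * h (x - y) \<partial>lborel)"
    unfolding distr_pre_passage[OF x] by (subst nn_integral_density) auto
  also have "\<dots> = (\<integral>\<^sup>+r. ennreal (arcsine_density \<beta> x (x - r)) * indicator {0<..<x} (x - r) * h (x - (x - r)) \<partial>lborel)"
    by (subst nn_integral_real_affine[where c="-1" and t=x]) (auto simp: algebra_simps)
  also have "\<dots> = K_nn \<beta> h x"
    unfolding K_nn_def arcsine_density_def by (intro nn_integral_cong) (auto simp: indicator_def)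
  finally show ?thesis .
qed

text \<open>This measure has infinite mass, which is the reason why
  \<open>measure_eqI_Laplace\<close> asks for finiteness of the transform at 1 only.
  \<open>right_reg\<close> replaces \<open>Y\<close> because joint measurability in time and
  \<open>\<omega>\<close> is needed.\<close>

lemma occupation_measure:
  "distr (density (lborel \<Otimes>\<^sub>M M) (\<lambda>p. indicator {0..} (fst p))) borel (\<lambda>p. right_reg (path (snd p)) (fst p)) =
   density lborel (\<lambda>y. ennreal (y powr (\<beta> - 1) / Gamma \<beta>) * indicator {0<..} y)" (is "?U = ?D")
proof (rule measure_eqI_Laplace)
  show "emeasure ?U {..<0} = 0"
    by (subst emeasure_distr) (simp_all add: vimage_def not_le[symmetric])
  show "emeasure ?D {..<0} = 0"
    by (rule density_lborel_lessThan_0) auto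
  have G: "Gamma \<beta> > 0" using \<beta> by (auto intro!: Gamma_real_pos)
  have D: "(\<integral>\<^sup>+y. ennreal (exp (- k * y)) \<partial>?D) = ennreal (k powr (- \<beta>))" if k: "k > 0" for k
  proof -
    have "(\<integral>\<^sup>+y. ennreal (exp (- k * y)) \<partial>?D) =
      (\<integral>\<^sup>+y. ennreal (1 / Gamma \<beta>) * (ennreal (exp (- k * y) * y powr (\<beta> - 1)) * indicator {0<..} y) \<partial>lborel)"
      using G by (subst nn_integral_density) (auto intro!: nn_integral_cong simp: indicator_def ennreal_mult'[symmetric] mult_ac)
    also have "\<dots> = ennreal (1 / Gamma \<beta>) * ennreal (Gamma \<beta> * k powr (- \<beta>))"
      using \<beta> k by (subst nn_integral_cmult, measurable, subst nn_integral_Gamma_scaled) auto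
    finally show ?thesis using G by (simp add: ennreal_mult'[symmetric])
  qed
  have U: "(\<integral>\<^sup>+y. ennreal (exp (- k * y)) \<partial>?U) = ennreal (k powr (- \<beta>))" if k: "k > 0" for k
  proof -
    have "(\<integral>\<^sup>+y. ennreal (exp (- k * y)) \<partial>?U) =
        (\<integral>\<^sup>+p. indicator {0..} (fst p) * ennreal (exp (- k * right_reg (path (snd p)) (fst p))) \<partial>(lborel \<Otimes>\<^sub>M M))"
      by (subst nn_integral_distr, measurable, subst nn_integral_density) auto
    also have "\<dots> = (\<integral>\<^sup>+s. \<integral>\<^sup>+\<omega>. indicator {0..} s * ennreal (exp (- k * right_reg (path \<omega>) s)) \<partial>M \<partial>lborel)"
      by (subst nn_integral_fst[symmetric]) auto
    also have "\<dots> = (\<integral>\<^sup>+s. ennreal (exp (- (k powr \<beta>) * s) * s powr (1 - 1)) * indicator {0<..} s \<partial>lborel)"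
    proof (rule nn_integral_cong_AE, rule AE_mp[OF AE_lborel_singleton[of 0]], rule AE_I2, rule impI)
      fix s :: real assume "s \<noteq> 0"
      show "(\<integral>\<^sup>+\<omega>. indicator {0..} s * ennreal (exp (- k * right_reg (path \<omega>) s)) \<partial>M) =
        ennreal (exp (- (k powr \<beta>) * s) * s powr (1 - 1)) * indicator {0<..} s"
      proof (cases "s > 0")
        case True
        have "(\<integral>\<^sup>+\<omega>. ennreal (exp (- k * right_reg (path \<omega>) s)) \<partial>M) = (\<integral>\<^sup>+\<omega>. ennreal (exp (- k * Y s \<omega>)) \<partial>M)"
          by (rule nn_integral_cong_AE, use AE_good_path in eventually_elim)
             (use True in \<open>simp add: right_reg_good\<close>)
        then show ?thesis using Laplace_Y[of k s] k True by (simp add: mult.commute)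
      qed (use \<open>s \<noteq> 0\<close> in auto)
    qed
    also have "\<dots> = ennreal (k powr (- \<beta>))"
      using k by (subst nn_integral_Gamma_scaled) (auto simp: powr_minus)
    finally show ?thesis .
  qed
  show "(\<integral>\<^sup>+y. ennreal (exp (- k * y)) \<partial>?U) = (\<integral>\<^sup>+y. ennreal (exp (- k * y)) \<partial>?D)" if "k > 0" for k
    unfolding D[OF that] U[OF that] ..
  show "(\<integral>\<^sup>+y. ennreal (exp (- y)) \<partial>?U) < \<infinity>"
    using U[of 1] by simp
qed auto

text \<open>On a monotone path the times before the passage over z are those with value below z. The
  time integral is therefore the integral of a function of the height against the potential measure,
  and reflecting the height at z gives \<open>J_nn\<close>.\<close>

lemma nn_integral_occupation:
  assumes [measurable]: "h \<in> borel_measurable borel"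
  shows "(\<integral>\<^sup>+\<omega>. \<integral>\<^sup>+s. indicator {0..} s * (if right_reg (path \<omega>) s < z then h (z - right_reg (path \<omega>) s) else 0) \<partial>lborel \<partial>M) =
         J_nn \<beta> h z"
proof -
  interpret lM: pair_sigma_finite "lborel :: real measure" M ..
  define f where "f y = (if y < z then h (z - y) else 0)" for y
  have [measurable]: "f \<in> borel_measurable borel" unfolding f_def by measurable
  have "(\<integral>\<^sup>+\<omega>. \<integral>\<^sup>+s. indicator {0..} s * f (right_reg (path \<omega>) s) \<partial>lborel \<partial>M) =
      (\<integral>\<^sup>+p. indicator {0..} (fst p) * f (right_reg (path (snd p)) (fst p)) \<partial>(lborel \<Otimes>\<^sub>M M))"
    by (subst lM.nn_integral_snd[symmetric]) auto
  also have "\<dots> = (\<integral>\<^sup>+y. f y \<partial>distr (density (lborel \<Otimes>\<^sub>M M) (\<lambda>p. indicator {0..} (fst p))) borel (\<lambda>p. right_reg (path (snd p)) (fst p)))"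
    by (subst nn_integral_distr, measurable, subst nn_integral_density) auto
  also have "\<dots> = (\<integral>\<^sup>+y. ennreal (y powr (\<beta> - 1) / Gamma \<beta>) * indicator {0<..} y * f y \<partial>lborel)"
    unfolding occupation_measure by (subst nn_integral_density) auto
  also have "\<dots> = (\<integral>\<^sup>+r. ennreal ((z - r) powr (\<beta> - 1) / Gamma \<beta>) * indicator {0<..} (z - r) * f (z - r) \<partial>lborel)"
    by (subst nn_integral_real_affine[where c="-1" and t=z]) (auto simp: algebra_simps)
  also have "\<dots> = J_nn \<beta> h z"
    unfolding J_nn_def by (intro nn_integral_cong) (auto simp: indicator_def f_def)
  finally show ?thesis unfolding f_def .
qed

end

subsection \<open>Paths of the censored process\<close>

text \<open>The position from which the path with index j + 1 starts: x for j = 0, and otherwise the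
  left limit of the j-th path at the j-th passage.\<close>

fun restart_pos :: "real \<Rightarrow> (nat \<Rightarrow> real \<Rightarrow> real) \<Rightarrow> nat \<Rightarrow> real" where
  "restart_pos x y 0 = x"
| "restart_pos x y (Suc j) = restart_pos x y j - pre_passage (y (Suc j)) (restart_pos x y j)"

fun restart_time :: "real \<Rightarrow> (nat \<Rightarrow> real \<Rightarrow> real) \<Rightarrow> nat \<Rightarrow> real" where
  "restart_time x y 0 = 0"
| "restart_time x y (Suc j) = restart_time x y j + passage_time (y (Suc j)) (restart_pos x y j)"

text \<open>On good paths the condition \<open>right_reg w s < z\<close> says that s is before the
  passage over z. Comparing heights instead of times keeps the functional measurable in both the
  path and z.\<close>

definition excursion_occupation :: "(real \<Rightarrow> ennreal) \<Rightarrow> (real \<Rightarrow> real) \<Rightarrow> real \<Rightarrow> ennreal" where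
  "excursion_occupation h w z =
     (\<integral>\<^sup>+s. indicator {0..} s * (if right_reg w s < z then h (z - right_reg w s) else 0) \<partial>lborel)"

lemma right_reg_time_measurable [measurable]: "right_reg w \<in> borel_measurable borel"
proof -
  have [measurable]: "(\<lambda>_. restrict w {0..}) \<in> (borel :: real measure) \<rightarrow>\<^sub>M path_space"
    by (rule measurable_const) (auto simp: space_PiM)
  have "(\<lambda>s. right_reg (restrict w {0..}) s) \<in> borel_measurable borel" by measurable
  then show ?thesis by simp
qed

text \<open>The deterministic setting of a single \<open>\<omega>\<close>. Positive restart
  positions exclude that a path approaches its level continuously; \<open>AE_pos\<close> shows that
  this holds almost surely.\<close>

locale restarted_paths =
  fixes x :: real and y :: "nat \<Rightarrow> real \<Rightarrow> real"
  assumes good: "\<And>j. good_path (y (Suc j))" and pos: "\<And>j. 0 < restart_pos x y j"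
begin

abbreviation (input) "X \<equiv> restart_pos x y"
abbreviation (input) "\<tau> \<equiv> restart_time x y"
abbreviation (input) "S \<equiv> (\<lambda>j t. - y j t)"

text \<open>The two recursions have to be solved together, since each path is built from the
  preceding time and the next time is read off that path.\<close>

lemma cens_time_path:
  "cens_time x S j = ereal (\<tau> j) \<and> cens_path x S (Suc j) = (\<lambda>t. X j - y (Suc j) (t - \<tau> j))"
proof (induction j)
  case 0
  then show ?case by (simp add: zero_ereal_def)
next
  case (Suc j)
  define \<sigma> where "\<sigma> = passage_time (y (Suc j)) (X j)"
  have \<sigma>: "0 < \<sigma>" using passage_time_pos[OF good pos] by (simp add: \<sigma>_def)
  \<comment> \<open>The times eligible for the infimum form a closed half-line, whose left end is
    the next restart time.\<close>
  have iff: "ereal (\<tau> j) < ereal s \<and> X j - y (Suc j) (s - \<tau> j) \<le> 0 \<longleftrightarrow> \<tau> j + \<sigma> \<le> s" for s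
    using passage_time_iff[OF good pos, of "s - \<tau> j" j j] \<sigma> unfolding \<sigma>_def[symmetric]
    by (cases "\<tau> j < s") auto
  have time: "cens_time x S (Suc j) = ereal (\<tau> (Suc j))"
  proof -
    have "cens_time x S (Suc j) = Inf {ereal s | s. \<tau> j + \<sigma> \<le> s}"
      using Suc iff by simp
    also have "\<dots> = ereal (\<tau> j + \<sigma>)"
      by (rule Inf_eqI) auto
    finally show ?thesis by (simp add: \<sigma>_def)
  qed
  have "filterlim (\<lambda>t. t - \<tau> j) (at_left \<sigma>) (at_left (\<tau> (Suc j)))"
    using filtermap_at_left_shift[of "\<tau> j" "\<tau> (Suc j)"] by (simp add: filterlim_def \<sigma>_def)
  then have "((\<lambda>t. X j - y (Suc j) (t - \<tau> j)) \<longlongrightarrow> X (Suc j)) (at_left (\<tau> (Suc j)))"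
    using tendsto_pre_passage[OF good pos, of j j] unfolding \<sigma>_def[symmetric]
    by (auto intro!: tendsto_intros elim: filterlim_compose[rotated])
  then have "Lim (at_left (\<tau> (Suc j))) (\<lambda>t. X j - y (Suc j) (t - \<tau> j)) = X (Suc j)"
    by (intro tendsto_Lim) (auto simp: trivial_limit_at_left_real)
  then show ?case using Suc time by simp
qed

lemma restart_time_less: "\<tau> j < \<tau> (Suc j)"
  using passage_time_pos[OF good pos] by simp

lemma restart_time_strict_mono: "strict_mono \<tau>"
  by (rule strict_mono_Suc_iff[THEN iffD2]) (use restart_time_less in blast)

lemma cens_lifetime_eq: "cens_lifetime x S = (SUP j. ereal (\<tau> j))"
proof -
  have "incseq (\<lambda>j. ereal (\<tau> j))"
    using strict_mono_less_eq[OF restart_time_strict_mono] by (auto simp: incseq_def)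
  then have "(\<lambda>j. ereal (\<tau> j)) \<longlonglongrightarrow> (SUP j. ereal (\<tau> j))" by (rule LIMSEQ_SUP)
  moreover have "cens_time x S = (\<lambda>j. ereal (\<tau> j))" using cens_time_path by blast
  ultimately show ?thesis unfolding cens_lifetime_def by (simp add: limI)
qed

lemma alive_times_eq: "alive_times x S = (\<Union>j. {\<tau> j..<\<tau> (Suc j)})"
proof (intro equalityI subsetI)
  fix s assume "s \<in> alive_times x S"
  then have s: "0 \<le> s" "\<exists>j. s < \<tau> j"
    by (auto simp: alive_times_def cens_lifetime_eq less_SUP_iff)
  define n where "n = (LEAST j. s < \<tau> j)"
  have n: "s < \<tau> n" unfolding n_def using s(2) by (rule LeastI_ex)
  then obtain m where m: "n = Suc m" using s(1) by (cases n) auto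
  have "\<not> s < \<tau> m" unfolding m[symmetric] using not_less_Least[of m "\<lambda>j. s < \<tau> j"] m n_def by simp
  then have "s \<in> {\<tau> m..<\<tau> (Suc m)}" using n m by (simp del: restart_time.simps)
  then show "s \<in> (\<Union>j. {\<tau> j..<\<tau> (Suc j)})" by blast
next
  fix s assume "s \<in> (\<Union>j. {\<tau> j..<\<tau> (Suc j)})"
  then obtain j where j: "\<tau> j \<le> s" "s < \<tau> (Suc j)" by auto
  have "0 \<le> \<tau> j" using strict_mono_less_eq[OF restart_time_strict_mono, of 0 j] by simp
  then show "s \<in> alive_times x S"
    using j by (auto simp: alive_times_def cens_lifetime_eq less_SUP_iff simp del: restart_time.simps)
qed

lemma restart_interval_unique:
  "s \<in> {\<tau> i..<\<tau> (Suc i)} \<Longrightarrow> s \<in> {\<tau> j..<\<tau> (Suc j)} \<Longrightarrow> i = j"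
  using strict_mono_less[OF restart_time_strict_mono, of i "Suc j"]
    strict_mono_less[OF restart_time_strict_mono, of j "Suc i"]
  by (simp del: restart_time.simps)

lemma cens_proc_eq:
  assumes s: "s \<in> {\<tau> j..<\<tau> (Suc j)}"
  shows "cens_proc x S s = Some (X j - y (Suc j) (s - \<tau> j))"
proof -
  have al: "ereal s < cens_lifetime x S"
    using s alive_times_eq by (auto simp: alive_times_def simp del: restart_time.simps)
  have "(THE j. 1 \<le> j \<and> cens_time x S (j - 1) \<le> ereal s \<and> ereal s < cens_time x S j) = Suc j"
  proof (rule the_equality)
    show "1 \<le> Suc j \<and> cens_time x S (Suc j - 1) \<le> ereal s \<and> ereal s < cens_time x S (Suc j)"
      using s cens_time_path[of j] cens_time_path[of "Suc j"] by (simp del: restart_time.simps cens_time.simps)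
    fix i assume i: "1 \<le> i \<and> cens_time x S (i - 1) \<le> ereal s \<and> ereal s < cens_time x S i"
    then obtain m where m: "i = Suc m" by (cases i) auto
    have "s \<in> {\<tau> m..<\<tau> (Suc m)}"
      using i m cens_time_path[of m] cens_time_path[of "Suc m"] by (simp del: restart_time.simps cens_time.simps)
    then show "i = Suc j" using restart_interval_unique[OF _ s] m by blast
  qed
  then show ?thesis using al cens_time_path[of j] by (simp add: cens_proc_def)
qed

lemma restart_pos_le: "X j \<le> x"
proof (induction j)
  case (Suc j)
  have "X (Suc j) \<le> X j" by simp
  then show ?case using Suc by (rule order.trans)
qed simp

text \<open>Replaces the passage time by a comparison of heights, which is the form used in
  \<open>excursion_occupation\<close>.\<close>

lemma interval_iff:
  "s \<in> {\<tau> j..<\<tau> (Suc j)} \<longleftrightarrow> 0 \<le> s - \<tau> j \<and> right_reg (y (Suc j)) (s - \<tau> j) < X j"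
  using passage_time_iff[OF good pos, of "s - \<tau> j" j j] right_reg_good[OF good, of "s - \<tau> j" j]
  by (cases "0 \<le> s - \<tau> j") auto

lemma cens_proc_range:
  assumes "s \<in> alive_times x S"
  shows "0 < the (cens_proc x S s)" "the (cens_proc x S s) \<le> x"
proof -
  obtain j where j: "s \<in> {\<tau> j..<\<tau> (Suc j)}" using assms alive_times_eq by auto
  have "0 \<le> y (Suc j) (s - \<tau> j)" "y (Suc j) (s - \<tau> j) < X j"
    using j good_pathD(5)[OF good] passage_time_iff[OF good pos, of "s - \<tau> j" j j] by auto
  then show "0 < the (cens_proc x S s)" "the (cens_proc x S s) \<le> x"
    using restart_pos_le[of j] cens_proc_eq[OF j] by auto
qed

text \<open>The life intervals are disjoint, so at most one summand is nonzero. In this form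
  measurability in s is evident, although \<open>cens_proc\<close> is defined by a description
  operator.\<close>

lemma alive_integrand:
  "indicator (alive_times x S) s * h (the (cens_proc x S s)) =
   (\<Sum>j. indicator {0..} (s - \<tau> j) * (if right_reg (y (Suc j)) (s - \<tau> j) < X j
      then h (X j - right_reg (y (Suc j)) (s - \<tau> j)) else (0::ennreal)))" (is "_ = (\<Sum>j. ?f j)")
proof (cases "s \<in> alive_times x S")
  case True
  then obtain i where i: "s \<in> {\<tau> i..<\<tau> (Suc i)}" using alive_times_eq by auto
  have "?f j = (if j = i then h (the (cens_proc x S s)) else 0)" for j
  proof (cases "j = i")
    case True
    then show ?thesis
      using i interval_iff[of s i] cens_proc_eq[OF i] right_reg_good[OF good, of "s - \<tau> i" i]
      by (simp del: restart_time.simps atLeastLessThan_iff)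
  next
    case False
    then have "\<not> (0 \<le> s - \<tau> j \<and> right_reg (y (Suc j)) (s - \<tau> j) < X j)"
      using restart_interval_unique[OF _ i, of j] interval_iff[of s j] by blast
    then show ?thesis using False by (auto simp: indicator_def)
  qed
  then show ?thesis using True sums_unique[OF sums_single[of i "\<lambda>_. h (the (cens_proc x S s))"]] by simp
next
  case False
  then have "s \<notin> {\<tau> j..<\<tau> (Suc j)}" for j unfolding alive_times_eq by blast
  then have "?f j = 0" for j using interval_iff[of s j] by (auto simp: indicator_def simp del: restart_time.simps)
  then have "(\<Sum>j. ?f j) = (\<Sum>j. 0)" by (rule suminf_cong)
  moreover have "indicator (alive_times x S) s = (0::ennreal)" using False by simp
  ultimately show ?thesis by (simp only: mult_zero_left suminf_zero)
qed

lemma alive_integrand_measurable: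
  fixes h :: "real \<Rightarrow> ennreal"
  assumes [measurable]: "h \<in> borel_measurable borel"
  shows "(\<lambda>s. indicator (alive_times x S) s * h (the (cens_proc x S s))) \<in> borel_measurable borel"
  unfolding alive_integrand by measurable

text \<open>Translating each piece by its restart time removes these times from the formula; only
  the restart positions remain.\<close>

lemma nn_integral_alive:
  assumes [measurable]: "h \<in> borel_measurable borel"
  shows "(\<integral>\<^sup>+s. indicator (alive_times x S) s * h (the (cens_proc x S s)) \<partial>lborel) =
         (\<Sum>j. excursion_occupation h (y (Suc j)) (X j))"
proof -
  let ?f = "\<lambda>j s. indicator {0..} s * (if right_reg (y (Suc j)) s < X j
      then h (X j - right_reg (y (Suc j)) s) else 0)"
  have "(\<integral>\<^sup>+s. ?f j (s - \<tau> j) \<partial>lborel) = (\<integral>\<^sup>+s. ?f j s \<partial>lborel)" for j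
    by (subst nn_integral_real_affine[where c=1 and t="\<tau> j"], measurable, simp, simp cong: if_cong)
  moreover have "(\<integral>\<^sup>+s. indicator (alive_times x S) s * h (the (cens_proc x S s)) \<partial>lborel) =
    (\<Sum>j. \<integral>\<^sup>+s. ?f j (s - \<tau> j) \<partial>lborel)"
    unfolding alive_integrand by (rule nn_integral_suminf) measurable
  ultimately show ?thesis unfolding excursion_occupation_def by (simp only:)
qed

text \<open>The process lives in (0,x] while alive, so only the values of \<open>f\<close> there
  matter. As \<open>ennreal\<close> sends negative numbers to 0, the two sums are the occupations of
  the positive and the negative part.\<close>

lemma occupation_integral_eq:
  assumes [measurable]: "g \<in> borel_measurable borel" and f: "\<And>r. 0 < r \<Longrightarrow> r \<le> x \<Longrightarrow> f r = g r"
    and fin: "(\<Sum>j. excursion_occupation (\<lambda>r. ennreal (g r)) (y (Suc j)) (X j)) < \<infinity>"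
      "(\<Sum>j. excursion_occupation (\<lambda>r. ennreal (- g r)) (y (Suc j)) (X j)) < \<infinity>"
  shows "set_integrable lborel (alive_times x S) (\<lambda>s. f (the (cens_proc x S s)))"
    and "occupation_integral f x S =
       enn2real (\<Sum>j. excursion_occupation (\<lambda>r. ennreal (g r)) (y (Suc j)) (X j)) -
       enn2real (\<Sum>j. excursion_occupation (\<lambda>r. ennreal (- g r)) (y (Suc j)) (X j))"
proof -
  define F where "F s = indicator (alive_times x S) s *\<^sub>R f (the (cens_proc x S s))" for s
  have pF: "ennreal (F s) = indicator (alive_times x S) s * ennreal (g (the (cens_proc x S s)))" for s
    using f[OF cens_proc_range[of s]] by (auto simp: F_def indicator_def)
  have nF: "ennreal (- F s) = indicator (alive_times x S) s * ennreal (- g (the (cens_proc x S s)))" for s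
    using f[OF cens_proc_range[of s]] by (auto simp: F_def indicator_def)
  have m1: "(\<lambda>s. ennreal (F s)) \<in> borel_measurable borel"
    unfolding pF by (rule alive_integrand_measurable) measurable
  have m2: "(\<lambda>s. ennreal (- F s)) \<in> borel_measurable borel"
    unfolding nF by (rule alive_integrand_measurable) measurable
  \<comment> \<open>\<open>f\<close> itself need not be measurable, so the integrand is reassembled
    from its two measurable parts.\<close>
  have F_eq: "F = (\<lambda>s. enn2real (ennreal (F s)) - enn2real (ennreal (- F s)))"
  proof
    show "F s = enn2real (ennreal (F s)) - enn2real (ennreal (- F s))" for s
      by (cases "0 \<le> F s") (auto simp: ennreal_neg)
  qed
  have Fm: "F \<in> borel_measurable borel"
    by (subst F_eq) (intro borel_measurable_diff borel_measurable_enn2real m1 m2)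
  have iP: "(\<integral>\<^sup>+s. ennreal (F s) \<partial>lborel) = (\<Sum>j. excursion_occupation (\<lambda>r. ennreal (g r)) (y (Suc j)) (X j))"
    unfolding pF by (rule nn_integral_alive) measurable
  have iN: "(\<integral>\<^sup>+s. ennreal (- F s) \<partial>lborel) = (\<Sum>j. excursion_occupation (\<lambda>r. ennreal (- g r)) (y (Suc j)) (X j))"
    unfolding nF by (rule nn_integral_alive) measurable
  have int: "integrable lborel F"
    unfolding real_integrable_def using Fm iP iN fin by auto
  then show "set_integrable lborel (alive_times x S) (\<lambda>s. f (the (cens_proc x S s)))"
    unfolding set_integrable_def F_def[abs_def] .
  have "occupation_integral f x S = integral\<^sup>L lborel F"
    by (simp add: occupation_integral_def set_lebesgue_integral_def F_def[abs_def])
  also have "\<dots> = enn2real (\<integral>\<^sup>+s. ennreal (F s) \<partial>lborel) - enn2real (\<integral>\<^sup>+s. ennreal (- F s) \<partial>lborel)"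
    by (rule real_lebesgue_integral_def[OF int])
  finally show "occupation_integral f x S =
       enn2real (\<Sum>j. excursion_occupation (\<lambda>r. ennreal (g r)) (y (Suc j)) (X j)) -
       enn2real (\<Sum>j. excursion_occupation (\<lambda>r. ennreal (- g r)) (y (Suc j)) (X j))"
    unfolding iP iN .
qed

end

subsection \<open>The occupation formula\<close>

text \<open>On exceptional paths the occupation integral is out of control. Agreement with a
  measurable function off a null set still makes it a random variable for the completion.\<close>

lemma measurable_completion_AE:
  assumes D: "D \<in> borel_measurable M" and ae: "AE \<omega> in M. f \<omega> = D \<omega>"
  shows "f \<in> borel_measurable (completion M)"
proof (rule measurableI)
  fix B :: "'b set" assume B: "B \<in> sets borel"
  show "f -` B \<inter> space (completion M) \<in> sets (completion M)"
  proof (rule completion.in_sets_AE)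
    show "D -` B \<inter> space M \<in> sets (completion M)"
      using measurable_sets[OF D B] by (rule sets_completionI_sets)
    show "AE \<omega> in completion M. \<omega> \<in> D -` B \<inter> space M \<longleftrightarrow> \<omega> \<in> f -` B \<inter> space (completion M)"
      using AE_completion[OF ae] by eventually_elim auto
  qed auto
qed simp

lemma restart_pos_cong:
  "(\<And>i. 1 \<le> i \<Longrightarrow> i \<le> j \<Longrightarrow> pre_passage (y i) = pre_passage (y' i)) \<Longrightarrow> restart_pos x y j = restart_pos x y' j"
  by (induction j) simp_all

lemma restart_pos_measurable:
  "{1..j} \<subseteq> A \<Longrightarrow> (\<lambda>w. restart_pos x w j) \<in> borel_measurable (\<Pi>\<^sub>M i\<in>A. path_space)"
proof (induction j)
  case (Suc j)
  then have "{1..j} \<subseteq> A" "Suc j \<in> A" by auto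
  then have [measurable]: "(\<lambda>w. restart_pos x w j) \<in> borel_measurable (\<Pi>\<^sub>M i\<in>A. path_space)"
    "(\<lambda>w. w (Suc j)) \<in> (\<Pi>\<^sub>M i\<in>A. path_space) \<rightarrow>\<^sub>M path_space"
    using Suc.IH by (auto intro: measurable_component_singleton)
  show ?case by simp
qed simp

lemma excursion_occupation_measurable [measurable]:
  assumes [measurable]: "f \<in> N \<rightarrow>\<^sub>M path_space" "z \<in> borel_measurable N" "h \<in> borel_measurable borel"
  shows "(\<lambda>u. excursion_occupation h (f u) (z u)) \<in> borel_measurable N"
  unfolding excursion_occupation_def by measurable

lemma excursion_occupation_restrict [simp]:
  "excursion_occupation h (restrict w {0..}) = excursion_occupation h w"
  by (simp add: excursion_occupation_def[abs_def] cong: if_cong)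

section \<open>The random chain of restart positions\<close>

locale censored_process =
  fixes P :: "'w measure" and \<beta> :: real and S :: "nat \<Rightarrow> real \<Rightarrow> 'w \<Rightarrow> real" and x :: real
  assumes iid: "iid_stable_subordinators P \<beta> (\<lambda>j t \<omega>. - S j t \<omega>)"
    and \<beta>: "0 < \<beta>" "\<beta> < 1" and x: "0 < x"
begin

lemma subordinator_S: "1 \<le> j \<Longrightarrow> subordinator P \<beta> (\<lambda>t \<omega>. - S j t \<omega>)"
  using iid \<beta> by unfold_locales (simp_all add: iid_stable_subordinators_def)

sublocale prob_space P
  using subordinator_S[of 1] by (simp add: subordinator_def stable_subordinator_def levy_process_def)

definition W :: "nat \<Rightarrow> 'w \<Rightarrow> real \<Rightarrow> real" where
  "W j \<omega> = (\<lambda>t\<in>{0..}. - S j t \<omega>)"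

definition pos :: "nat \<Rightarrow> 'w \<Rightarrow> real" where
  "pos j \<omega> = restart_pos x (\<lambda>i t. - S i t \<omega>) j"

lemma W_functionals:
  "pre_passage (W j \<omega>) = pre_passage (\<lambda>t. - S j t \<omega>)" "right_reg (W j \<omega>) = right_reg (\<lambda>t. - S j t \<omega>)"
  "excursion_occupation h (W j \<omega>) = excursion_occupation h (\<lambda>t. - S j t \<omega>)"
  unfolding W_def by simp_all

lemma indep_W: "indep_vars (\<lambda>_. path_space) W {1..}"
  using iid unfolding iid_stable_subordinators_def W_def[abs_def] by simp

lemma W_measurable: "1 \<le> j \<Longrightarrow> W j \<in> P \<rightarrow>\<^sub>M path_space"
  using indep_W by (auto simp: indep_vars_def)

definition past :: "nat \<Rightarrow> 'w \<Rightarrow> nat \<Rightarrow> real \<Rightarrow> real" where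
  "past j \<omega> = restrict (\<lambda>i. W i \<omega>) {1..j}"

lemma pos_past: "pos j \<omega> = restart_pos x (past j \<omega>) j"
  by (auto simp: pos_def past_def W_functionals intro!: restart_pos_cong)

lemma past_measurable [measurable]: "past j \<in> P \<rightarrow>\<^sub>M (\<Pi>\<^sub>M i\<in>{1..j}. path_space)"
  unfolding past_def[abs_def] by (rule measurable_restrict) (simp add: W_measurable)

lemma pos_measurable [measurable]: "pos j \<in> borel_measurable P"
  unfolding pos_past[abs_def] by (rule measurable_compose[OF past_measurable restart_pos_measurable]) simp

text \<open>The joint law of the first j paths and of the next one is a product, and
  \<open>pos j\<close> is a function of the former; hence the next path can be integrated out with
  the restart position frozen.\<close>

lemma nn_integral_pos_W:
  assumes [measurable]: "F \<in> borel_measurable (borel \<Otimes>\<^sub>M path_space)"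
  shows "(\<integral>\<^sup>+\<omega>. F (pos j \<omega>, W (Suc j) \<omega>) \<partial>P) = (\<integral>\<^sup>+\<omega>. \<integral>\<^sup>+\<omega>'. F (pos j \<omega>, W (Suc j) \<omega>') \<partial>P \<partial>P)"
proof -
  let ?A = "\<Pi>\<^sub>M i\<in>{1..j}. path_space" and ?B = "\<Pi>\<^sub>M i\<in>{Suc j}. path_space"
  \<comment> \<open>The next path is packed as a one-element family, so that independence of
    disjoint blocks of indices applies.\<close>
  define V where "V \<omega> = restrict (\<lambda>i. W i \<omega>) {Suc j}" for \<omega>
  have VW: "V \<omega> (Suc j) = W (Suc j) \<omega>" for \<omega> by (simp add: V_def)
  have ind: "indep_var ?A (past j) ?B V"
    unfolding past_def[abs_def] V_def[abs_def] by (rule indep_var_restrict[OF indep_W]) auto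
  have [measurable]: "V \<in> P \<rightarrow>\<^sub>M ?B" using indep_var_rv2[OF ind] .
  have [measurable]: "(\<lambda>w. restart_pos x w j) \<in> borel_measurable ?A" by (rule restart_pos_measurable) simp
  have [measurable]: "(\<lambda>w. w (Suc j)) \<in> ?B \<rightarrow>\<^sub>M path_space" by (rule measurable_component_singleton) simp
  interpret d: prob_space "distr P ?B V" by (rule prob_space_distr) measurable
  define H where "H w w' = F (restart_pos x w j, w' (Suc j))" for w w'
  have [measurable]: "(\<lambda>(w, w'). H w w') \<in> borel_measurable (?A \<Otimes>\<^sub>M ?B)" unfolding H_def by measurable
  have "(\<integral>\<^sup>+\<omega>. F (pos j \<omega>, W (Suc j) \<omega>) \<partial>P) = (\<integral>\<^sup>+p. (\<lambda>(w, w'). H w w') p \<partial>distr P (?A \<Otimes>\<^sub>M ?B) (\<lambda>\<omega>. (past j \<omega>, V \<omega>)))"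
    by (subst nn_integral_distr) (auto simp: H_def pos_past VW simp del: One_nat_def)
  also have "\<dots> = (\<integral>\<^sup>+p. (\<lambda>(w, w'). H w w') p \<partial>(distr P ?A (past j) \<Otimes>\<^sub>M distr P ?B V))"
    using ind unfolding indep_var_distribution_eq by simp
  also have "\<dots> = (\<integral>\<^sup>+w. \<integral>\<^sup>+w'. H w w' \<partial>distr P ?B V \<partial>distr P ?A (past j))"
    by (subst d.nn_integral_fst[symmetric]) (simp_all cong: measurable_cong_sets sets_pair_measure_cong del: One_nat_def)
  also have "\<dots> = (\<integral>\<^sup>+w. \<integral>\<^sup>+\<omega>'. H w (V \<omega>') \<partial>P \<partial>distr P ?A (past j))"
    by (intro nn_integral_cong nn_integral_distr) auto
  also have "\<dots> = (\<integral>\<^sup>+\<omega>. \<integral>\<^sup>+\<omega>'. H (past j \<omega>) (V \<omega>') \<partial>P \<partial>P)"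
    by (subst nn_integral_distr) (simp_all del: One_nat_def)
  finally show ?thesis by (simp add: H_def pos_past VW)
qed

lemma pos_Suc: "pos (Suc j) \<omega> = pos j \<omega> - pre_passage (W (Suc j) \<omega>) (pos j \<omega>)"
  by (simp add: pos_def W_functionals)

text \<open>With the current position frozen, a step of the chain is the undershoot of a single
  subordinator, whose law is known for every positive level.\<close>

lemma nn_integral_pos_Suc:
  assumes [measurable]: "h \<in> borel_measurable borel" and pos: "AE \<omega> in P. 0 < pos j \<omega>"
  shows "(\<integral>\<^sup>+\<omega>. h (pos (Suc j) \<omega>) \<partial>P) = (\<integral>\<^sup>+\<omega>. K_nn \<beta> h (pos j \<omega>) \<partial>P)"
proof -
  interpret Y: subordinator P \<beta> "\<lambda>t \<omega>. - S (Suc j) t \<omega>" by (rule subordinator_S) simp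
  have "(\<integral>\<^sup>+\<omega>. h (pos (Suc j) \<omega>) \<partial>P) =
      (\<integral>\<^sup>+\<omega>. (\<lambda>(z, w). h (z - pre_passage w z)) (pos j \<omega>, W (Suc j) \<omega>) \<partial>P)"
    by (simp add: pos_Suc)
  also have "\<dots> = (\<integral>\<^sup>+\<omega>. \<integral>\<^sup>+\<omega>'. (\<lambda>(z, w). h (z - pre_passage w z)) (pos j \<omega>, W (Suc j) \<omega>') \<partial>P \<partial>P)"
    by (rule nn_integral_pos_W) measurable
  also have "\<dots> = (\<integral>\<^sup>+\<omega>. K_nn \<beta> h (pos j \<omega>) \<partial>P)"
    by (rule nn_integral_cong_AE, use pos in eventually_elim)
       (simp add: W_functionals Y.nn_integral_undershoot)
  finally show ?thesis .
qed

text \<open>The kernel started at z charges (0,z) only, so it gives no mass to nonpositive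
  positions.\<close>

lemma AE_pos: "AE \<omega> in P. 0 < pos j \<omega>"
proof (induction j)
  case 0
  then show ?case using x by (simp add: pos_def)
next
  case (Suc j)
  have "K_nn \<beta> (indicator {..0}) z = K_nn \<beta> (\<lambda>_. 0) z" for z
    by (rule K_nn_cong) auto
  then have "K_nn \<beta> (indicator {..0}) z = 0" for z by (simp add: K_nn_def)
  then have "(\<integral>\<^sup>+\<omega>. indicator {..0} (pos (Suc j) \<omega>) \<partial>P) = 0"
    using nn_integral_pos_Suc[OF _ Suc, of "indicator {..0}"] by simp
  then have "AE \<omega> in P. indicator {..0} (pos (Suc j) \<omega>) = (0::ennreal)"
    by (subst (asm) nn_integral_0_iff_AE) auto
  then show ?case by eventually_elim (auto simp: indicator_def split: if_splits)
qed

text \<open>The chain is unwound from its last step, which replaces \<open>h\<close> by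
  \<open>K_nn \<beta> h\<close>; this is why the induction ranges over all \<open>h\<close>.\<close>

lemma nn_integral_pos:
  "h \<in> borel_measurable borel \<Longrightarrow> (\<integral>\<^sup>+\<omega>. h (pos j \<omega>) \<partial>P) = (K_nn \<beta> ^^ j) h x"
proof (induction j arbitrary: h)
  case 0
  then show ?case by (simp add: pos_def emeasure_space_1)
next
  case (Suc j)
  then show ?case using nn_integral_pos_Suc[OF Suc.prems AE_pos]
    by (simp add: funpow_swap1)
qed

definition total_occupation :: "(real \<Rightarrow> ennreal) \<Rightarrow> 'w \<Rightarrow> ennreal" where
  "total_occupation h \<omega> = (\<Sum>j. excursion_occupation h (\<lambda>t. - S (Suc j) t \<omega>) (pos j \<omega>))"

lemma total_occupation_W: "total_occupation h \<omega> = (\<Sum>j. excursion_occupation h (W (Suc j) \<omega>) (pos j \<omega>))"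
  by (simp add: total_occupation_def W_functionals)

lemma total_occupation_measurable:
  assumes [measurable]: "h \<in> borel_measurable borel"
  shows "total_occupation h \<in> borel_measurable P"
proof -
  have [measurable]: "W (Suc j) \<in> P \<rightarrow>\<^sub>M path_space" for j by (rule W_measurable) simp
  show ?thesis unfolding total_occupation_W[abs_def] by measurable
qed

text \<open>For each piece, integrating out the next path at a frozen start gives
  \<open>J_nn\<close>, and \<open>nn_integral_pos\<close> then averages over the start.\<close>

lemma nn_integral_total_occupation:
  assumes [measurable]: "h \<in> borel_measurable borel"
  shows "(\<integral>\<^sup>+\<omega>. total_occupation h \<omega> \<partial>P) = (\<Sum>j. (K_nn \<beta> ^^ j) (J_nn \<beta> h) x)"
proof -
  have [measurable]: "W (Suc j) \<in> P \<rightarrow>\<^sub>M path_space" for j by (rule W_measurable) simp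
  have "(\<integral>\<^sup>+\<omega>. excursion_occupation h (W (Suc j) \<omega>) (pos j \<omega>) \<partial>P) = (K_nn \<beta> ^^ j) (J_nn \<beta> h) x" for j
  proof -
    interpret Y: subordinator P \<beta> "\<lambda>t \<omega>. - S (Suc j) t \<omega>" by (rule subordinator_S) simp
    have J: "(\<integral>\<^sup>+\<omega>. excursion_occupation h (\<lambda>t. - S (Suc j) t \<omega>) z \<partial>P) = J_nn \<beta> h z" for z
      unfolding excursion_occupation_def by (rule Y.nn_integral_occupation) measurable
    have "(\<integral>\<^sup>+\<omega>. excursion_occupation h (W (Suc j) \<omega>) (pos j \<omega>) \<partial>P) =
        (\<integral>\<^sup>+\<omega>. (\<lambda>(z, w). excursion_occupation h w z) (pos j \<omega>, W (Suc j) \<omega>) \<partial>P)" by simp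
    also have "\<dots> = (\<integral>\<^sup>+\<omega>. \<integral>\<^sup>+\<omega>'. (\<lambda>(z, w). excursion_occupation h w z) (pos j \<omega>, W (Suc j) \<omega>') \<partial>P \<partial>P)"
      by (rule nn_integral_pos_W) measurable
    also have "\<dots> = (\<integral>\<^sup>+\<omega>. J_nn \<beta> h (pos j \<omega>) \<partial>P)"
      by (simp add: W_functionals J)
    also have "\<dots> = (K_nn \<beta> ^^ j) (J_nn \<beta> h) x" by (rule nn_integral_pos) measurable
    finally show ?thesis .
  qed
  then show ?thesis unfolding total_occupation_W by (subst nn_integral_suminf) auto
qed

lemma AE_good: "AE \<omega> in P. (\<forall>j. good_path (\<lambda>t. - S (Suc j) t \<omega>)) \<and> (\<forall>j. 0 < pos j \<omega>)"
proof (intro AE_conjI)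
  show "AE \<omega> in P. \<forall>j. good_path (\<lambda>t. - S (Suc j) t \<omega>)"
    unfolding AE_all_countable using subordinator.AE_good_path[OF subordinator_S] by simp
  show "AE \<omega> in P. \<forall>j. 0 < pos j \<omega>" unfolding AE_all_countable using AE_pos by simp
qed

text \<open>The positive and negative parts of \<open>g\<close> obey the same power bound, so their
  expected occupations are finite values of \<open>I_op\<close>. Both occupations are then finite
  almost surely, which makes the path integral exist and split.\<close>

lemma occupation_formula:
  assumes g: "power_bounded (\<alpha> - \<beta>) C g" and \<alpha>: "0 < \<alpha>" and f: "\<And>r. 0 < r \<Longrightarrow> r \<le> x \<Longrightarrow> f r = g r"
  shows "AE \<omega> in P. set_integrable lborel (alive_times x (\<lambda>j t. S j t \<omega>)) (\<lambda>s. f (the (cens_proc x (\<lambda>j t. S j t \<omega>) s)))"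
    and "has_bochner_integral (completion P) (\<lambda>\<omega>. occupation_integral f x (\<lambda>j t. S j t \<omega>)) (I_op \<beta> g x)"
proof -
  note [measurable] = power_boundedD(1)[OF g]
  define gp gn where "gp r = max 0 (g r)" and "gn r = max 0 (- g r)" for r
  have pb: "power_bounded (\<alpha> - \<beta>) C gp" "power_bounded (\<alpha> - \<beta>) C gn"
    using power_boundedD[OF g] unfolding power_bounded_def gp_def gn_def
    by (auto simp: abs_le_iff max_def)
  have I: "I_op \<beta> g x = I_op \<beta> gp x - I_op \<beta> gn x"
  proof -
    have "g = (\<lambda>r. gp r - gn r)" by (auto simp: gp_def gn_def max_def)
    then show ?thesis using I_op_diff[OF \<alpha> \<beta> pb x] by simp
  qed
  define Op On where "Op = total_occupation (\<lambda>r. ennreal (g r))" and "On = total_occupation (\<lambda>r. ennreal (- g r))"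
  have [measurable]: "Op \<in> borel_measurable P" "On \<in> borel_measurable P"
    unfolding Op_def On_def by (rule total_occupation_measurable; measurable)+
  \<comment> \<open>\<open>ennreal\<close> already truncates negative values to 0, so taking the
    positive part first changes nothing.\<close>
  have "(\<lambda>r. ennreal (gp r)) = (\<lambda>r. ennreal (g r))" "(\<lambda>r. ennreal (gn r)) = (\<lambda>r. ennreal (- g r))"
    by (auto simp: gp_def gn_def max_def ennreal_neg)
  then have int: "(\<integral>\<^sup>+\<omega>. Op \<omega> \<partial>P) = ennreal (I_op \<beta> gp x)" "(\<integral>\<^sup>+\<omega>. On \<omega> \<partial>P) = ennreal (I_op \<beta> gn x)"
    using I_op_nn(1)[OF \<alpha> \<beta> pb(1) _ x] I_op_nn(1)[OF \<alpha> \<beta> pb(2) _ x]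
    by (simp_all add: Op_def On_def nn_integral_total_occupation gp_def gn_def)
  have nonneg: "0 \<le> I_op \<beta> gp x" "0 \<le> I_op \<beta> gn x"
    using I_op_nn(2)[OF \<alpha> \<beta> pb(1) _ x] I_op_nn(2)[OF \<alpha> \<beta> pb(2) _ x] by (auto simp: gp_def gn_def)
  have fin: "AE \<omega> in P. Op \<omega> \<noteq> \<infinity>" "AE \<omega> in P. On \<omega> \<noteq> \<infinity>"
    by (rule nn_integral_PInf_AE; simp add: int)+
  have hp: "has_bochner_integral P (\<lambda>\<omega>. enn2real (Op \<omega>)) (I_op \<beta> gp x)"
  proof (rule has_bochner_integral_nn_integral)
    have "(\<integral>\<^sup>+\<omega>. ennreal (enn2real (Op \<omega>)) \<partial>P) = (\<integral>\<^sup>+\<omega>. Op \<omega> \<partial>P)"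
      by (rule nn_integral_cong_AE) (use fin(1) in eventually_elim, simp add: less_top)
    then show "(\<integral>\<^sup>+\<omega>. ennreal (enn2real (Op \<omega>)) \<partial>P) = ennreal (I_op \<beta> gp x)" using int by simp
  qed (use nonneg in auto)
  have hn: "has_bochner_integral P (\<lambda>\<omega>. enn2real (On \<omega>)) (I_op \<beta> gn x)"
  proof (rule has_bochner_integral_nn_integral)
    have "(\<integral>\<^sup>+\<omega>. ennreal (enn2real (On \<omega>)) \<partial>P) = (\<integral>\<^sup>+\<omega>. On \<omega> \<partial>P)"
      by (rule nn_integral_cong_AE) (use fin(2) in eventually_elim, simp add: less_top)
    then show "(\<integral>\<^sup>+\<omega>. ennreal (enn2real (On \<omega>)) \<partial>P) = ennreal (I_op \<beta> gn x)" using int by simp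
  qed (use nonneg in auto)
  define D where "D \<omega> = enn2real (Op \<omega>) - enn2real (On \<omega>)" for \<omega>
  have hD: "has_bochner_integral P D (I_op \<beta> g x)"
    unfolding D_def I by (rule has_bochner_integral_diff[OF hp hn])
  have Dm: "D \<in> borel_measurable P" unfolding D_def by measurable
  have path: "AE \<omega> in P. set_integrable lborel (alive_times x (\<lambda>j t. S j t \<omega>)) (\<lambda>s. f (the (cens_proc x (\<lambda>j t. S j t \<omega>) s)))
      \<and> occupation_integral f x (\<lambda>j t. S j t \<omega>) = D \<omega>"
    using AE_good fin
  proof eventually_elim
    case (elim \<omega>)
    \<comment> \<open>The double negation matches the abbreviation \<open>S\<close> of
      \<open>restarted_paths\<close>, the negative of its parameter \<open>y\<close>.\<close>
    have "set_integrable lborel (alive_times x (\<lambda>j t. - (- S j t \<omega>))) (\<lambda>s. f (the (cens_proc x (\<lambda>j t. - (- S j t \<omega>)) s)))"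
      "occupation_integral f x (\<lambda>j t. - (- S j t \<omega>)) = D \<omega>"
      using elim restarted_paths.occupation_integral_eq[where y="\<lambda>j t. - S j t \<omega>" and x=x and g=g and f=f] f
      by (auto simp: restarted_paths_def pos_def D_def Op_def On_def total_occupation_def less_top)
    then show ?case by simp
  qed
  then show "AE \<omega> in P. set_integrable lborel (alive_times x (\<lambda>j t. S j t \<omega>)) (\<lambda>s. f (the (cens_proc x (\<lambda>j t. S j t \<omega>) s)))"
    by eventually_elim simp
  have ae: "AE \<omega> in P. occupation_integral f x (\<lambda>j t. S j t \<omega>) = D \<omega>"
    using path by eventually_elim simp
  have "has_bochner_integral (completion P) D (I_op \<beta> g x)"
    using hD Dm by (simp add: has_bochner_integral_iff integrable_completion integral_completion)
  then show "has_bochner_integral (completion P) (\<lambda>\<omega>. occupation_integral f x (\<lambda>j t. S j t \<omega>)) (I_op \<beta> g x)"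
    using has_bochner_integral_cong_AE[OF measurable_completion_AE[OF Dm ae] measurable_completion[OF Dm] AE_completion[OF ae]]
    by simp
qed

end

theorem proposition4p5:
  fixes \<beta> T :: real and g :: "real \<Rightarrow> real"
  assumes "0 < \<beta>" "\<beta> < 1" and "0 < T"
    and "(continuous_on {0<..T} g \<and>
            (\<exists>C>0. \<exists>\<alpha>>0. \<forall>x\<in>{0<..T}. \<bar>g x\<bar> \<le> C * x powr (\<alpha> - \<beta>)))
         \<or> g \<in> bounded_borel T"
  shows "uniform_limit {0..T} (\<lambda>n x. \<Sum>j<n. (K_op \<beta> ^^ j) (J_op \<beta> g) x) (I_op \<beta> g) sequentially
    \<and> I_op \<beta> g \<in> C_infty T
    \<and> (\<forall>(P :: 'w measure) (S :: nat \<Rightarrow> real \<Rightarrow> 'w \<Rightarrow> real).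
         iid_stable_subordinators P \<beta> (\<lambda>j t \<omega>. - S j t \<omega>) \<longrightarrow>
         (\<forall>x\<in>{0<..T}.
            (AE \<omega> in P. set_integrable lborel (alive_times x (\<lambda>j t. S j t \<omega>))
                          (\<lambda>s. g (the (cens_proc x (\<lambda>j t. S j t \<omega>) s))))
          \<and> integrable (completion P) (\<lambda>\<omega>. occupation_integral g x (\<lambda>j t. S j t \<omega>))
          \<and> I_op \<beta> g x =
              (LINT \<omega>|completion P. occupation_integral g x (\<lambda>j t. S j t \<omega>))))"
proof -
  note \<beta> = assms(1,2)
  \<comment> \<open>Cutting off outside (0,T] makes either hypothesis a power bound for a Borel
    function on the whole line. The point 0 is left out because in the first case nothing is known
    about \<open>g\<close> there.\<close>
  define G where "G r = indicator {0<..T} r *\<^sub>R g r" for r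
  have gG: "g r = G r" if "0 < r" "r \<le> T" for r using that by (simp add: G_def)
  have Gm: "G \<in> borel_measurable borel"
  proof -
    have "g \<in> borel_measurable (restrict_space borel {0<..T})"
      using assms(4)
    proof
      assume "continuous_on {0<..T} g \<and> (\<exists>C>0. \<exists>\<alpha>>0. \<forall>x\<in>{0<..T}. \<bar>g x\<bar> \<le> C * x powr (\<alpha> - \<beta>))"
      then show ?thesis by (intro borel_measurable_continuous_on_restrict) simp
    next
      assume "g \<in> bounded_borel T"
      then have "g \<in> borel_measurable (restrict_space borel {0..T})" by (simp add: bounded_borel_def)
      then show ?thesis by (rule measurable_restrict_mono) auto
    qed
    then show ?thesis
      unfolding G_def[abs_def] by (subst (asm) borel_measurable_restrict_space_iff) auto
  qed
  obtain C \<alpha> where C: "0 \<le> C" "0 < \<alpha>" and bd: "\<And>r. 0 < r \<Longrightarrow> r \<le> T \<Longrightarrow> \<bar>g r\<bar> \<le> C * r powr (\<alpha> - \<beta>)"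
    using assms(4)
  proof
    assume "continuous_on {0<..T} g \<and> (\<exists>C>0. \<exists>\<alpha>>0. \<forall>x\<in>{0<..T}. \<bar>g x\<bar> \<le> C * x powr (\<alpha> - \<beta>))"
    then obtain C \<alpha> where "0 < C" "0 < \<alpha>" "\<forall>x\<in>{0<..T}. \<bar>g x\<bar> \<le> C * x powr (\<alpha> - \<beta>)" by blast
    then show thesis by (intro that[of C \<alpha>]) auto
  next
    assume "g \<in> bounded_borel T"
    then obtain B where "\<forall>r\<in>{0..T}. \<bar>g r\<bar> \<le> B"
      by (auto simp: bounded_borel_def bounded_iff)
    then have B: "\<bar>g r\<bar> \<le> B" if "0 \<le> r" "r \<le> T" for r using that by simp
    then have "0 \<le> B" using B[of T] assms(3) by linarith
    \<comment> \<open>A bounded function is the case \<alpha> = \<beta>, where the weight r powr 0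
      is 1.\<close>
    then show thesis using B \<beta> by (intro that[of B \<beta>]) auto
  qed
  have G: "power_bounded (\<alpha> - \<beta>) C G"
    using Gm bd C by (auto simp: power_bounded_def G_def indicator_def)
  have it: "(K_op \<beta> ^^ j) (J_op \<beta> g) r = (K_op \<beta> ^^ j) (J_op \<beta> G) r" if "r \<in> {0..T}" for j r
    using that gG by (intro funpow_K_op_cong[where T=T]) auto
  have Ieq: "I_op \<beta> g r = I_op \<beta> G r" if "r \<in> {0..T}" for r
    unfolding I_op_def it[OF that] ..
  have "uniform_limit {0..T} (\<lambda>n x. \<Sum>j<n. (K_op \<beta> ^^ j) (J_op \<beta> g) x) (I_op \<beta> g) sequentially"
    using I_op_uniform_limit[OF C(2) \<beta> G, of T]
    by (rule uniform_limit_cong'[THEN iffD1, rotated -1]) (auto simp: it Ieq)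
  moreover have "I_op \<beta> g \<in> C_infty T"
    using I_op_C_infty[OF C(2) \<beta> G, of T] Ieq assms(3) continuous_on_cong[OF refl Ieq, of "{0..T}"]
    by (simp add: C_infty_def)
  moreover have "(AE \<omega> in P. set_integrable lborel (alive_times x (\<lambda>j t. S j t \<omega>))
                          (\<lambda>s. g (the (cens_proc x (\<lambda>j t. S j t \<omega>) s))))
          \<and> integrable (completion P) (\<lambda>\<omega>. occupation_integral g x (\<lambda>j t. S j t \<omega>))
          \<and> I_op \<beta> g x = (LINT \<omega>|completion P. occupation_integral g x (\<lambda>j t. S j t \<omega>))"
    if "iid_stable_subordinators P \<beta> (\<lambda>j t \<omega>. - S j t \<omega>)" and xT: "x \<in> {0<..T}"
    for P :: "'w measure" and S :: "nat \<Rightarrow> real \<Rightarrow> 'w \<Rightarrow> real" and x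
  proof -
    interpret censored_process P \<beta> S x
      using that \<beta> by unfold_locales auto
    have eq: "g r = G r" if "0 < r" "r \<le> x" for r using that xT gG by auto
    show ?thesis
      using occupation_formula[OF G C(2) eq] Ieq[of x] xT by (auto simp: has_bochner_integral_iff)
  qed
  ultimately show ?thesis by blast
qed

end
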